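(* Let $T$ be a Calderón–Zygmund operator in $\mathbb{R}^n$ with maximal truncated version $T_{\natural}$. Let $1<p<\infty$, $p'=p/(p-1)$, and let $X$ and $Y$ be Banach function spaces over $\mathbb{R}^n$ such that $M_{X'}$ is bounded on $L^{p'}(\mathbb{R}^n)$ and $M_{Y'}$ is bounded on $L^{p}(\mathbb{R}^n)$. Then there is a constant $c$, independent of the weights, such that for all weights $u,v$ on $\mathbb{R}^n$, $$\|T_{\natural}\|_{L^p(v)\to L^p(u)}\le c\,\sup_Q\|u^{1/p}\|_{X,Q}\,\|v^{-1/p}\|_{Y,Q},$$ where the supremum is over all cubes $Q\subset\mathbb{R}^n$.
   Context: A weight is a non-negative locally integrable function on $\mathbb{R}^n$; $\|f\|_{L^p(w)}=(\int|f|^pw\,dx)^{1/p}$. Calderón–Zygmund operator: an $L^2(\mathbb{R}^n)$-bounded integral operator $T$ with kernel $K$ (so $Tf(x)=\int K(x,y)f(y)\,dy$ for $x\notin\operatorname{supp} f$) satisfying, for some constant $c$ and some $0<\delta\le 1$: (i) $|K(x,y)|\le \frac{c}{|x-y|^n}$ for all $x\ne y$; (ii) $|K(x,y)-K(x',y)|+|K(y,x)-K(y,x')|\le c\frac{|x-x'|^{\delta}}{|x-y|^{n+\delta}}$ whenever $|x-x'|<|x-y|/2$. Its maximal truncated version is $$T_{\natural}f(x)=\sup_{0<\varepsilon<\nu}\Big|\int_{\varepsilon<|x-y|<\nu}K(x,y)f(y)\,dy\Big|.$$ Banach function space (over $\mathbb{R}^n$ with Lebesgue measure) is understood in the sense of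 Bennett–Sharpley: $\|f\|_X=\rho(|f|)$, where $\rho$ is a functional on non-negative measurable functions with values in $[0,\infty]$ that is a norm up to a.e. equality, is monotone, has the Fatou property ($0\le f_m\uparrow f$ a.e. implies $\rho(f_m)\uparrow\rho(f)$), satisfies $\rho(\chi_E)<\infty$ whenever $|E|<\infty$, and $\int_E f\le C_E\,\rho(f)$ whenever $|E|<\infty$. The associate space $X'$ has norm $\|f\|_{X'}=\sup_{\|g\|_X\le1}\int_{\mathbb{R}^n}|fg|\,dx$. For a cube $Q$ with sidelength $\ell_Q$, the $X$-average of $f$ over $Q$ is $\|f\|_{X,Q}=\|(f\chi_Q)(\ell_Q\,\cdot)\|_X$, and $M_Xf(x)=\sup_{Q\ni x}\|f\|_{X,Q}$ (supremum over all cubes containing $x$); $M_{X'}$, $M_{Y'}$ are defined in the same way from $X'$, $Y'$. *)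

theory Defs
  imports "HOL-Analysis.Analysis"
begin

section \<open>Weighted Lebesgue spaces\<close>

text \<open>Real powers on \<open>[0,\<infinity>]\<close>, meant for exponents \<open>a > 0\<close> only.\<close>

definition ennreal_powr :: "ennreal \<Rightarrow> real \<Rightarrow> ennreal" where
  "ennreal_powr x a = (if x = \<infinity> then \<infinity> else ennreal (enn2real x powr a))"

definition weight :: "('a::euclidean_space \<Rightarrow> real) \<Rightarrow> bool" where
  "weight w \<longleftrightarrow> (\<forall>x. 0 \<le> w x) \<and> (\<forall>S. compact S \<longrightarrow> w absolutely_integrable_on S)"

text \<open>
  Norms are defined on nonnegative, \<open>[0,\<infinity>]\<close>-valued functions and are applied to the
  modulus of a complex-valued function. Measurability always means Lebesgue measurability.
\<close>

definition Lp_norm :: "real \<Rightarrow> ('a::euclidean_space \<Rightarrow> real) \<Rightarrow> ('a \<Rightarrow> ennreal) \<Rightarrow> ennreal" where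
  "Lp_norm p w f =
     ennreal_powr (\<integral>\<^sup>+ x. ennreal_powr (f x) p * ennreal (w x) \<partial>lebesgue) (1 / p)"

abbreviation modulus :: "('a \<Rightarrow> complex) \<Rightarrow> 'a \<Rightarrow> ennreal" where
  "modulus f \<equiv> (\<lambda>x. ennreal (cmod (f x)))"

definition L2_functions :: "('a::euclidean_space \<Rightarrow> complex) set" where
  "L2_functions = {f \<in> borel_measurable lebesgue. Lp_norm 2 (\<lambda>_. 1) (modulus f) < \<infinity>}"

text \<open>
  The norm from \<open>L\<^sup>p(v)\<close> to \<open>L\<^sup>p(u)\<close> of a (positively homogeneous) operator with values in
  \<open>[0,\<infinity>]\<close>. A supremum over the unit ball is used since \<open>C * \<parallel>f\<parallel>\<close> would vanish
  for \<open>C = \<infinity>\<close> and \<open>\<parallel>f\<parallel> = 0\<close>.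
\<close>

definition weighted_opnorm ::
  "real \<Rightarrow> ('a::euclidean_space \<Rightarrow> real) \<Rightarrow> ('a \<Rightarrow> real) \<Rightarrow>
     (('a \<Rightarrow> complex) \<Rightarrow> 'a \<Rightarrow> ennreal) \<Rightarrow> ennreal" where
  "weighted_opnorm p v u S =
     (SUP f \<in> {f \<in> borel_measurable lebesgue. Lp_norm p v (modulus f) \<le> 1}. Lp_norm p u (S f))"

section \<open>Calderon--Zygmund operators\<close>

text \<open>The values of the kernel on the diagonal are irrelevant.\<close>

definition CZ_kernel :: "('a::euclidean_space \<Rightarrow> 'a \<Rightarrow> complex) \<Rightarrow> bool" where
  "CZ_kernel K \<longleftrightarrow>
     (\<exists>c \<delta>::real. 0 < \<delta> \<and> \<delta> \<le> 1 \<and>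
        (\<forall>x y. x \<noteq> y \<longrightarrow> cmod (K x y) \<le> c / norm (x - y) ^ DIM('a)) \<and>
        (\<forall>x x' y. norm (x - x') < norm (x - y) / 2 \<longrightarrow>
           cmod (K x y - K x' y) + cmod (K y x - K y x')
             \<le> c * (norm (x - x') powr \<delta> / norm (x - y) powr (DIM('a) + \<delta>))))"

text \<open>
  \<open>T\<close> acts on representatives of \<open>L\<^sup>2\<close> functions, so its properties hold almost everywhere.
\<close>

definition CZ_operator ::
  "(('a::euclidean_space \<Rightarrow> complex) \<Rightarrow> 'a \<Rightarrow> complex) \<Rightarrow> ('a \<Rightarrow> 'a \<Rightarrow> complex) \<Rightarrow> bool" where
  "CZ_operator T K \<longleftrightarrow>
     CZ_kernel K \<and>
     (\<forall>f \<in> L2_functions. T f \<in> L2_functions) \<and>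
     (\<forall>f \<in> L2_functions. \<forall>g \<in> L2_functions. \<forall>a b.
        AE x in lebesgue. T (\<lambda>y. a * f y + b * g y) x = a * T f x + b * T g x) \<and>
     (\<exists>C::real. \<forall>f \<in> L2_functions.
        Lp_norm 2 (\<lambda>_. 1) (modulus (T f)) \<le> ennreal C * Lp_norm 2 (\<lambda>_. 1) (modulus f)) \<and>
     (\<forall>f \<in> L2_functions.
        AE x in lebesgue. x \<notin> closure {y. f y \<noteq> 0} \<longrightarrow> T f x = (LINT y|lebesgue. K x y * f y))"

definition maximal_truncation ::
  "('a::euclidean_space \<Rightarrow> 'a \<Rightarrow> complex) \<Rightarrow> ('a \<Rightarrow> complex) \<Rightarrow> 'a \<Rightarrow> ennreal" where
  "maximal_truncation K f x =
     (SUP (\<epsilon>, \<nu>) \<in> {(\<epsilon>::real, \<nu>). 0 < \<epsilon> \<and> \<epsilon> < \<nu>}.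
        ennreal (cmod (LINT y:{y. \<epsilon> < norm (x - y) \<and> norm (x - y) < \<nu>}|lebesgue. K x y * f y)))"

section \<open>Banach function spaces\<close>

text \<open>
  A Banach function space is represented by its function norm \<open>\<rho>\<close>, whose values on
  non-measurable functions are irrelevant.
\<close>

locale banach_function_norm =
  fixes \<rho> :: "('a::euclidean_space \<Rightarrow> ennreal) \<Rightarrow> ennreal"
  assumes eq_0_iff: "f \<in> borel_measurable lebesgue \<Longrightarrow> \<rho> f = 0 \<longleftrightarrow> (AE x in lebesgue. f x = 0)"
    and scale: "f \<in> borel_measurable lebesgue \<Longrightarrow> 0 \<le> a \<Longrightarrow>
      \<rho> (\<lambda>x. ennreal a * f x) = ennreal a * \<rho> f"
    and triangle: "f \<in> borel_measurable lebesgue \<Longrightarrow> g \<in> borel_measurable lebesgue \<Longrightarrow>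
      \<rho> (\<lambda>x. f x + g x) \<le> \<rho> f + \<rho> g"
    and mono: "f \<in> borel_measurable lebesgue \<Longrightarrow> g \<in> borel_measurable lebesgue \<Longrightarrow>
      (AE x in lebesgue. g x \<le> f x) \<Longrightarrow> \<rho> g \<le> \<rho> f"
    and fatou: "(\<And>m. F m \<in> borel_measurable lebesgue) \<Longrightarrow> f \<in> borel_measurable lebesgue \<Longrightarrow>
      (AE x in lebesgue. incseq (\<lambda>m::nat. F m x) \<and> (\<lambda>m. F m x) \<longlonglongrightarrow> f x) \<Longrightarrow>
      incseq (\<lambda>m. \<rho> (F m)) \<and> (\<lambda>m. \<rho> (F m)) \<longlonglongrightarrow> \<rho> f"
    and indicator_finite: "E \<in> sets lebesgue \<Longrightarrow> emeasure lebesgue E < \<infinity> \<Longrightarrow>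
      \<rho> (indicator E) < \<infinity>"
    and integral_le: "E \<in> sets lebesgue \<Longrightarrow> emeasure lebesgue E < \<infinity> \<Longrightarrow>
      \<exists>C::real. \<forall>f \<in> borel_measurable lebesgue.
        (\<integral>\<^sup>+ x \<in> E. f x \<partial>lebesgue) \<le> ennreal C * \<rho> f"

definition associate_norm ::
  "(('a::euclidean_space \<Rightarrow> ennreal) \<Rightarrow> ennreal) \<Rightarrow> ('a \<Rightarrow> ennreal) \<Rightarrow> ennreal" where
  "associate_norm \<rho> f =
     (SUP g \<in> {g \<in> borel_measurable lebesgue. \<rho> g \<le> 1}. \<integral>\<^sup>+ x. f x * g x \<partial>lebesgue)"

section \<open>Averages over cubes\<close>

text \<open>
  Cubes are closed with sides parallel to the axes; they are parametrised by their lower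
  corner and side length.
\<close>

definition cube :: "'a::euclidean_space \<Rightarrow> real \<Rightarrow> 'a set" where
  "cube a l = cbox a (a + l *\<^sub>R One)"

definition cube_average ::
  "(('a::euclidean_space \<Rightarrow> ennreal) \<Rightarrow> ennreal) \<Rightarrow> 'a \<Rightarrow> real \<Rightarrow> ('a \<Rightarrow> ennreal) \<Rightarrow> ennreal" where
  "cube_average \<rho> a l f = \<rho> (\<lambda>x. f (l *\<^sub>R x) * indicator (cube a l) (l *\<^sub>R x))"

definition maximal_function ::
  "(('a::euclidean_space \<Rightarrow> ennreal) \<Rightarrow> ennreal) \<Rightarrow> ('a \<Rightarrow> ennreal) \<Rightarrow> 'a \<Rightarrow> ennreal" where
  "maximal_function \<rho> f x =
     (SUP (a, l) \<in> {(a, l). 0 < l \<and> x \<in> cube a l}. cube_average \<rho> a l f)"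

definition maximal_bounded_on_Lp ::
  "(('a::euclidean_space \<Rightarrow> ennreal) \<Rightarrow> ennreal) \<Rightarrow> real \<Rightarrow> bool" where
  "maximal_bounded_on_Lp \<rho> q \<longleftrightarrow>
     (\<exists>C::real. \<forall>f \<in> borel_measurable lebesgue. Lp_norm q (\<lambda>_. 1) f < \<infinity> \<longrightarrow>
        Lp_norm q (\<lambda>_. 1) (maximal_function \<rho> f) \<le> ennreal C * Lp_norm q (\<lambda>_. 1) f)"

text \<open>
  \<open>v\<^bsup>-1/p\<^esup>\<close> takes the value \<open>\<infinity>\<close> where \<open>v\<close> vanishes (note that \<open>0 powr a = 0\<close> for every \<open>a\<close>).
  A product of a zero and an infinite average is \<open>0\<close>.
\<close>

definition two_weight_bump ::
  "(('a::euclidean_space \<Rightarrow> ennreal) \<Rightarrow> ennreal) \<Rightarrow> (('a \<Rightarrow> ennreal) \<Rightarrow> ennreal) \<Rightarrow> real \<Rightarrow>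
     ('a \<Rightarrow> real) \<Rightarrow> ('a \<Rightarrow> real) \<Rightarrow> ennreal" where
  "two_weight_bump X Y p u v =
     (SUP (a, l) \<in> {(a, l). 0 < l}.
        cube_average X a l (\<lambda>x. ennreal (u x powr (1 / p))) *
        cube_average Y a l (\<lambda>x. inverse (ennreal (v x powr (1 / p)))))"

end

theory Submission
  imports Defs
begin

text \<open>
  The estimate is proved by localisation to dyadic cubes, without choosing a sparse family. If
  \<open>Q\<close> is a dyadic cube and \<open>E\<close> is the set where \<open>T\<^sub>\<natural>(f\<chi>\<^bsub>3Q\<^esub>)\<close> or the Hardy--Littlewood maximal
  function of \<open>f\<chi>\<^bsub>3Q\<^esub>\<close> exceeds a large multiple of the average of \<open>|f|\<close> over \<open>3Q\<close>, then the maximal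
  dyadic cubes \<open>P\<close> with large density of \<open>E\<close> fill at most half of \<open>Q\<close>, and the smoothness of the
  kernel gives \<open>T\<^sub>\<natural>(f\<chi>\<^bsub>3Q\<^esub>) \<le> C avg |f| + T\<^sub>\<natural>(f\<chi>\<^bsub>3P\<^esub>)\<close> on \<open>P\<close>. Testing against \<open>w = g u\<^bsup>1/p\<^esup>\<close>
  and using Hoelder's inequality for \<open>X, X'\<close> and \<open>Y, Y'\<close>, the first term contributes at most a multiple
  of the bump constant times the integral over the uncovered half of \<open>Q\<close> of
  \<open>M\<^bsub>Y'\<^esub>(f v\<^bsup>1/p\<^esup>) M\<^bsub>X'\<^esub> g\<close>; these halves are disjoint for successive generations of cubes, so the
  contributions add up to one integral, which the two maximal hypotheses control.

  The weak type (1,1) bound for \<open>T\<^sub>\<natural>\<close> that makes \<open>E\<close> small is obtained directly from the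
  \<open>L\<^sup>2\<close> bound for \<open>T\<close>: the good part of a Calderon--Zygmund decomposition is treated by an
  \<open>L\<^sup>2\<close> version of Cotlar's inequality, so that the weak type of \<open>T\<close> itself is not needed.
\<close>

section \<open>Integrals over countable unions\<close>

text \<open>The weights enter only at the end, through the one hypothesis \<open>H\<close> of
  \<open>global_bound\<close>: on each dyadic cube a function \<open>G\<close> dominates the product
  of the averages of \<open>|f|\<close> over the triple and of \<open>w\<close> over the cube.
  Everything before that is unweighted.

  The left-hand side of that bound may be infinite, so nothing can be absorbed into it. The
  recursion is stopped after \<open>k\<close> generations instead. What it leaves is a set of
  measure at most \<open>2^(-k) |Q|\<close>, whose contribution is never estimated: it disappears in
  the limit by Borel-Cantelli and Fatou's lemma.

  Bochner integrals of non-integrable functions are 0, so additivity of truncations needs local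
  integrability. A function in the unit ball of \<open>L^p(v)\<close> does not have it by
  assumption; it is extracted from the finiteness of the bump constant together with the hypothesis
  on the maximal operator of \<open>Y'\<close>. The cases of an infinite bump constant and of
  \<open>u = 0\<close> almost everywhere are separated first, because a zero average times an
  infinite one is 0 and gives no information.\<close>

lemma nn_integral_UN_le:
  assumes "countable I" "\<And>i. i \<in> I \<Longrightarrow> X i \<in> sets M" "f \<in> borel_measurable M"
  shows "(\<integral>\<^sup>+x\<in>(\<Union>i\<in>I. X i). f x \<partial>M)
      \<le> (\<integral>\<^sup>+i. (\<integral>\<^sup>+x\<in>X i. f x \<partial>M) \<partial>count_space I)"
proof -
  have "f x * indicator (\<Union>i\<in>I. X i) x \<le> (\<integral>\<^sup>+i. f x
      * indicator (X i) x \<partial>count_space I)" for x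
  proof (cases "x \<in> (\<Union>i\<in>I. X i)")
    case True
    then obtain i where i: "i \<in> I" "x \<in> X i" by auto
    then have "f x * indicator (\<Union>i\<in>I. X i) x = f x * indicator (X i) x" by (auto simp: indicator_def)
    also have "\<dots> \<le> (\<integral>\<^sup>+i. f x * indicator (X i) x \<partial>count_space I)"
      using i by (intro nn_integral_ge_point)
    finally show ?thesis .
  qed simp
  then have "(\<integral>\<^sup>+x\<in>(\<Union>i\<in>I. X i). f x \<partial>M)
      \<le> (\<integral>\<^sup>+x. \<integral>\<^sup>+i. f x * indicator (X i) x \<partial>count_space I \<partial>M)"
    by (intro nn_integral_mono)
  also have "\<dots> = (\<integral>\<^sup>+i. (\<integral>\<^sup>+x\<in>X i. f x \<partial>M) \<partial>count_space I)"
    using assms by (intro nn_integral_count_space_nn_integral) auto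
  finally show ?thesis .
qed

text \<open>Sums over a countable family are written as integrals against
  \<open>count_space\<close>, so that finite and infinite families are treated alike and Tonelli's
  theorem interchanges sum and integral.\<close>

lemma nn_integral_UN_disjoint:
  assumes "countable I" "\<And>i. i \<in> I \<Longrightarrow> X i \<in> sets M" "f \<in> borel_measurable M"
    and disj: "disjoint_family_on X I"
  shows "(\<integral>\<^sup>+x\<in>(\<Union>i\<in>I. X i). f x \<partial>M)
      = (\<integral>\<^sup>+i. (\<integral>\<^sup>+x\<in>X i. f x \<partial>M) \<partial>count_space I)"
proof -
  have "f x * indicator (\<Union>i\<in>I. X i) x = (\<integral>\<^sup>+i. f x
      * indicator (X i) x \<partial>count_space I)" for x
  proof (cases "x \<in> (\<Union>i\<in>I. X i)")
    case True
    then obtain i0 where i: "i0 \<in> I" "x \<in> X i0" by auto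
    have "(\<integral>\<^sup>+i. f x * indicator (X i) x \<partial>count_space I) = (\<integral>\<^sup>+i. f x
        * indicator {i0} i \<partial>count_space I)"
      using i disj by (intro nn_integral_cong)
        (auto simp: disjoint_family_on_def indicator_def)
    also have "\<dots> = f x"
      using i by (simp add: nn_integral_cmult emeasure_count_space_finite)
    finally show ?thesis using True by simp
  next
    case False
    then have "(\<integral>\<^sup>+i. f x * indicator (X i) x \<partial>count_space I)
        = (\<integral>\<^sup>+i. 0 \<partial>count_space I)"
      by (intro nn_integral_cong) (auto simp: indicator_def)
    then show ?thesis using False by simp
  qed
  then have "(\<integral>\<^sup>+x\<in>(\<Union>i\<in>I. X i). f x \<partial>M)
      = (\<integral>\<^sup>+x. \<integral>\<^sup>+i. f x * indicator (X i) x \<partial>count_space I \<partial>M)"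
    by simp
  also have "\<dots> = (\<integral>\<^sup>+i. (\<integral>\<^sup>+x\<in>X i. f x \<partial>M) \<partial>count_space I)"
    using assms by (intro nn_integral_count_space_nn_integral) auto
  finally show ?thesis .
qed

lemma emeasure_UN_le:
  assumes "countable I" "\<And>i. i \<in> I \<Longrightarrow> X i \<in> sets M"
  shows "emeasure M (\<Union>i\<in>I. X i) \<le> (\<integral>\<^sup>+i. emeasure M (X i) \<partial>count_space I)"
proof -
  have U: "(\<Union>i\<in>I. X i) \<in> sets M"
    using assms by auto
  have "(\<integral>\<^sup>+i. (\<integral>\<^sup>+x\<in>X i. 1 \<partial>M) \<partial>count_space I)
      = (\<integral>\<^sup>+i. emeasure M (X i) \<partial>count_space I)"
    using assms by (intro nn_integral_cong) auto
  then show ?thesis using nn_integral_UN_le[of I X M "\<lambda>_. 1"] assms U by simp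
qed

lemma nn_set_integral_mono_set:
  "A \<subseteq> B \<Longrightarrow> (\<integral>\<^sup>+x\<in>A. f x \<partial>M)
      \<le> (\<integral>\<^sup>+x\<in>B. f x \<partial>M)"
  for f :: "'a \<Rightarrow> ennreal"
  by (intro nn_integral_mono) (auto simp: indicator_def)

section \<open>Superlevel sets of the Hardy--Littlewood maximal function\<close>

lemma open_in_sets_lebesgue: "open A \<Longrightarrow> A \<in> sets lebesgue"
  by auto

lemma ball_in_sets_lebesgue [measurable]: "ball x r \<in> sets lebesgue" for x :: "'a::euclidean_space"
  by simp

lemma emeasure_lebesgue_ball:
  "0 \<le> r \<Longrightarrow> emeasure lebesgue (ball (c::'a::euclidean_space) r)
      = ennreal (unit_ball_vol DIM('a) * r ^ DIM('a))"
  by (simp add: emeasure_ball)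

text \<open>The superlevel set at height \<open>t\<close> of the centred maximal function, with
  averages normalised by \<open>r ^ DIM('a)\<close> instead of the volume of the ball. Only these
  sets are used, so the maximal function itself is not introduced.\<close>

definition HL_set :: "('a::euclidean_space \<Rightarrow> ennreal) \<Rightarrow> real \<Rightarrow> 'a set" where
  "HL_set h t = {x. \<exists>r>0. ennreal (t * r ^ DIM('a))
      < (\<integral>\<^sup>+y\<in>ball x r. h y \<partial>lebesgue)}"

lemma not_HL_setD:
  fixes h :: "'a::euclidean_space \<Rightarrow> ennreal"
  assumes "x \<notin> HL_set h t" "0 < r" "A \<subseteq> ball x r"
  shows "(\<integral>\<^sup>+y\<in>A. h y \<partial>lebesgue) \<le> ennreal (t * r ^ DIM('a))"
proof (rule order_trans)
  show "(\<integral>\<^sup>+y\<in>A. h y \<partial>lebesgue)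
      \<le> (\<integral>\<^sup>+y\<in>ball x r. h y \<partial>lebesgue)"
    by (rule nn_set_integral_mono_set[OF assms(3)])
  show "(\<integral>\<^sup>+y\<in>ball x r. h y \<partial>lebesgue) \<le> ennreal (t * r ^ DIM('a))"
  proof (rule ccontr)
    assume "\<not> ?thesis"
    then have "x \<in> HL_set h t" using assms(2) unfolding HL_set_def not_le by blast
    then show False using assms(1) by simp
  qed
qed

text \<open>If the mass of \<open>ball x r\<close> exceeds the bound strictly, so does the mass of a
  slightly smaller ball, and that ball is contained in \<open>ball x' r\<close> for all
  \<open>x'\<close> near \<open>x\<close>. Besides measurability this makes the exceptional set in
  \<open>stopping_cubes\<close> open.\<close>

lemma open_HL_set:
  fixes h :: "'a::euclidean_space \<Rightarrow> ennreal"
  assumes h: "h \<in> borel_measurable lebesgue"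
  shows "open (HL_set h t)"
proof (rule openI)
  fix x assume "x \<in> HL_set h t"
  then obtain r where r: "r > 0" "ennreal (t * r ^ DIM('a))
      < (\<integral>\<^sup>+y\<in>ball x r. h y \<partial>lebesgue)"
    by (auto simp: HL_set_def)
  define B where "B k = ball x (r - 1 / real (Suc k))" for k
  have B_sets: "B k \<in> sets lebesgue" for k by (simp add: B_def)
  have inc: "incseq B"
    unfolding B_def by (intro incseq_SucI subset_ball) (simp add: field_simps)
  have UN: "(\<Union>k. B k) = ball x r"
  proof (intro antisym subsetI)
    fix y assume "y \<in> ball x r"
    then have "0 < r - dist x y" by simp
    then obtain k where "1 / real (Suc k) < r - dist x y" using nat_approx_posE by blast
    then show "y \<in> (\<Union>k. B k)" by (auto simp: B_def intro!: exI[of _ k])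
  qed (auto simp: B_def intro: less_le_trans)
  have "(SUP k. emeasure (density lebesgue h) (B k)) = emeasure (density lebesgue h) (ball x r)"
    unfolding UN[symmetric] using B_sets by (intro SUP_emeasure_incseq inc) auto
  then have "ennreal (t * r ^ DIM('a)) < (SUP k. \<integral>\<^sup>+y\<in>B k. h y \<partial>lebesgue)"
    using r h B_sets by (simp add: emeasure_density)
  then obtain k where k: "ennreal (t * r ^ DIM('a)) < (\<integral>\<^sup>+y\<in>B k. h y \<partial>lebesgue)"
    by (auto simp: less_SUP_iff)
  show "\<exists>e>0. ball x e \<subseteq> HL_set h t"
  proof (intro exI conjI subsetI)
    fix x' assume "x' \<in> ball x (1 / real (Suc k))"
    then have d: "dist x' x < 1 / real (Suc k)" by (simp add: dist_commute)
    have "B k \<subseteq> ball x' r"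
    proof
      fix y assume "y \<in> B k"
      then have "dist x y < r - 1 / real (Suc k)" by (simp add: B_def)
      then show "y \<in> ball x' r" using dist_triangle[of x' y x] d by simp
    qed
    then have "ennreal (t * r ^ DIM('a)) < (\<integral>\<^sup>+y\<in>ball x' r. h y \<partial>lebesgue)"
      by (rule less_le_trans[OF k nn_set_integral_mono_set])
    then show "x' \<in> HL_set h t" using r by (auto simp: HL_set_def)
  qed simp
qed

text \<open>Weak type (1,1) from Vitali's covering lemma, the source of \<open>5 ^ DIM('a)\<close>.
  The covering lemma requires bounded radii, which is why an infinite integral is treated
  separately.\<close>

lemma emeasure_HL_set_le:
  fixes h :: "'a::euclidean_space \<Rightarrow> ennreal"
  assumes h: "h \<in> borel_measurable lebesgue" and t: "0 < t"
  shows "emeasure lebesgue (HL_set h t)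
    \<le> ennreal (unit_ball_vol DIM('a) * 5 ^ DIM('a) / t) * (\<integral>\<^sup>+x. h x \<partial>lebesgue)"
proof (cases "(\<integral>\<^sup>+x. h x \<partial>lebesgue) = \<infinity>")
  case True
  define c where "c = unit_ball_vol DIM('a) * 5 ^ DIM('a) / t"
  have "0 < c"
    using t unit_ball_vol_pos[of "real DIM('a)"] by (simp add: c_def)
  then have "ennreal c * \<infinity> = \<infinity>"
    by (simp add: ennreal_mult_top)
  then show ?thesis unfolding True c_def[symmetric] by simp
next
  case False
  let ?n = "DIM('a)"
  obtain I where I: "0 \<le> I" "(\<integral>\<^sup>+x. h x \<partial>lebesgue) = ennreal I"
    using False by (cases "(\<integral>\<^sup>+x. h x \<partial>lebesgue)") auto
  define K where "K = {(x, r). r > 0 \<and> ennreal (t * r ^ ?n)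
      < (\<integral>\<^sup>+y\<in>ball x r. h y \<partial>lebesgue)}"
  have bound: "0 < snd i \<and> snd i \<le> max 1 (I / t)" if i: "i \<in> K" for i
  proof -
    obtain x r where xr: "i = (x, r)" by (cases i)
    have r: "r > 0" using i xr by (simp add: K_def)
    have "ennreal (t * r ^ ?n) < (\<integral>\<^sup>+y\<in>ball x r. h y \<partial>lebesgue)" using i xr
        by (simp add: K_def)
    also have "\<dots> \<le> ennreal I" unfolding I(2)[symmetric]
      by (intro nn_integral_mono) (auto simp: indicator_def)
    finally have "t * r ^ ?n < I" using I(1) t r by (simp add: ennreal_less_iff)
    then have le: "r ^ ?n \<le> I / t" using t by (simp add: field_simps)
    \<comment> \<open>Only \<open>r ^ ?n\<close> is bounded by \<open>I / t\<close>; for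
      \<open>r > 1\<close> this bounds \<open>r\<close> as well.\<close>
    have "r \<le> max 1 (I / t)"
    proof (cases "r \<le> 1")
      case False
      then have "r \<le> r ^ ?n" using self_le_power[of r ?n] by simp
      then show ?thesis using le by simp
    qed simp
    then show ?thesis using r xr by simp
  qed
  have cov: "HL_set h t \<subseteq> (\<Union>i\<in>K. ball (fst i) (snd i))"
    by (force simp: HL_set_def K_def)
  obtain C where C: "countable C" "C \<subseteq> K"
     "pairwise (\<lambda>i j. disjnt (ball (fst i) (snd i)) (ball (fst j) (snd j))) C"
     "HL_set h t \<subseteq> (\<Union>i\<in>C. ball (fst i) (5 * snd i))"
    by (rule Vitali_covering_lemma_balls[OF cov bound]) (blast intro: that)+
  have "emeasure lebesgue (HL_set h t) \<le> emeasure lebesgue (\<Union>i\<in>C. ball (fst i) (5 * snd i))"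
    using C(1,4) by (intro emeasure_mono) auto
  also have "\<dots> \<le> (\<integral>\<^sup>+i. emeasure lebesgue (ball (fst i) (5
      * snd i)) \<partial>count_space C)"
    using C(1) by (intro emeasure_UN_le) auto
  also have "\<dots> \<le> (\<integral>\<^sup>+i. ennreal (unit_ball_vol ?n * 5 ^ ?n / t)
      * (\<integral>\<^sup>+y\<in>ball (fst i) (snd i). h y \<partial>lebesgue) \<partial>count_space C)"
  proof (intro nn_integral_mono)
    fix i assume "i \<in> space (count_space C)"
    then have i: "i \<in> K" using C(2) by auto
    have "emeasure lebesgue (ball (fst i) (5 * snd i)) = ennreal (unit_ball_vol ?n * (5 * snd i) ^ ?n)"
      using bound[OF i] by (intro emeasure_lebesgue_ball) auto
    also have "\<dots> = ennreal (unit_ball_vol ?n * 5 ^ ?n / t) * ennreal (t * snd i ^ ?n)"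
      using t bound[OF i] by (subst ennreal_mult[symmetric]) (auto simp: power_mult_distrib)
    also have "\<dots> \<le> ennreal (unit_ball_vol ?n * 5 ^ ?n / t)
        * (\<integral>\<^sup>+y\<in>ball (fst i) (snd i). h y \<partial>lebesgue)"
      using i by (intro mult_left_mono) (auto simp: K_def)
    finally show "emeasure lebesgue (ball (fst i) (5 * snd i)) \<le> \<dots>" .
  qed
  also have "\<dots> = ennreal (unit_ball_vol ?n * 5 ^ ?n / t)
      * (\<integral>\<^sup>+i. (\<integral>\<^sup>+y\<in>ball (fst i) (snd i). h y \<partial>lebesgue) \<partial>count_space C)"
    by (rule nn_integral_cmult) simp
  also have "(\<integral>\<^sup>+i. (\<integral>\<^sup>+y\<in>ball (fst i) (snd i). h y \<partial>lebesgue) \<partial>count_space C)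
      = (\<integral>\<^sup>+y\<in>(\<Union>i\<in>C. ball (fst i) (snd i)). h y \<partial>lebesgue)"
    using C(1,3) h by (intro nn_integral_UN_disjoint[symmetric])
      (auto simp: disjoint_family_on_def pairwise_def disjnt_def)
  also have "\<dots> \<le> (\<integral>\<^sup>+y. h y \<partial>lebesgue)"
    by (intro nn_integral_mono) (auto simp: indicator_def)
  finally show ?thesis by (simp add: mult_left_mono)
qed

section \<open>Tail integrals under control of the masses of concentric balls\<close>

lemma tail_sum_bound:
  fixes d r s :: real
  assumes "0 < r" "r \<le> s" "0 < d"
  obtains k :: nat where "s < 2 ^ Suc k * r"
    "r powr d / s powr (real n + d) \<le> (1 / 2 powr d) ^ k * (1 / (2 ^ k * r) ^ n)"
proof -
  obtain m :: nat where m: "s / r < 2 ^ m" using real_arch_pow[of 2 "s / r"] by auto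
  define k where "k = (LEAST k. s < 2 ^ Suc k * r)"
  have "s < 2 ^ m * r" using m assms by (simp add: pos_divide_less_eq)
  moreover have "0 \<le> 2 ^ m * r" using assms by simp
  ultimately have ex: "s < 2 ^ Suc m * r" by simp
  have k: "s < 2 ^ Suc k * r" unfolding k_def by (rule LeastI[of _ m]) (rule ex)
  have lower: "2 ^ k * r \<le> s"
  proof (cases k)
    case (Suc k')
    then have "\<not> s < 2 ^ Suc k' * r" using not_less_Least[of k' "\<lambda>k. s < 2 ^ Suc k * r"] k_def by auto
    then show ?thesis using Suc by simp
  qed (use assms in simp)
  have pos: "0 < 2 ^ k * r" using assms by simp
  have "r powr d / s powr (real n + d) \<le> r powr d / (2 ^ k * r) powr (real n + d)"
    using lower pos assms by (intro divide_left_mono powr_mono2 mult_pos_pos) auto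
  also have "(2 ^ k * r) powr (real n + d) = (2 ^ k * r) ^ n * (2 ^ k * r) powr d"
    using pos by (simp add: powr_add powr_realpow)
  also have "(2 ^ k * r) powr d = (2 powr d) ^ k * r powr d"
  proof -
    have "(2 ^ k :: real) powr d = (2 powr d) ^ k"
      by (simp add: powr_realpow[symmetric] powr_powr powr_power mult.commute)
    then show ?thesis using assms by (simp add: powr_mult)
  qed
  finally have "r powr d / s powr (real n + d) \<le> (1 / 2 powr d) ^ k * (1 / (2 ^ k * r) ^ n)"
    using assms by (simp add: field_simps power_divide)
  then show ?thesis using that k by blast
qed

text \<open>The shell \<open>2 ^ k * r \<le> norm (x - y) < 2 ^ Suc k * r\<close> has mass at most
  \<open>t * (2 ^ Suc k * r) ^ DIM('a)\<close>, while the weight on it is at most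
  \<open>(1 / 2 powr d) ^ k / (2 ^ k * r) ^ DIM('a)\<close>. The quotient of the two powers gives
  \<open>2 ^ DIM('a)\<close>, and the geometric series gives the denominator.\<close>

lemma nn_integral_tail_le:
  fixes h :: "'a::euclidean_space \<Rightarrow> ennreal"
  assumes d: "0 < d" and r: "0 < r" and t: "0 \<le> t" and h: "h \<in> borel_measurable lebesgue"
    and B: "\<And>r. 0 < r \<Longrightarrow> (\<integral>\<^sup>+y\<in>ball x r. h y \<partial>lebesgue)
        \<le> ennreal (t * r ^ DIM('a))"
  shows "(\<integral>\<^sup>+y\<in>{y. r
      \<le> norm (x - y)}. ennreal (r powr d / norm (x - y) powr (real DIM('a) + d)) * h y \<partial>lebesgue)
     \<le> ennreal (2 ^ DIM('a) / (1 - 1 / 2 powr d) * t)"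
proof -
  let ?n = "DIM('a)"
  define q :: real where "q = 1 / 2 powr d"
  have ind: "(\<lambda>y. h y * indicator (ball x R) y) \<in> borel_measurable lebesgue" for R
    by (rule borel_measurable_times_ennreal[OF h borel_measurable_indicator[OF ball_in_sets_lebesgue]])
  have q: "0 < q" "q < 1" using d by (auto simp: q_def)
  let ?F = "\<lambda>k y. ennreal (q ^ k * (1 / (2 ^ k * r) ^ ?n)) * (h y * indicator (ball x (2 ^ Suc k * r)) y)"
  have le: "ennreal (r powr d / norm (x - y) powr (real ?n + d)) * h y * indicator {y. r \<le> norm (x - y)} y
      \<le> (\<Sum>k. ?F k y)" for y
  proof (cases "r \<le> norm (x - y)")
    case True
    then obtain k :: nat where k: "norm (x - y) < 2 ^ Suc k * r"
      "r powr d / norm (x - y) powr (real ?n + d) \<le> q ^ k * (1 / (2 ^ k * r) ^ ?n)"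
      using tail_sum_bound[OF r True d, of ?n] unfolding q_def by metis
    have "ennreal (r powr d / norm (x - y) powr (real ?n + d)) * h y * indicator {y. r \<le> norm (x - y)} y
        \<le> ?F k y"
      using True k by (auto simp: dist_norm indicator_def intro!: mult_right_mono ennreal_leI)
    also have "\<dots> \<le> (\<Sum>k. ?F k y)"
      using sum_le_suminf[of "\<lambda>k. ?F k y" "{k}"] by simp
    finally show ?thesis .
  qed simp
  have "(\<integral>\<^sup>+y\<in>{y. r \<le> norm (x - y)}. ennreal (r powr d / norm (x - y) powr (real ?n
      + d)) * h y \<partial>lebesgue)
     \<le> (\<integral>\<^sup>+y. (\<Sum>k. ?F k y) \<partial>lebesgue)"
    by (intro nn_integral_mono le)
  also have "\<dots> = (\<Sum>k. \<integral>\<^sup>+y. ?F k y \<partial>lebesgue)"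
    by (intro nn_integral_suminf borel_measurable_times_ennreal[OF borel_measurable_const ind])
  also have "\<dots> \<le> (\<Sum>k. ennreal (2 ^ ?n * t * q ^ k))"
  proof (intro suminf_le summableI)
    fix k
    have "(\<integral>\<^sup>+y. ?F k y \<partial>lebesgue) = ennreal (q ^ k * (1 / (2 ^ k * r) ^ ?n))
        * (\<integral>\<^sup>+y\<in>ball x (2 ^ Suc k * r). h y \<partial>lebesgue)"
      by (rule nn_integral_cmult[OF ind])
    also have "\<dots> \<le> ennreal (q ^ k * (1 / (2 ^ k * r) ^ ?n)) * ennreal (t * (2 ^ Suc k * r) ^ ?n)"
      using r by (intro mult_left_mono B) auto
    also have "\<dots> = ennreal (2 ^ ?n * t * q ^ k)"
      using r q t by (subst ennreal_mult[symmetric]) (auto simp: power_mult_distrib field_simps)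
    finally show "(\<integral>\<^sup>+y. ?F k y \<partial>lebesgue) \<le> \<dots>" .
  qed
  also have "\<dots> = ennreal (2 ^ ?n / (1 - q) * t)"
  proof -
    have "(\<lambda>k. 2 ^ ?n * t * q ^ k) sums (2 ^ ?n * t * (1 / (1 - q)))"
      using q by (intro sums_mult geometric_sums) auto
    then have s: "(\<Sum>k. 2 ^ ?n * t * q ^ k) = 2 ^ ?n / (1 - q) * t" "summable (\<lambda>k. 2 ^ ?n * t * q ^ k)"
      by (auto simp: sums_iff)
    show ?thesis
      using q t s by (subst suminf_ennreal2) auto
  qed
  finally show ?thesis unfolding q_def .
qed

section \<open>Dyadic cubes\<close>

text \<open>The half-open dyadic cube of side \<open>2 powi j\<close> through \<open>x\<close>.
  Naming a cube by any of its points makes the ancestors of a cube simply \<open>dyadic i x\<close>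
  for larger \<open>i\<close>; \<open>dyadic_eqD\<close> exchanges representatives.\<close>

definition dyadic :: "int \<Rightarrow> 'a::euclidean_space \<Rightarrow> 'a set" where
  "dyadic j x = {y. \<forall>b\<in>Basis. \<lfloor>(y \<bullet> b) / 2 powi j\<rfloor>
      = \<lfloor>(x \<bullet> b) / 2 powi j\<rfloor>}"

definition dyadic_corner :: "int \<Rightarrow> 'a::euclidean_space \<Rightarrow> 'a" where
  "dyadic_corner j x = (\<Sum>b\<in>Basis. (2 powi j * \<lfloor>(x \<bullet> b) / 2 powi j\<rfloor>) *\<^sub>R b)"

text \<open>The concentric cube of triple side; closed, so that it is one of the cubes over which
  the bump condition and the maximal functions range.\<close>

definition dyadic_triple :: "int \<Rightarrow> 'a::euclidean_space \<Rightarrow> 'a set" where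
  "dyadic_triple j x = cube (dyadic_corner j x - 2 powi j *\<^sub>R One) (3 * 2 powi j)"

lemma powi_two_pos [simp]: "0 < (2::real) powi j"
  by (simp add: zero_less_power_int)

lemma powi_two_Suc: "(2::real) powi (j + 1) = 2 * 2 powi j"
  by (simp add: power_int_add)

lemma dyadic_refl [simp]: "x \<in> dyadic j x"
  by (simp add: dyadic_def)

lemma dyadic_eqD:
  assumes "y \<in> dyadic j x"
  shows "dyadic j y = dyadic j x" "dyadic_corner j y = dyadic_corner j x"
    "dyadic_triple j y = dyadic_triple j x"
  using assms by (auto simp: dyadic_def dyadic_corner_def dyadic_triple_def intro!: sum.cong)

lemma inner_dyadic_corner:
  "b \<in> Basis \<Longrightarrow> dyadic_corner j x \<bullet> b = 2 powi j
      * \<lfloor>(x \<bullet> b) / 2 powi j\<rfloor>"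
  by (simp add: dyadic_corner_def)

lemma floor_div_eq_iff:
  fixes s t :: real
  assumes "0 < s"
  shows "\<lfloor>t / s\<rfloor> = k \<longleftrightarrow> s * k \<le> t \<and> t < s * k + s"
proof -
  have "\<lfloor>t / s\<rfloor> = k \<longleftrightarrow> of_int k \<le> t / s \<and> t / s < of_int k + 1"
    by (rule floor_eq_iff)
  then show ?thesis using assms by (simp add: field_simps)
qed

lemma mem_dyadic_iff:
  fixes x y :: "'a::euclidean_space"
  shows "y \<in> dyadic j x \<longleftrightarrow>
    (\<forall>b\<in>Basis. dyadic_corner j x \<bullet> b \<le> y \<bullet> b \<and> y \<bullet> b
        < dyadic_corner j x \<bullet> b + 2 powi j)"
  by (simp add: dyadic_def floor_div_eq_iff inner_dyadic_corner)

lemma mem_dyadic_triple_iff: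
  fixes x y :: "'a::euclidean_space"
  shows "y \<in> dyadic_triple j x \<longleftrightarrow>
    (\<forall>b\<in>Basis. dyadic_corner j x \<bullet> b - 2 powi j \<le> y \<bullet> b \<and> y \<bullet> b
        \<le> dyadic_corner j x \<bullet> b + 2 * 2 powi j)"
  by (auto simp: dyadic_triple_def cube_def mem_box algebra_simps)

lemma floor_half_real: "\<lfloor>t / (2 * s)\<rfloor> = \<lfloor>t / s\<rfloor> div 2" for s t :: real
proof -
  have "\<lfloor>(t / s) / of_int 2\<rfloor> = \<lfloor>t / s\<rfloor> div 2"
    by (rule floor_divide_real_eq_div) simp
  then show ?thesis by (simp add: mult.commute)
qed

lemma dyadic_mono_Suc: "dyadic j x \<subseteq> dyadic (j + 1) x"
  by (auto simp: dyadic_def powi_two_Suc floor_half_real)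

lemma dyadic_mono: "i \<le> j \<Longrightarrow> dyadic i x \<subseteq> dyadic j x"
  by (induction j rule: int_ge_induct) (use dyadic_mono_Suc in blast)+

lemma dyadic_triple_mono_Suc: "dyadic_triple j x \<subseteq> dyadic_triple (j + 1) x"
proof
  fix y assume y: "y \<in> dyadic_triple j x"
  let ?s = "2 powi j :: real"
  show "y \<in> dyadic_triple (j + 1) x"
    unfolding mem_dyadic_triple_iff
  proof
    fix b :: 'a assume b: "b \<in> Basis"
    define a m where "a = \<lfloor>(x \<bullet> b) / ?s\<rfloor>" and "m = a div 2"
    have 1: "dyadic_corner j x \<bullet> b = ?s * a" using b by (simp add: inner_dyadic_corner a_def)
    have 2: "dyadic_corner (j + 1) x \<bullet> b = ?s * (2 * m)"
      using b by (simp add: inner_dyadic_corner powi_two_Suc floor_half_real a_def m_def)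
    \<comment> \<open>In each coordinate the child is the lower or the upper half of its parent. In
      units of \<open>?s\<close> the claim is that [a - 1, a + 2] lies in [2m - 2, 2m + 4].\<close>
    have "2 * m \<le> a" "a \<le> 2 * m + 1" by (auto simp: m_def)
    then have am: "real_of_int (2 * m) \<le> a" "real_of_int a \<le> 2 * m + 1" by linarith+
    have "?s * (2 * m) \<le> ?s * a" "?s * a \<le> ?s * (2 * m + 1)"
      using mult_left_mono[OF am(1), of ?s] mult_left_mono[OF am(2), of ?s] by auto
    then have "?s * (2 * m) \<le> ?s * a" "?s * a \<le> ?s * (2 * m) + ?s" by (auto simp: distrib_left)
    moreover have "?s * a - ?s \<le> y \<bullet> b" "y \<bullet> b \<le> ?s * a + 2 * ?s"
      using y b 1 by (auto simp: mem_dyadic_triple_iff)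
    moreover have "0 < ?s" by simp
    ultimately show "dyadic_corner (j + 1) x \<bullet> b - 2 powi (j + 1) \<le> y \<bullet> b \<and>
        y \<bullet> b \<le> dyadic_corner (j + 1) x \<bullet> b + 2 * 2 powi (j + 1)"
      unfolding 2 powi_two_Suc by linarith
  qed
qed

lemma dyadic_triple_mono: "i \<le> j \<Longrightarrow> dyadic_triple i x \<subseteq> dyadic_triple j x"
  by (induction j rule: int_ge_induct) (use dyadic_triple_mono_Suc in blast)+

lemma dyadic_subset_triple: "dyadic j x \<subseteq> dyadic_triple j x"
proof
  fix y assume "y \<in> dyadic j x"
  then show "y \<in> dyadic_triple j x"
    unfolding mem_dyadic_triple_iff mem_dyadic_iff using powi_two_pos[of j] by smt
qed

lemma dyadic_norm_diff:
  fixes x y z :: "'a::euclidean_space"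
  assumes "y \<in> dyadic j x" "z \<in> dyadic j x"
  shows "norm (y - z) \<le> real DIM('a) * 2 powi j"
proof -
  have "norm (y - z) \<le> (\<Sum>b\<in>Basis. \<bar>(y - z) \<bullet> b\<bar>)" by (rule norm_le_l1)
  also have "\<dots> \<le> (\<Sum>b\<in>(Basis::'a set). 2 powi j)"
    using assms by (intro sum_mono) (force simp: mem_dyadic_iff inner_diff_left abs_le_iff)
  finally show ?thesis by simp
qed

lemma dyadic_triple_norm_diff:
  fixes x y z :: "'a::euclidean_space"
  assumes y: "y \<in> dyadic_triple j x" and z: "z \<in> dyadic j x"
  shows "norm (z - y) \<le> real DIM('a) * (2 * 2 powi j)"
proof -
  have "norm (z - y) \<le> (\<Sum>b\<in>Basis. \<bar>(z - y) \<bullet> b\<bar>)" by (rule norm_le_l1)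
  also have "\<dots> \<le> (\<Sum>b\<in>(Basis::'a set). 2 * 2 powi j)"
  proof (intro sum_mono)
    fix b :: 'a assume b: "b \<in> Basis"
    show "\<bar>(z - y) \<bullet> b\<bar> \<le> 2 * 2 powi j"
      using bspec[OF y[unfolded mem_dyadic_triple_iff] b] bspec[OF z[unfolded mem_dyadic_iff] b]
      by (simp add: inner_diff_left abs_le_iff)
  qed
  finally show ?thesis by simp
qed

text \<open>The reason for tripling: seen from the cube, the kernel is at most
  \<open>c / (2 powi j) ^ DIM('a)\<close> off the triple, and annuli of outer radius at most
  \<open>2 powi j\<close> stay inside it.\<close>

lemma not_dyadic_triple_norm:
  fixes x y z :: "'a::euclidean_space"
  assumes "y \<notin> dyadic_triple j x" "z \<in> dyadic j x"
  shows "2 powi j \<le> norm (z - y)"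
proof -
  obtain b where b: "b \<in> Basis"
    "\<not> (dyadic_corner j x \<bullet> b - 2 powi j \<le> y \<bullet> b \<and> y \<bullet> b
        \<le> dyadic_corner j x \<bullet> b + 2 * 2 powi j)"
    using assms(1) unfolding mem_dyadic_triple_iff by blast
  then have "2 powi j \<le> \<bar>(z - y) \<bullet> b\<bar>"
    using bspec[OF assms(2)[unfolded mem_dyadic_iff] b(1)] powi_two_pos[of j]
    by (simp add: inner_diff_left abs_le_iff) linarith
  also have "\<dots> \<le> norm (z - y)" using b(1) by (rule Basis_le_norm)
  finally show ?thesis .
qed

lemma emeasure_cube:
  "0 \<le> l \<Longrightarrow> emeasure lebesgue (cube (a::'a::euclidean_space) l) = ennreal (l ^ DIM('a))"
  by (simp add: cube_def emeasure_lborel_cbox_eq inner_simps)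

lemma sets_dyadic_triple: "dyadic_triple j x \<in> sets lebesgue"
  by (simp add: dyadic_triple_def cube_def)

lemma sets_dyadic: "dyadic j (x::'a::euclidean_space) \<in> sets lebesgue"
proof -
  have "dyadic j x = (\<Inter>b\<in>Basis. {y. dyadic_corner j x \<bullet> b
      \<le> y \<bullet> b} \<inter> {y. y \<bullet> b < dyadic_corner j x \<bullet> b + 2 powi j})"
    by (auto simp: mem_dyadic_iff)
  moreover have "(\<Inter>b\<in>Basis. {y. dyadic_corner j x \<bullet> b
      \<le> y \<bullet> b} \<inter> {y. y \<bullet> b < dyadic_corner j x \<bullet> b + 2 powi j}) \<in> sets borel"
    by (intro sets.finite_INT) (auto intro!: sets.Int borel_closed borel_open closed_Collect_le open_Collect_less continuous_intros)
  ultimately show ?thesis by (simp only: sets_completionI_sets sets_lborel)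
qed

lemma emeasure_dyadic:
  "emeasure lebesgue (dyadic j (x::'a::euclidean_space)) = ennreal ((2 powi j) ^ DIM('a))"
proof (rule antisym)
  let ?c = "dyadic_corner j x" and ?s = "2 powi j :: real"
  have "dyadic j x \<subseteq> cbox ?c (?c + ?s *\<^sub>R One)"
    by (auto simp: mem_dyadic_iff mem_box inner_simps less_imp_le)
  then have "emeasure lebesgue (dyadic j x) \<le> emeasure lebesgue (cbox ?c (?c + ?s *\<^sub>R One))"
    by (intro emeasure_mono) auto
  also have "\<dots> = ennreal (?s ^ DIM('a))"
    by (simp add: emeasure_lborel_cbox_eq inner_simps less_imp_le)
  finally show "emeasure lebesgue (dyadic j x) \<le> ennreal (?s ^ DIM('a))" .
  have "ennreal (?s ^ DIM('a)) = emeasure lebesgue (box ?c (?c + ?s *\<^sub>R One))"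
    by (simp add: emeasure_lborel_box_eq inner_simps less_imp_le)
  also have "\<dots> \<le> emeasure lebesgue (dyadic j x)"
    by (intro emeasure_mono sets_dyadic) (auto simp: mem_dyadic_iff mem_box inner_simps less_imp_le)
  finally show "ennreal (?s ^ DIM('a)) \<le> emeasure lebesgue (dyadic j x)" .
qed

section \<open>Families of maximal dyadic cubes\<close>

definition dyadic_cubes :: "'a::euclidean_space set set" where
  "dyadic_cubes = {dyadic j x | j x. True}"

lemma countable_dyadic_cubes: "countable (dyadic_cubes :: 'a::euclidean_space set set)"
proof -
  have "dyadic_cubes \<subseteq> (\<Union>j. (\<lambda>k. {y::'a. \<forall>b\<in>Basis. \<lfloor>(y \<bullet> b) / 2 powi j\<rfloor> = k b}) ` (Basis \<rightarrow>\<^sub>E UNIV))"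
  proof
    fix Q :: "'a set" assume "Q \<in> dyadic_cubes"
    then obtain j x where Q: "Q = dyadic j x" by (auto simp: dyadic_cubes_def)
    then have "Q = {y::'a. \<forall>b\<in>Basis. \<lfloor>(y \<bullet> b) / 2 powi j\<rfloor>
        = restrict (\<lambda>b. \<lfloor>(x \<bullet> b) / 2 powi j\<rfloor>) Basis b}"
      by (auto simp: dyadic_def)
    then show "Q \<in> (\<Union>j. (\<lambda>k. {y::'a. \<forall>b\<in>Basis. \<lfloor>(y \<bullet> b) / 2 powi j\<rfloor> = k b}) ` (Basis \<rightarrow>\<^sub>E UNIV))"
      by (intro UN_I[of j] image_eqI[where x = "restrict (\<lambda>b. \<lfloor>(x \<bullet> b) / 2 powi j\<rfloor>) Basis"]) auto
  qed
  moreover have "countable (Basis \<rightarrow>\<^sub>E (UNIV :: int set) :: ('a \<Rightarrow> int) set)"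
    by (intro countable_PiE) auto
  ultimately show ?thesis
    by (elim countable_subset) auto
qed

lemma dyadic_subset_open:
  fixes x :: "'a::euclidean_space"
  assumes "open E" "x \<in> E"
  obtains m where "\<And>j. j \<le> m \<Longrightarrow> dyadic j x \<subseteq> E"
proof -
  obtain e where e: "e > 0" "ball x e \<subseteq> E" using assms by (auto elim: openE)
  obtain k :: nat where k: "real DIM('a) / e < 2 ^ k" using real_arch_pow[of 2] by auto
  have "dyadic j x \<subseteq> E" if "j \<le> - int k" for j
  proof
    fix y assume "y \<in> dyadic j x"
    then have "norm (x - y) \<le> real DIM('a) * 2 powi j" by (intro dyadic_norm_diff) auto
    also have "\<dots> \<le> real DIM('a) * 2 powi (- int k)"
      using that by (intro mult_left_mono power_int_increasing) auto
    also have "\<dots> < e" using k e by (simp add: power_int_minus field_simps)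
    finally show "y \<in> E" using e(2) by (auto simp: dist_norm)
  qed
  then show ?thesis using that by blast
qed

text \<open>Maximality compares a cube only with its ancestors \<open>dyadic i x\<close>,
  \<open>i > j\<close>, since every larger dyadic cube that meets it is one of them.\<close>

definition maximal_dyadic :: "('a::euclidean_space set \<Rightarrow> bool) \<Rightarrow> 'a set set" where
  "maximal_dyadic P = {dyadic j x | j x. P (dyadic j x) \<and> (\<forall>i>j. \<not> P (dyadic i x))}"

lemma countable_maximal_dyadic: "countable (maximal_dyadic P)"
  by (rule countable_subset[OF _ countable_dyadic_cubes]) (auto simp: maximal_dyadic_def dyadic_cubes_def)

lemma sets_maximal_dyadic: "Q \<in> maximal_dyadic P \<Longrightarrow> Q \<in> sets lebesgue"
  by (auto simp: maximal_dyadic_def sets_dyadic)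

text \<open>A common point \<open>z\<close> places both cubes in the chain
  \<open>dyadic k z\<close>; if their scales differed, the smaller one would have an ancestor
  satisfying \<open>P\<close>.\<close>

lemma disjoint_maximal_dyadic: "disjoint_family_on (\<lambda>Q. Q) (maximal_dyadic P)"
  unfolding disjoint_family_on_def
proof (intro ballI impI)
  fix Q R assume QR: "Q \<in> maximal_dyadic P" "R \<in> maximal_dyadic P" "Q \<noteq> R"
  obtain i x where i: "Q = dyadic i x" "P (dyadic i x)" "\<And>k. k > i \<Longrightarrow> \<not> P (dyadic k x)"
    using QR(1) by (auto simp: maximal_dyadic_def)
  obtain j y where j: "R = dyadic j y" "P (dyadic j y)" "\<And>k. k > j \<Longrightarrow> \<not> P (dyadic k y)"
    using QR(2) by (auto simp: maximal_dyadic_def)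
  show "Q \<inter> R = {}"
  proof (rule ccontr)
    assume "Q \<inter> R \<noteq> {}"
    then obtain z where z: "z \<in> dyadic i x" "z \<in> dyadic j y" using i j by auto
    have zi: "dyadic k z = dyadic k x" if "i \<le> k" for k
      using dyadic_mono[OF that] z by (intro dyadic_eqD) auto
    have zj: "dyadic k z = dyadic k y" if "j \<le> k" for k
      using dyadic_mono[OF that] z by (intro dyadic_eqD) auto
    have "i = j"
    proof (rule ccontr)
      assume "i \<noteq> j"
      then consider "i < j" | "j < i" by linarith
      then show False
      proof cases
        case 1
        then show False using i(3)[of j] j(2) zi[of j] zj[of j] by simp
      next
        case 2
        then show False using j(3)[of i] i(2) zi[of i] zj[of i] by simp
      qed
    qed
    then show False using zi[of i] zj[of i] i j QR(3) by simp
  qed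
qed

lemma Union_maximal_dyadic:
  assumes bdd: "\<And>x j. P (dyadic j x) \<Longrightarrow> j \<le> m x"
  shows "\<Union>(maximal_dyadic P) = {x. \<exists>j. P (dyadic j x)}"
proof (intro antisym subsetI)
  fix x assume "x \<in> \<Union>(maximal_dyadic P)"
  then obtain j y where "x \<in> dyadic j y" "P (dyadic j y)" by (auto simp: maximal_dyadic_def)
  then show "x \<in> {x. \<exists>j. P (dyadic j x)}" using dyadic_eqD(1)[of x j y]
      by (intro CollectI exI[of _ j]) simp
next
  fix x assume "x \<in> {x. \<exists>j. P (dyadic j x)}"
  then obtain j0 where j0: "P (dyadic j0 x)" by auto
  \<comment> \<open>The scales are searched downwards from the bound \<open>m x\<close>, so the
    least \<open>k\<close> belongs to the largest cube.\<close>
  define k where "k = (LEAST k. P (dyadic (m x - int k) x))"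
  have "P (dyadic (m x - int (nat (m x - j0))) x)" using j0 bdd[OF j0] by simp
  then have k: "P (dyadic (m x - int k) x)" unfolding k_def by (rule LeastI)
  have "\<not> P (dyadic i x)" if "i > m x - int k" for i
  proof
    assume P: "P (dyadic i x)"
    have "nat (m x - i) < k" using that bdd[OF P] by linarith
    moreover have "k \<le> nat (m x - i)" unfolding k_def
      using P bdd[OF P] by (intro Least_le) simp
    ultimately show False by simp
  qed
  then have "dyadic (m x - int k) x \<in> maximal_dyadic P" using k by (auto simp: maximal_dyadic_def)
  then show "x \<in> \<Union>(maximal_dyadic P)" by (rule UnionI) simp
qed

section \<open>Kernels and their truncations\<close>

lemma norm_set_integral_le:
  fixes F :: "'b \<Rightarrow> complex"
  shows "ennreal (cmod (LINT y:A|M. F y)) \<le> (\<integral>\<^sup>+y\<in>A. ennreal (cmod (F y)) \<partial>M)"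
proof (cases "set_integrable M A F")
  case True
  then have "ennreal (cmod (LINT y:A|M. F y))
      \<le> (\<integral>\<^sup>+y. ennreal (cmod (indicator A y *\<^sub>R F y)) \<partial>M)"
    unfolding set_lebesgue_integral_def set_integrable_def by (rule integral_norm_bound_ennreal)
  also have "\<dots> = (\<integral>\<^sup>+y\<in>A. ennreal (cmod (F y)) \<partial>M)"
    by (intro nn_integral_cong) (auto simp: indicator_def)
  finally show ?thesis .
next
  \<comment> \<open>The Bochner integral of a non-integrable function is 0.\<close>
  case False
  then show ?thesis by (simp add: set_lebesgue_integral_def set_integrable_def not_integrable_integral_eq)
qed

lemma norm_set_integral_diff_le:
  fixes F :: "'b \<Rightarrow> complex"
  assumes A: "set_integrable M A F" and B: "set_integrable M B F" and S: "(A - B) \<union> (B - A) \<subseteq> S"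
  shows "ennreal (cmod ((LINT y:A|M. F y) - (LINT y:B|M. F y)))
      \<le> (\<integral>\<^sup>+y\<in>S. ennreal (cmod (F y)) \<partial>M)"
proof -
  have "ennreal (cmod ((LINT y:A|M. F y) - (LINT y:B|M. F y)))
      = ennreal (cmod (\<integral>y. indicator A y *\<^sub>R F y - indicator B y *\<^sub>R F y \<partial>M))"
    using A B by (simp add: set_lebesgue_integral_def set_integrable_def)
  also have "\<dots> \<le> (\<integral>\<^sup>+y. ennreal (cmod (indicator A y *\<^sub>R F y - indicator B y *\<^sub>R F y)) \<partial>M)"
    using A B by (intro integral_norm_bound_ennreal) (simp add: set_integrable_def)
  also have "\<dots> \<le> (\<integral>\<^sup>+y\<in>S. ennreal (cmod (F y)) \<partial>M)"
    using S by (intro nn_integral_mono) (auto simp: indicator_def)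
  finally show ?thesis .
qed

section \<open>Truncated integrals and their suprema\<close>

definition annulus :: "'a::euclidean_space \<Rightarrow> real \<Rightarrow> real \<Rightarrow> 'a set" where
  "annulus x e v = {y. e < norm (x - y) \<and> norm (x - y) < v}"

lemma open_annulus: "open (annulus x e v)"
  unfolding annulus_def by (intro open_Collect_conj open_Collect_less continuous_intros)

lemma sets_annulus: "annulus x e v \<in> sets lebesgue"
  by (rule open_in_sets_lebesgue[OF open_annulus])

lemma annulus_subset_ball: "annulus x e v \<subseteq> ball x v"
  by (auto simp: annulus_def dist_norm)

definition truncation ::
    "('a::euclidean_space \<Rightarrow> 'a \<Rightarrow> complex) \<Rightarrow> ('a \<Rightarrow> complex) \<Rightarrow> real \<Rightarrow> real \<Rightarrow> 'a \<Rightarrow> complex" where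
  "truncation K f e v x = (LINT y:annulus x e v|lebesgue. K x y * f y)"

text \<open>The set of admissible radii is a parameter because \<open>global_bound\<close> works
  with bounded outer radii and lets the bound grow.\<close>

definition sup_truncation :: "('a::euclidean_space \<Rightarrow> 'a \<Rightarrow> complex) \<Rightarrow> (real \<times> real) set \<Rightarrow>
    ('a \<Rightarrow> complex) \<Rightarrow> 'a \<Rightarrow> ennreal" where
  "sup_truncation K I f x = (SUP (e, v) \<in> I. ennreal (cmod (truncation K f e v x)))"

lemma maximal_truncation_eq:
  "maximal_truncation K f = sup_truncation K {(e, v). 0 < e \<and> e < v} f"
  by (simp add: fun_eq_iff maximal_truncation_def sup_truncation_def truncation_def annulus_def)

lemma maximal_truncation_le_iff:
  "maximal_truncation K f x \<le> t \<longleftrightarrow>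
    (\<forall>e v. 0 < e \<longrightarrow> e < v \<longrightarrow> ennreal (cmod (truncation K f e v x)) \<le> t)"
  by (auto simp: maximal_truncation_eq sup_truncation_def SUP_le_iff)

lemma truncation_le_maximal_truncation:
  "0 < e \<Longrightarrow> e < v \<Longrightarrow> ennreal (cmod (truncation K f e v x))
      \<le> maximal_truncation K f x"
  using maximal_truncation_le_iff by blast

definition loc_integrable :: "('a::euclidean_space \<Rightarrow> complex) \<Rightarrow> bool" where
  "loc_integrable f \<longleftrightarrow> (\<forall>A \<in> sets lebesgue. bounded A
      \<longrightarrow> set_integrable lebesgue A f)"

lemma loc_integrableD: "loc_integrable f \<Longrightarrow> A \<in> sets lebesgue \<Longrightarrow> bounded A
    \<Longrightarrow> set_integrable lebesgue A f"
  by (simp add: loc_integrable_def)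

lemma integrable_imp_set_integrable:
  fixes f :: "'b \<Rightarrow> complex"
  shows "integrable M f \<Longrightarrow> A \<in> sets M \<Longrightarrow> set_integrable M A f"
  unfolding set_integrable_def by (rule integrable_mult_indicator)

lemma integrable_imp_loc_integrable: "integrable lebesgue f \<Longrightarrow> loc_integrable f"
  by (auto simp: loc_integrable_def intro: integrable_imp_set_integrable)

lemma loc_integrable_set: "loc_integrable f \<Longrightarrow> A \<in> sets lebesgue
    \<Longrightarrow> bounded A \<Longrightarrow>
    integrable lebesgue (\<lambda>y. f y * indicator A y)"
  using loc_integrableD[of f A] by (simp add: set_integrable_def scaleR_conv_of_real mult.commute of_real_indicator)

text \<open>Fixes the constants hidden in \<open>CZ_kernel\<close>, with a positive \<open>c\<close>
  and the two terms of the smoothness condition stated separately.\<close>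

locale cz_kernel =
  fixes K :: "'a::euclidean_space \<Rightarrow> 'a \<Rightarrow> complex" and c d :: real
  assumes c: "0 < c" and d: "0 < d" "d \<le> 1"
    and size: "x \<noteq> y \<Longrightarrow> cmod (K x y) \<le> c / norm (x - y) ^ DIM('a)"
    and reg1: "norm (x - x') < norm (x - y) / 2 \<Longrightarrow>
      cmod (K x y - K x' y) \<le> c * (norm (x - x') powr d / norm (x - y) powr (DIM('a) + d))"
    and reg2: "norm (x - x') < norm (x - y) / 2 \<Longrightarrow>
      cmod (K y x - K y x') \<le> c * (norm (x - x') powr d / norm (x - y) powr (DIM('a) + d))"
begin

text \<open>Stated for an abstract section \<open>g\<close> of the kernel, so that it yields
  continuity in either variable.\<close>

lemma kernel_tendsto:
  assumes "x \<noteq> y" and k: "\<And>x'. norm (x - x') < norm (x - y) / 2 \<Longrightarrow>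
      cmod (g x - g x') \<le> c * (norm (x - x') powr d / norm (x - y) powr (DIM('a) + d))"
  shows "isCont g x"
proof -
  have "((\<lambda>x'. norm (x - x')) \<longlongrightarrow> norm (x - x)) (at x)"
    by (intro tendsto_intros)
  then have n0: "((\<lambda>x'. norm (x - x')) \<longlongrightarrow> 0) (at x)" by simp
  have "((\<lambda>x'. norm (x - x') powr d) \<longlongrightarrow> 0) (at x)"
    using d by (intro tendsto_zero_powrI[OF n0 tendsto_const]) auto
  then have "((\<lambda>x'. c * (norm (x - x') powr d / norm (x - y) powr (DIM('a) + d))) \<longlongrightarrow>
      c * (0 / norm (x - y) powr (DIM('a) + d))) (at x)"
    using assms(1) by (intro tendsto_intros) auto
  then have lim: "((\<lambda>x'. c * (norm (x - x') powr d / norm (x - y) powr (DIM('a)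
      + d))) \<longlongrightarrow> 0) (at x)"
    by simp
  have "\<forall>\<^sub>F x' in at x. norm (x - x') < norm (x - y) / 2"
    using assms(1) by (intro order_tendstoD(2)[OF n0]) simp
  then have "\<forall>\<^sub>F x' in at x. norm (g x' - g x) \<le> c
      * (norm (x - x') powr d / norm (x - y) powr (DIM('a) + d))"
    by eventually_elim (subst norm_minus_commute, rule k)
  then have "((\<lambda>x'. g x' - g x) \<longlongrightarrow> 0) (at x)"
    by (rule Lim_null_comparison[OF _ lim])
  then show ?thesis by (simp add: isCont_def LIM_zero_iff)
qed

lemma isCont_kernel_1: "x \<noteq> y \<Longrightarrow> isCont (\<lambda>x. K x y) x"
  by (rule kernel_tendsto[OF _ reg1])

lemma isCont_kernel_2: "x \<noteq> y \<Longrightarrow> isCont (\<lambda>y. K x y) y"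
  by (rule kernel_tendsto[OF _ reg2]) auto

text \<open>Measurability is not part of the definition of a kernel; it comes from continuity off
  the diagonal. The indicator removes the one point where the value is unconstrained.\<close>

lemma measurable_kernel: "(\<lambda>y. indicator (-{x}) y *\<^sub>R K x y) \<in> borel_measurable lebesgue"
proof -
  have "continuous_on (-{x}) (\<lambda>y. K x y)"
    by (intro continuous_at_imp_continuous_on ballI isCont_kernel_2) auto
  then have "(\<lambda>y. indicator (-{x}) y *\<^sub>R K x y) \<in> borel_measurable borel"
    by (intro borel_measurable_continuous_on_indicator) auto
  then show ?thesis by (simp add: measurable_completion)
qed

lemma kernel_le:
  assumes "0 < r" "r \<le> norm (x - y)"
  shows "cmod (K x y) \<le> c / r ^ DIM('a)"
proof -
  have "cmod (K x y) \<le> c / norm (x - y) ^ DIM('a)" using assms by (intro size) auto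
  also have "\<dots> \<le> c / r ^ DIM('a)"
    using assms c by (intro divide_left_mono power_mono mult_pos_pos zero_less_power) auto
  finally show ?thesis .
qed

lemma measurable_kernel_mult:
  assumes "(\<lambda>y. indicator A y *\<^sub>R f y) \<in> borel_measurable lebesgue" "x \<notin> A"
  shows "(\<lambda>y. indicator A y *\<^sub>R (K x y * f y)) \<in> borel_measurable lebesgue"
proof -
  have "(\<lambda>y. indicator A y *\<^sub>R (K x y * f y)) = (\<lambda>y. (indicator (-{x}) y *\<^sub>R K x y)
      * (indicator A y *\<^sub>R f y))"
    using assms(2) by (auto simp: fun_eq_iff indicator_def)
  then show ?thesis using borel_measurable_times[OF measurable_kernel assms(1)] by simp
qed

lemma kernel_integrable:
  assumes f: "set_integrable lebesgue A f" and A: "A \<subseteq> {y. r \<le> norm (x - y)}" and r: "0 < r"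
  shows "set_integrable lebesgue A (\<lambda>y. K x y * f y)"
proof (rule set_integrable_bound)
  show "set_integrable lebesgue A (\<lambda>y. of_real (c / r ^ DIM('a)) * f y)"
    using f by (intro set_integrable_mult_right) simp
  show "set_borel_measurable lebesgue A (\<lambda>y. K x y * f y)"
    unfolding set_borel_measurable_def
    using f A r by (intro measurable_kernel_mult) (auto simp: set_integrable_def)
  have "cmod (K x y * f y) \<le> cmod (of_real (c / r ^ DIM('a)) * f y)" if "y \<in> A" for y
  proof -
    have "cmod (K x y) \<le> c / r ^ DIM('a)" using that A r by (intro kernel_le) auto
    moreover have "cmod (of_real (c / r ^ DIM('a))) = c / r ^ DIM('a)"
      unfolding norm_of_real using c r by simp
    ultimately show ?thesis unfolding norm_mult by (simp only: mult_right_mono norm_ge_zero)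
  qed
  then show "AE y in lebesgue. y \<in> A \<longrightarrow> cmod (K x y * f y)
      \<le> cmod (of_real (c / r ^ DIM('a)) * f y)"
    by simp
qed

lemma truncation_integrable:
  assumes "loc_integrable f" "0 < e"
  shows "set_integrable lebesgue (annulus x e v) (\<lambda>y. K x y * f y)"
proof (rule kernel_integrable[OF _ _ assms(2)])
  show "set_integrable lebesgue (annulus x e v) f"
    using assms bounded_subset[OF bounded_ball annulus_subset_ball]
    by (intro loc_integrableD sets_annulus) auto
qed (auto simp: annulus_def)

text \<open>Local integrability is what excludes the default value 0 of the integral, under which
  additivity could fail; sublinearity of the maximal truncation inherits this condition.\<close>

lemma truncation_add:
  assumes "loc_integrable f" "loc_integrable g" "0 < e"
  shows "truncation K (\<lambda>y. f y + g y) e v x = truncation K f e v x + truncation K g e v x"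
  using truncation_integrable[OF assms(1,3)] truncation_integrable[OF assms(2,3)]
  by (simp add: truncation_def distrib_left set_integral_add)

lemma maximal_truncation_add_le:
  assumes "loc_integrable f" "loc_integrable g"
  shows "maximal_truncation K (\<lambda>y. f y + g y) x \<le> maximal_truncation K f x + maximal_truncation K g x"
  unfolding maximal_truncation_le_iff
proof (intro allI impI)
  fix e v :: real assume e: "0 < e" "e < v"
  have "ennreal (cmod (truncation K (\<lambda>y. f y + g y) e v x))
      \<le> ennreal (cmod (truncation K f e v x)) + ennreal (cmod (truncation K g e v x))"
    using e assms by (simp add: truncation_add norm_triangle_ineq flip: ennreal_plus)
  also have "\<dots> \<le> maximal_truncation K f x + maximal_truncation K g x"
    using e by (intro add_mono truncation_le_maximal_truncation)
  finally show "ennreal (cmod (truncation K (\<lambda>y. f y + g y) e v x)) \<le> \<dots>" .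
qed

lemma kernel_integral_le:
  assumes f: "f \<in> borel_measurable lebesgue" and A: "A \<subseteq> {y. r
      \<le> norm (x - y)}" "A \<in> sets lebesgue" and r: "0 < r"
  shows "(\<integral>\<^sup>+y\<in>A. ennreal (cmod (K x y * f y)) \<partial>lebesgue)
    \<le> ennreal (c / r ^ DIM('a)) * (\<integral>\<^sup>+y\<in>A. ennreal (cmod (f y)) \<partial>lebesgue)"
proof -
  have "(\<integral>\<^sup>+y\<in>A. ennreal (cmod (K x y * f y)) \<partial>lebesgue)
    \<le> (\<integral>\<^sup>+y. ennreal (c / r ^ DIM('a)) * (ennreal (cmod (f y))
        * indicator A y) \<partial>lebesgue)"
  proof (rule nn_integral_mono)
    fix y
    show "ennreal (cmod (K x y * f y)) * indicator A y \<le> ennreal (c / r ^ DIM('a)) * (ennreal (cmod (f y))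
        * indicator A y)"
    proof (cases "y \<in> A")
      case True
      then have "cmod (K x y) \<le> c / r ^ DIM('a)" using A r by (intro kernel_le) auto
      then show ?thesis using True
        by (simp add: norm_mult ennreal_mult mult_right_mono ennreal_leI)
    qed simp
  qed
  also have "\<dots> = ennreal (c / r ^ DIM('a))
      * (\<integral>\<^sup>+y\<in>A. ennreal (cmod (f y)) \<partial>lebesgue)"
    using f A(2) by (intro nn_integral_cmult) auto
  finally show ?thesis .
qed

lemma truncation_le:
  assumes "f \<in> borel_measurable lebesgue" "0 < e"
  shows "ennreal (cmod (truncation K f e v x)) \<le> ennreal (c / e ^ DIM('a))
      * (\<integral>\<^sup>+y. ennreal (cmod (f y)) \<partial>lebesgue)"
proof -
  have "ennreal (cmod (truncation K f e v x))
      \<le> (\<integral>\<^sup>+y\<in>annulus x e v. ennreal (cmod (K x y * f y)) \<partial>lebesgue)"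
    unfolding truncation_def by (rule norm_set_integral_le)
  also have "\<dots> \<le> ennreal (c / e ^ DIM('a))
      * (\<integral>\<^sup>+y\<in>annulus x e v. ennreal (cmod (f y)) \<partial>lebesgue)"
    using assms by (intro kernel_integral_le sets_annulus) (auto simp: annulus_def)
  also have "\<dots> \<le> ennreal (c / e ^ DIM('a))
      * (\<integral>\<^sup>+y. ennreal (cmod (f y)) \<partial>lebesgue)"
    by (intro mult_left_mono nn_integral_mono) (auto simp: indicator_def)
  finally show ?thesis .
qed

text \<open>Continuity of every single truncation makes the superlevel sets of their suprema open.
  This gives measurability of the maximal truncation without passing to rational radii, and open
  exceptional sets.\<close>

lemma isCont_truncation:
  assumes f: "loc_integrable f" and e: "0 < e"
  shows "isCont (truncation K f e v) x"
proof -
  have "continuous (at x within ball x (e / 2)) (truncation K f e v)"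
  proof (rule continuous_within_sequentiallyI)
    fix u :: "nat \<Rightarrow> 'a" assume u: "u \<longlonglongrightarrow> x" "\<forall>k. u k \<in> ball x (e / 2)"
    let ?g = "\<lambda>x y. indicator (annulus x e v) y *\<^sub>R (K x y * f y)"
    have meas: "?g z \<in> borel_measurable lebesgue" for z
      using truncation_integrable[OF f e, of z v] by (auto simp: set_integrable_def)
    have "(\<lambda>k. integral\<^sup>L lebesgue (?g (u k))) \<longlonglongrightarrow> integral\<^sup>L lebesgue (?g x)"
    proof (rule integral_dominated_convergence)
      \<comment> \<open>Each \<open>u k\<close> is within \<open>e / 2\<close> of \<open>x\<close>,
        so the annuli about all \<open>u k\<close> lie in \<open>ball x (v + e)\<close>, and on them
        the kernel is at most \<open>c / e ^ DIM('a)\<close>.\<close>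
      show "integrable lebesgue (\<lambda>y. c / e ^ DIM('a) * cmod (f y * indicator (ball x (v + e)) y))"
        by (intro integrable_mult_right integrable_norm loc_integrable_set f) auto
      \<comment> \<open>Away from these two spheres a point is eventually inside, or eventually
        outside, the annuli about \<open>u k\<close>.\<close>
      have "{y. norm (x - y) = e} \<union> {y. norm (x - y) = v} \<in> null_sets lebesgue"
      proof -
        have "{y. norm (x - y) = r} = sphere x r" for r by (auto simp: dist_norm)
        then show ?thesis using negligible_sphere by (auto simp: negligible_iff_null_sets intro!: null_sets.Un)
      qed
      then have "AE y in lebesgue. y \<notin> {y. norm (x - y) = e} \<union> {y. norm (x - y) = v}"
        by (rule AE_not_in)
      then show "AE y in lebesgue. (\<lambda>k. ?g (u k) y) \<longlonglongrightarrow> ?g x y"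
      proof eventually_elim
        fix y assume y: "y \<notin> {y. norm (x - y) = e} \<union> {y. norm (x - y) = v}"
        have un: "(\<lambda>k. norm (u k - y)) \<longlonglongrightarrow> norm (x - y)"
          by (intro tendsto_intros u)
        show "(\<lambda>k. ?g (u k) y) \<longlonglongrightarrow> ?g x y"
        proof (cases "y \<in> annulus x e v")
          case True
          then have "e < norm (x - y)" "norm (x - y) < v" by (auto simp: annulus_def)
          then have "\<forall>\<^sub>F k in sequentially. e < norm (u k - y) \<and> norm (u k - y) < v"
            using order_tendstoD[OF un] by (simp add: eventually_conj)
          then have ev: "\<forall>\<^sub>F k in sequentially. ?g (u k) y = K (u k) y * f y"
            by eventually_elim (simp add: annulus_def)
          have "x \<noteq> y" using \<open>e < norm (x - y)\<close> e by auto
          then have "(\<lambda>k. K (u k) y) \<longlonglongrightarrow> K x y"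
            using isCont_tendsto_compose[OF isCont_kernel_1 u(1)] by blast
          then have "(\<lambda>k. K (u k) y * f y) \<longlonglongrightarrow> K x y * f y" by (intro tendsto_intros)
          then show ?thesis using True tendsto_cong[OF ev] by simp
        next
          case False
          then have "norm (x - y) < e \<or> v < norm (x - y)" using y by (auto simp: annulus_def)
          then have "\<forall>\<^sub>F k in sequentially. norm (u k - y) < e \<or> v < norm (u k - y)"
          proof
            assume "norm (x - y) < e"
            from order_tendstoD(2)[OF un this] show ?thesis by eventually_elim simp
          next
            assume "v < norm (x - y)"
            from order_tendstoD(1)[OF un this] show ?thesis by eventually_elim simp
          qed
          then have ev: "\<forall>\<^sub>F k in sequentially. ?g (u k) y = 0"
            by eventually_elim (auto simp: annulus_def)
          then show ?thesis using False tendsto_cong[OF ev] by simp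
        qed
      qed
      fix k
      show "AE y in lebesgue. norm (?g (u k) y) \<le> c / e ^ DIM('a) * cmod (f y * indicator (ball x (v + e)) y)"
      proof (rule AE_I2)
        fix y
        show "norm (?g (u k) y) \<le> c / e ^ DIM('a) * cmod (f y * indicator (ball x (v + e)) y)"
        proof (cases "y \<in> annulus (u k) e v")
          case True
          have "dist x (u k) < e / 2" using u by simp
          then have "y \<in> ball x (v + e)"
            using True dist_triangle[of x y "u k"] e by (simp add: annulus_def dist_norm)
          moreover have "cmod (K (u k) y) \<le> c / e ^ DIM('a)"
            using True e by (intro kernel_le) (auto simp: annulus_def)
          then have *: "cmod (K (u k) y) * cmod (f y) \<le> c / e ^ DIM('a) * cmod (f y)"
            by (rule mult_right_mono) simp
          ultimately show ?thesis using True * by (simp add: norm_mult)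
        qed (use c e in simp)
      qed
    qed (use meas in auto)
    then show "(\<lambda>k. truncation K f e v (u k)) \<longlonglongrightarrow> truncation K f e v x"
      by (simp add: truncation_def set_lebesgue_integral_def)
  qed
  then show ?thesis using e by (simp add: at_within_open[of x "ball x (e/2)"])
qed

lemma open_sup_truncation:
  assumes f: "loc_integrable f" and I: "I \<subseteq> {(e, v). 0 < e \<and> e < v}"
  shows "open {x. t < sup_truncation K I f x}"
proof -
  have "{x. t < sup_truncation K I f x} = (\<Union>(e, v)\<in>I. {x. t < ennreal (cmod (truncation K f e v x))})"
    by (force simp: sup_truncation_def less_SUP_iff)
  also have "open \<dots>"
  proof (intro open_UN ballI)
    fix i assume i: "i \<in> I"
    obtain e v where ev: "i = (e, v)" by (cases i)
    have "continuous_on UNIV (truncation K f e v)"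
      using i I ev by (intro continuous_at_imp_continuous_on ballI isCont_truncation f) auto
    then have "open {x. t < ennreal (cmod (truncation K f e v x))}"
      by (intro open_Collect_less continuous_intros continuous_on_ennreal) auto
    then show "open (case i of (e, v) \<Rightarrow> {x. t < ennreal (cmod (truncation K f e v x))})"
      using ev by simp
  qed
  finally show ?thesis .
qed

lemma open_maximal_truncation:
  "loc_integrable f \<Longrightarrow> open {x. t < maximal_truncation K f x}"
  unfolding maximal_truncation_eq by (rule open_sup_truncation) auto

lemma measurable_sup_truncation:
  assumes "loc_integrable f" "I \<subseteq> {(e, v). 0 < e \<and> e < v}"
  shows "sup_truncation K I f \<in> borel_measurable lebesgue"
  using open_in_sets_lebesgue[OF open_sup_truncation[OF assms]]
  by (intro borel_measurableI_greater) auto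

lemma measurable_maximal_truncation:
  "loc_integrable f \<Longrightarrow> maximal_truncation K f \<in> borel_measurable lebesgue"
  unfolding maximal_truncation_eq by (rule measurable_sup_truncation) auto

section \<open>Kernel estimates at points outside a Hardy-Littlewood set\<close>

definition tail_const :: real where
  "tail_const = 2 ^ DIM('a) / (1 - 1 / 2 powr d)"

lemma tail_const_pos: "0 < tail_const"
  using d by (simp add: tail_const_def)

text \<open>Smoothness dominates the difference of the kernels by the weight of
  \<open>nn_integral_tail_le\<close>, and the condition on balls required there is what
  \<open>x \<notin> HL_set\<close> provides.\<close>

lemma kernel_diff_tail:
  assumes f: "f \<in> borel_measurable lebesgue" and x: "x \<notin> HL_set (\<lambda>y. ennreal (cmod (f y))) t"
    and t: "0 \<le> t" and r: "0 < r" "norm (x - x') < r / 2"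
    and A: "A \<subseteq> {y. r \<le> norm (x - y)}"
  shows "(\<integral>\<^sup>+y\<in>A. ennreal (cmod ((K x y - K x' y) * f y)) \<partial>lebesgue)
      \<le> ennreal (c * tail_const * t)"
proof -
  have "(\<integral>\<^sup>+y\<in>A. ennreal (cmod ((K x y - K x' y) * f y)) \<partial>lebesgue)
    \<le> (\<integral>\<^sup>+y. ennreal c * (ennreal (r powr d / norm (x - y) powr (real DIM('a) + d))
        * ennreal (cmod (f y))
          * indicator {y. r \<le> norm (x - y)} y) \<partial>lebesgue)"
  proof (rule nn_integral_mono)
    fix y
    show "ennreal (cmod ((K x y - K x' y) * f y)) * indicator A y
      \<le> ennreal c * (ennreal (r powr d / norm (x - y) powr (real DIM('a) + d)) * ennreal (cmod (f y))
          * indicator {y. r \<le> norm (x - y)} y)"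
    proof (cases "y \<in> A")
      case True
      then have y: "r \<le> norm (x - y)" using A by auto
      have "cmod (K x y - K x' y) \<le> c * (norm (x - x') powr d / norm (x - y) powr (DIM('a) + d))"
        using y r by (intro reg1) auto
      also have "\<dots> \<le> c * (r powr d / norm (x - y) powr (DIM('a) + d))"
        using r c d by (intro mult_left_mono divide_right_mono powr_mono2) auto
      finally have "cmod ((K x y - K x' y) * f y) \<le> c * (r powr d / norm (x - y) powr (DIM('a) + d)) * cmod (f y)"
        unfolding norm_mult by (rule mult_right_mono) simp
      then have "ennreal (cmod ((K x y - K x' y) * f y)) \<le> ennreal (c
          * (r powr d / norm (x - y) powr (DIM('a) + d)) * cmod (f y))"
        by (rule ennreal_leI)
      also have "\<dots> = ennreal c * (ennreal (r powr d / norm (x - y) powr (real DIM('a) + d))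
          * ennreal (cmod (f y)))"
        using c by (simp add: mult.assoc flip: ennreal_mult)
      finally show ?thesis using True y by simp
    qed simp
  qed
  also have "\<dots> = ennreal c * (\<integral>\<^sup>+y\<in>{y. r
      \<le> norm (x - y)}. ennreal (r powr d / norm (x - y) powr (real DIM('a) + d))
          * ennreal (cmod (f y)) \<partial>lebesgue)"
  proof (rule nn_integral_cmult)
    have "(\<lambda>y. r powr d / norm (x - y) powr (real DIM('a) + d)) \<in> borel_measurable borel"
      by measurable
    then have 1: "(\<lambda>y. r powr d / norm (x - y) powr (real DIM('a) + d)) \<in> borel_measurable lebesgue"
      by (simp add: measurable_completion)
    have "closed {y. r \<le> norm (x - y)}" by (intro closed_Collect_le continuous_intros)
    then have 2: "{y. r \<le> norm (x - y)} \<in> sets lebesgue" by simp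
    show "(\<lambda>y. ennreal (r powr d / norm (x - y) powr (real DIM('a) + d)) * ennreal (cmod (f y))
        * indicator {y. r \<le> norm (x - y)} y)
        \<in> borel_measurable lebesgue"
      using f by (intro borel_measurable_times_ennreal borel_measurable_indicator[OF 2] measurable_compose[OF 1 measurable_ennreal]) auto
  qed
  also have "\<dots> \<le> ennreal c * ennreal (tail_const * t)"
    unfolding tail_const_def
    using not_HL_setD[OF x _ subset_refl] f d r t by (intro mult_left_mono nn_integral_tail_le) auto
  also have "\<dots> = ennreal (c * tail_const * t)"
    using c t tail_const_pos by (simp add: ennreal_mult[symmetric] mult.assoc)
  finally show ?thesis .
qed

text \<open>Two centres occur: the kernel is evaluated at \<open>x\<close>, while the mass of
  \<open>f\<close> is controlled on balls about a possibly different good point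
  \<open>z\<close>.\<close>

lemma kernel_near_le:
  assumes f: "f \<in> borel_measurable lebesgue" and x: "z \<notin> HL_set (\<lambda>y. ennreal (cmod (f y))) t"
    and t: "0 \<le> t" and r: "0 < r" "0 < R" and A: "A \<in> sets lebesgue" "A \<subseteq> {y. r
        \<le> norm (x - y)}" "A \<subseteq> ball z R"
  shows "(\<integral>\<^sup>+y\<in>A. ennreal (cmod (K x y * f y)) \<partial>lebesgue) \<le> ennreal (c
      * (R / r) ^ DIM('a) * t)"
proof -
  have "(\<integral>\<^sup>+y\<in>A. ennreal (cmod (K x y * f y)) \<partial>lebesgue)
      \<le> ennreal (c / r ^ DIM('a)) * (\<integral>\<^sup>+y\<in>A. ennreal (cmod (f y)) \<partial>lebesgue)"
    by (rule kernel_integral_le[OF f A(2,1) r(1)])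
  also have "\<dots> \<le> ennreal (c / r ^ DIM('a)) * ennreal (t * R ^ DIM('a))"
    by (intro mult_left_mono not_HL_setD[OF x r(2) A(3)]) simp
  also have "\<dots> = ennreal (c * (R / r) ^ DIM('a) * t)"
    using c r t by (subst ennreal_mult[symmetric]) (auto simp: power_divide field_simps)
  finally show ?thesis .
qed

text \<open>Bounds the cost of moving a truncation sphere of radius about \<open>r\<close>. The 6 is
  the ratio of \<open>3 * r\<close>, a radius whose ball contains the shell, to its inner radius
  \<open>r / 2\<close>.\<close>

lemma kernel_annulus_le:
  assumes f: "f \<in> borel_measurable lebesgue" and x: "x \<notin> HL_set (\<lambda>y. ennreal (cmod (f y))) t"
    and t: "0 \<le> t" and r: "0 < r"
  shows "(\<integral>\<^sup>+y\<in>{y. r / 2 \<le> norm (x - y) \<and> norm (x - y) \<le> 2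
      * r}. ennreal (cmod (K x y * f y)) \<partial>lebesgue)
    \<le> ennreal (c * 6 ^ DIM('a) * t)"
proof -
  have "closed {y. r / 2 \<le> norm (x - y) \<and> norm (x - y) \<le> 2 * r}"
    by (intro closed_Collect_conj closed_Collect_le continuous_intros)
  then have "(\<integral>\<^sup>+y\<in>{y. r / 2 \<le> norm (x - y) \<and> norm (x - y) \<le> 2
      * r}. ennreal (cmod (K x y * f y)) \<partial>lebesgue)
    \<le> ennreal (c * ((3 * r) / (r / 2)) ^ DIM('a) * t)"
    using r by (intro kernel_near_le[OF f x t]) (auto simp: dist_norm)
  then show ?thesis using r by simp
qed

text \<open>One summand for each of the three comparisons in
  \<open>maximal_truncation_away_le\<close>, in the order of the proof.\<close>

definition away_const :: real where
  "away_const = c * (8 * real DIM('a)) ^ DIM('a) + c * tail_const + 2 * c * 6 ^ DIM('a)"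

lemma away_const_pos: "0 < away_const"
  unfolding away_const_def using c tail_const_pos by (intro add_pos_pos mult_pos_pos) auto

text \<open>For \<open>v \<le> e\<close> the annulus is empty and the truncation is 0. This happens
  below, where an inner radius is enlarged without regard to \<open>v\<close>.\<close>

lemma truncation_le_maximal_truncation':
  assumes "0 < e"
  shows "ennreal (cmod (truncation K f e v x)) \<le> maximal_truncation K f x"
proof (cases "e < v")
  case False
  then have "annulus x e v = {}" by (auto simp: annulus_def)
  then show ?thesis by (simp add: truncation_def set_lebesgue_integral_def)
qed (use assms truncation_le_maximal_truncation in blast)

text \<open>A truncation at \<open>x\<close> becomes one at the good point \<open>x'\<close> in
  three moves: the triple is replaced by a ball about \<open>x\<close>, the kernel at
  \<open>x\<close> by the kernel at \<open>x'\<close>, and the annulus about \<open>x\<close> by one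
  about \<open>x'\<close>. Every error is measured by ball masses at \<open>x'\<close>; nothing is
  assumed at \<open>x\<close>.\<close>

lemma maximal_truncation_away_le:
  assumes h: "integrable lebesgue h" and x: "x \<in> dyadic j z" and x': "x' \<in> dyadic j z"
    and good: "x' \<notin> HL_set (\<lambda>y. ennreal (cmod (h y))) t" and t: "0 \<le> t"
  shows "maximal_truncation K (\<lambda>y. h y * indicator (- dyadic_triple j z) y) x
    \<le> maximal_truncation K h x' + ennreal (away_const * t)"
  unfolding maximal_truncation_le_iff
proof (intro allI impI)
  fix e v :: real assume e: "0 < e" "e < v"
  define s :: real where "s = 2 powi j"
  define \<rho> where "\<rho> = real DIM('a) * s"
  \<comment> \<open>The ball of radius \<open>R\<close> about \<open>x\<close> contains the triple,
    and points outside it are at least \<open>3 * \<rho>\<close> away from \<open>x'\<close>, which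
    is more than twice \<open>norm (x - x')\<close> as smoothness demands.\<close>
  define R where "R = 4 * \<rho>"
  \<comment> \<open>The effective inner radius of the annulus once the ball has been
    removed.\<close>
  define e1 where "e1 = max e R"
  let ?P = "dyadic_triple j z"
  define A0 where "A0 = annulus x e v - ?P"
  define A2 where "A2 = annulus x e v - ball x R"
  define A3 where "A3 = annulus x' e1 v"
  have s: "0 < s" by (simp add: s_def)
  have \<rho>: "0 < \<rho>" using s by (simp add: \<rho>_def)
  have dxx: "norm (x - x') \<le> \<rho>" using dyadic_norm_diff[OF x x'] by (simp add: \<rho>_def s_def)
  have hm: "h \<in> borel_measurable lebesgue" using h by simp
  have Psub: "?P \<subseteq> ball x R"
  proof
    fix y assume "y \<in> ?P"
    then have "norm (x - y) \<le> 2 * \<rho>"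
      using dyadic_triple_norm_diff[OF _ x, of y] by (simp add: \<rho>_def s_def mult_ac)
    then show "y \<in> ball x R" using \<rho> by (simp add: dist_norm R_def)
  qed
  have sets: "A0 \<in> sets lebesgue" "A2 \<in> sets lebesgue" "A3 \<in> sets lebesgue"
    unfolding A0_def A2_def A3_def by (intro sets.Diff sets_annulus sets_dyadic_triple ball_in_sets_lebesgue)+
  have A0: "A0 \<subseteq> {y. s \<le> norm (x - y)}"
    using not_dyadic_triple_norm[OF _ x] by (auto simp: A0_def s_def)
  have A2: "A2 \<subseteq> {y. R \<le> norm (x - y)}"
    by (auto simp: A2_def dist_norm)
  have tri: "norm (x - y) \<le> norm (x' - y) + \<rho>" "norm (x' - y) \<le> norm (x - y) + \<rho>" for y
    using dxx norm_triangle_ineq[of "x - x'" "x' - y"] norm_triangle_ineq[of "x' - x" "x - y"]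
    by (auto simp: norm_minus_commute)
  have A2': "A2 \<subseteq> {y. 3 * \<rho> \<le> norm (x' - y)}"
  proof
    fix y assume "y \<in> A2"
    then have "R \<le> norm (x - y)" using A2 by auto
    then show "y \<in> {y. 3 * \<rho> \<le> norm (x' - y)}" using tri(1)[of y] by (simp add: R_def)
  qed
  have int: "set_integrable lebesgue A h" if "A \<in> sets lebesgue" for A
    using integrable_imp_set_integrable[OF h that] .
  have i0: "set_integrable lebesgue A0 (\<lambda>y. K x y * h y)"
    by (rule kernel_integrable[OF int[OF sets(1)] A0 s])
  have i2: "set_integrable lebesgue A2 (\<lambda>y. K x y * h y)"
    using \<rho> by (intro kernel_integrable[OF int[OF sets(2)] A2]) (simp add: R_def)
  have i2': "set_integrable lebesgue A2 (\<lambda>y. K x' y * h y)"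
    using \<rho> by (intro kernel_integrable[OF int[OF sets(2)] A2']) simp
  have e1: "0 < e1" using e by (simp add: e1_def)
  have i3: "set_integrable lebesgue A3 (\<lambda>y. K x' y * h y)"
    by (rule kernel_integrable[OF int[OF sets(3)] _ e1]) (auto simp: A3_def annulus_def)
  define I0 where "I0 = (LINT y:A0|lebesgue. K x y * h y)"
  define I2 where "I2 = (LINT y:A2|lebesgue. K x y * h y)"
  define I2' where "I2' = (LINT y:A2|lebesgue. K x' y * h y)"
  define I3 where "I3 = (LINT y:A3|lebesgue. K x' y * h y)"
  have "truncation K (\<lambda>y. h y * indicator (- ?P) y) e v x = I0"
    unfolding truncation_def I0_def set_lebesgue_integral_def
    by (intro Bochner_Integration.integral_cong) (auto simp: A0_def indicator_def)
  moreover have "ennreal (cmod (I0 - I2)) \<le> ennreal (c * (8 * real DIM('a)) ^ DIM('a) * t)"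
  proof -
    have "ennreal (cmod (I0 - I2)) \<le> (\<integral>\<^sup>+y\<in>ball x R - ?P. ennreal (cmod (K x y
        * h y)) \<partial>lebesgue)"
      unfolding I0_def I2_def using Psub
      by (intro norm_set_integral_diff_le i0 i2) (auto simp: A0_def A2_def)
    also have "\<dots> \<le> ennreal (c * ((2 * R) / s) ^ DIM('a) * t)"
    proof (rule kernel_near_le[OF hm good t s])
      show "0 < 2 * R" using \<rho> by (simp add: R_def)
      show "ball x R - ?P \<in> sets lebesgue" by (intro sets.Diff sets_dyadic_triple ball_in_sets_lebesgue)
      show "ball x R - ?P \<subseteq> {y. s \<le> norm (x - y)}"
        using not_dyadic_triple_norm[OF _ x] by (auto simp: s_def)
      show "ball x R - ?P \<subseteq> ball x' (2 * R)"
      proof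
        fix y assume "y \<in> ball x R - ?P"
        then have "norm (x - y) < R" by (simp add: dist_norm)
        then show "y \<in> ball x' (2 * R)" using tri(2)[of y] \<rho> by (simp add: dist_norm R_def)
      qed
    qed
    also have "(2 * R) / s = 8 * real DIM('a)" using s by (simp add: R_def \<rho>_def)
    finally show ?thesis .
  qed
  moreover have "ennreal (cmod (I2 - I2')) \<le> ennreal (c * tail_const * t)"
  proof -
    have "I2 - I2' = (LINT y:A2|lebesgue. K x y * h y - K x' y * h y)"
      unfolding I2_def I2'_def by (rule set_integral_diff(2)[OF i2 i2', symmetric])
    also have "\<dots> = - (LINT y:A2|lebesgue. (K x' y - K x y) * h y)"
      by (simp add: set_lebesgue_integral_def algebra_simps flip: integral_minus)
    finally have "ennreal (cmod (I2 - I2')) = ennreal (cmod (LINT y:A2|lebesgue. (K x' y - K x y) * h y))"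
      by simp
    also have "\<dots> \<le> (\<integral>\<^sup>+y\<in>A2. ennreal (cmod ((K x' y - K x y)
        * h y)) \<partial>lebesgue)"
      by (rule norm_set_integral_le)
    also have "\<dots> \<le> ennreal (c * tail_const * t)"
      using \<rho> dxx A2' by (intro kernel_diff_tail[OF hm good t, where r="3
          * \<rho>"]) (auto simp: norm_minus_commute)
    finally show ?thesis .
  qed
  moreover have "ennreal (cmod (I2' - I3)) \<le> ennreal (2 * c * 6 ^ DIM('a) * t)"
  proof -
    let ?N = "\<lambda>r. {y. r / 2 \<le> norm (x' - y) \<and> norm (x' - y) \<le> 2 * r}"
    have N: "?N r \<in> sets lebesgue" for r
    proof -
      have "closed (?N r)" by (intro closed_Collect_conj closed_Collect_le continuous_intros)
      then show ?thesis by simp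
    qed
    \<comment> \<open>Changing the centre alters distances by at most
      \<open>\<rho> \<le> e1 / 4\<close>, so only points near the spheres of radius
      \<open>e1\<close> and \<open>v\<close> can belong to one set and not to the other.\<close>
    have sub: "(A2 - A3) \<union> (A3 - A2) \<subseteq> ?N e1 \<union> ?N v"
    proof
      fix y assume y: "y \<in> (A2 - A3) \<union> (A3 - A2)"
      have "e \<le> e1" "4 * \<rho> \<le> e1" "e1 = e \<or> e1 = 4 * \<rho>" by (auto simp: e1_def R_def)
      moreover have "(e < norm (x - y) \<and> norm (x - y) < v \<and> 4 * \<rho>
          \<le> norm (x - y)) \<noteq> (e1 < norm (x' - y) \<and> norm (x' - y) < v)"
        using y by (auto simp: A2_def A3_def annulus_def R_def dist_norm)
      ultimately have "(e1 / 2 \<le> norm (x' - y) \<and> norm (x' - y) \<le> 2 * e1) \<or> (v / 2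
          \<le> norm (x' - y) \<and> norm (x' - y) \<le> 2 * v)"
        using tri[of y] \<rho> e by argo
      then show "y \<in> ?N e1 \<union> ?N v" by auto
    qed
    have km: "(\<lambda>y. ennreal (cmod (K x' y * h y))
        * indicator (?N r) y) \<in> borel_measurable lebesgue" if "0 < r" for r
    proof -
      have "(\<lambda>y. indicator (?N r) y *\<^sub>R (K x' y * h y)) \<in> borel_measurable lebesgue"
        using N[of r] hm that by (intro measurable_kernel_mult borel_measurable_scaleR borel_measurable_indicator) auto
      then have "(\<lambda>y. ennreal (cmod (indicator (?N r) y *\<^sub>R (K x' y
          * h y)))) \<in> borel_measurable lebesgue"
        by (rule measurable_compose) measurable
      moreover have "(\<lambda>y. ennreal (cmod (indicator (?N r) y *\<^sub>R (K x' y * h y))))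
          = (\<lambda>y. ennreal (cmod (K x' y * h y)) * indicator (?N r) y)"
        by (auto simp: indicator_def)
      ultimately show ?thesis by (simp only:)
    qed
    have "ennreal (cmod (I2' - I3)) \<le> (\<integral>\<^sup>+y\<in>?N e1 \<union> ?N v. ennreal (cmod (K x' y
        * h y)) \<partial>lebesgue)"
      unfolding I2'_def I3_def by (rule norm_set_integral_diff_le[OF i2' i3 sub])
    also have "\<dots> \<le> (\<integral>\<^sup>+y. ennreal (cmod (K x' y * h y)) * indicator (?N e1) y
        + ennreal (cmod (K x' y * h y)) * indicator (?N v) y \<partial>lebesgue)"
      by (intro nn_integral_mono) (auto simp: indicator_def)
    also have "\<dots> = (\<integral>\<^sup>+y\<in>?N e1. ennreal (cmod (K x' y * h y)) \<partial>lebesgue)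
        + (\<integral>\<^sup>+y\<in>?N v. ennreal (cmod (K x' y * h y)) \<partial>lebesgue)"
      using e e1 by (intro nn_integral_add km) auto
    also have "\<dots> \<le> ennreal (c * 6 ^ DIM('a) * t) + ennreal (c * 6 ^ DIM('a) * t)"
      using e e1 by (intro add_mono kernel_annulus_le[OF hm good t]) auto
    also have "\<dots> = ennreal (2 * c * 6 ^ DIM('a) * t)"
      using c t by (subst ennreal_plus[symmetric]) auto
    finally show ?thesis .
  qed
  moreover have "ennreal (cmod I3) \<le> maximal_truncation K h x'"
    using truncation_le_maximal_truncation'[OF e1, of h v x'] by (simp add: I3_def A3_def truncation_def)
  moreover have "cmod I0 \<le> cmod I3 + (cmod (I0 - I2) + cmod (I2 - I2') + cmod (I2' - I3))"
    using norm_triangle_ineq[of "I0 - I2" I2] norm_triangle_ineq[of "I2 - I2'" I2'] norm_triangle_ineq[of "I2' - I3" I3]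
    by simp
  then have "ennreal (cmod I0) \<le> ennreal (cmod I3) + (ennreal (cmod (I0 - I2)) + ennreal (cmod (I2 - I2'))
      + ennreal (cmod (I2' - I3)))"
    by (simp flip: ennreal_plus)
  ultimately have "ennreal (cmod (truncation K (\<lambda>y. h y * indicator (- ?P) y) e v x))
    \<le> maximal_truncation K h x' + (ennreal (c * (8 * real DIM('a)) ^ DIM('a) * t) + ennreal (c * tail_const
        * t) + ennreal (2 * c * 6 ^ DIM('a) * t))"
    by (auto intro: order_trans[OF _ add_mono[OF _ add_mono[OF add_mono]]])
  also have "ennreal (c * (8 * real DIM('a)) ^ DIM('a) * t) + ennreal (c * tail_const * t) + ennreal (2 * c
      * 6 ^ DIM('a) * t)
     = ennreal (away_const * t)"
    using c t tail_const_pos by (simp add: away_const_def distrib_right flip: ennreal_plus)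
  finally show "ennreal (cmod (truncation K (\<lambda>y. h y * indicator (- ?P) y) e v x))
      \<le> maximal_truncation K h x' + ennreal (away_const * t)" .
qed

end

section \<open>Cotlar's inequality in its square integrable form\<close>

definition square_integrable :: "('a::euclidean_space \<Rightarrow> complex) \<Rightarrow> bool" where
  "square_integrable f \<longleftrightarrow> f \<in> borel_measurable lebesgue \<and> (\<integral>\<^sup>+y. ennreal ((cmod (f y))\<^sup>2) \<partial>lebesgue) < \<infinity>"

lemma square_integrable_restrict:
  assumes "square_integrable f" "A \<in> sets lebesgue"
  shows "square_integrable (\<lambda>y. f y * indicator A y)"
proof -
  have "(\<integral>\<^sup>+y. ennreal ((cmod (f y * indicator A y))\<^sup>2) \<partial>lebesgue)
      \<le> (\<integral>\<^sup>+y. ennreal ((cmod (f y))\<^sup>2) \<partial>lebesgue)"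
    by (intro nn_integral_mono) (auto simp: indicator_def)
  then show ?thesis using assms by (auto simp: square_integrable_def intro: le_less_trans)
qed

text \<open>\<open>B\<close> bounds the square of the operator norm, so that only integrals of
  squares occur and no roots.\<close>

locale cz_operator = cz_kernel K c d
  for K :: "'a::euclidean_space \<Rightarrow> 'a \<Rightarrow> complex" and c d +
  fixes T :: "('a \<Rightarrow> complex) \<Rightarrow> 'a \<Rightarrow> complex" and B :: real
  assumes B: "0 < B"
    and T_square_integrable: "square_integrable f \<Longrightarrow> square_integrable (T f)"
    and T_add: "square_integrable f \<Longrightarrow> square_integrable g \<Longrightarrow>
      AE x in lebesgue. T (\<lambda>y. f y + g y) x = T f x + T g x"
    and T_bound: "square_integrable f \<Longrightarrow>
      (\<integral>\<^sup>+y. ennreal ((cmod (T f y))\<^sup>2) \<partial>lebesgue) \<le> ennreal B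
          * (\<integral>\<^sup>+y. ennreal ((cmod (f y))\<^sup>2) \<partial>lebesgue)"
    and T_kernel: "square_integrable f \<Longrightarrow>
      AE x in lebesgue. x \<notin> closure {y. f y \<noteq> 0} \<longrightarrow> T f x
          = (LINT y|lebesgue. K x y * f y)"
begin

text \<open>The outer 2 counts the two exteriors whose difference is an annulus. Under the root,
  every 3 comes from \<open>(a + b + c)^2 \<le> 3 (a^2 + b^2 + c^2)\<close>, the power of 4 from
  comparing a ball of radius \<open>2 * r\<close> with one of radius \<open>r / 2\<close>, and the
  unit ball from averaging over the latter.\<close>

definition cotlar_const :: real where
  "cotlar_const = 2 * sqrt (3 * (c * tail_const)\<^sup>2 + (3 + 3 * B * 4 ^ DIM('a)) / unit_ball_vol DIM('a))"

lemma cotlar_const_pos: "0 < cotlar_const"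
  unfolding cotlar_const_def using c tail_const_pos B unit_ball_vol_pos[of "real DIM('a)"]
  by (auto intro!: add_pos_nonneg)

text \<open>
  The truncated integral at \<open>x\<close> is compared with \<open>T(f\<chi>\<^bsub>-D\<^esub>) = Tf - T(f\<chi>\<^bsub>D\<^esub>)\<close> at the points of the ball of
  radius \<open>r/2\<close>; the squares are then averaged over that ball.
\<close>

lemma cotlar_exterior:
  assumes f: "integrable lebesgue f" and f2: "square_integrable f" and t: "0 \<le> t"
    and g1: "x \<notin> HL_set (\<lambda>y. ennreal (cmod (f y))) t"
    and g2: "x \<notin> HL_set (\<lambda>y. ennreal ((cmod (f y))\<^sup>2)) (t\<^sup>2)"
    and g3: "x \<notin> HL_set (\<lambda>y. ennreal ((cmod (T f y))\<^sup>2)) (t\<^sup>2)"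
    and r: "0 < r" and D: "D \<in> sets lebesgue" "ball x r \<subseteq> D" "D \<subseteq> cball x r"
  shows "cmod (LINT y:-D|lebesgue. K x y * f y) \<le> cotlar_const / 2 * t"
proof -
  let ?n = "DIM('a)"
  define S where "S = (LINT y:-D|lebesgue. K x y * f y)"
  define f1 where "f1 = (\<lambda>y. f y * indicator D y)"
  define f3 where "f3 = (\<lambda>y. f y * indicator (-D) y)"
  have fm: "f \<in> borel_measurable lebesgue" using f by simp
  have Dc: "-D \<in> sets lebesgue" using sets.compl_sets[OF D(1)] by (simp add: Compl_eq_Diff_UNIV)
  have sq1: "square_integrable f1" unfolding f1_def by (rule square_integrable_restrict[OF f2 D(1)])
  have sq3: "square_integrable f3" unfolding f3_def by (rule square_integrable_restrict[OF f2 Dc])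
  have "(\<lambda>y. f1 y + f3 y) = f" by (auto simp: f1_def f3_def indicator_def)
  then have AE1: "AE z in lebesgue. T f z = T f1 z + T f3 z" using T_add[OF sq1 sq3] by simp
  have Dsub: "-D \<subseteq> {y. r \<le> norm (x - y)}"
  proof
    fix y assume "y \<in> -D"
    then have "y \<notin> ball x r" using D(2) by auto
    then show "y \<in> {y. r \<le> norm (x - y)}" by (simp add: dist_norm)
  qed
  define a where "a = c * tail_const * t"
  have a: "0 \<le> a" using c tail_const_pos t by (simp add: a_def)
  \<comment> \<open>Additivity of \<open>T\<close> and its kernel representation hold only almost
    everywhere, so both identities at \<open>z\<close> appear as conditions.\<close>
  have key: "(cmod S)\<^sup>2 \<le> 3 * a\<^sup>2 + 3 * (cmod (T f z))\<^sup>2 + 3 * (cmod (T f1 z))\<^sup>2"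
    if z: "z \<in> ball x (r / 2)" and z1: "T f z = T f1 z + T f3 z"
      and z2: "z \<notin> closure {y. f3 y \<noteq> 0} \<longrightarrow> T f3 z = (LINT y|lebesgue. K z y
          * f3 y)" for z
  proof -
    have xz: "norm (x - z) < r / 2" using z by (simp add: dist_norm)
    have "closed {y. r \<le> norm (x - y)}" by (intro closed_Collect_le continuous_intros)
    moreover have "{y. f3 y \<noteq> 0} \<subseteq> {y. r \<le> norm (x - y)}" using Dsub
        by (auto simp: f3_def indicator_def)
    ultimately have "closure {y. f3 y \<noteq> 0} \<subseteq> {y. r \<le> norm (x - y)}"
        by (rule closure_minimal[rotated])
    then have "z \<notin> closure {y. f3 y \<noteq> 0}" using xz r by auto
    then have "T f3 z = (LINT y|lebesgue. K z y * f3 y)" using z2 by simp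
    also have "\<dots> = (LINT y:-D|lebesgue. K z y * f y)"
      unfolding set_lebesgue_integral_def by (intro Bochner_Integration.integral_cong) (auto simp: f3_def indicator_def)
    finally have T3: "T f3 z = (LINT y:-D|lebesgue. K z y * f y)" .
    have i: "set_integrable lebesgue (-D) f" by (rule integrable_imp_set_integrable[OF f Dc])
    have i1: "set_integrable lebesgue (-D) (\<lambda>y. K x y * f y)"
      by (rule kernel_integrable[OF i Dsub r])
    have i2: "set_integrable lebesgue (-D) (\<lambda>y. K z y * f y)"
    proof (rule kernel_integrable[OF i])
      show "-D \<subseteq> {y. r / 2 \<le> norm (z - y)}"
      proof
        fix y assume "y \<in> -D"
        then have "r \<le> norm (x - y)" using Dsub by auto
        then show "y \<in> {y. r / 2 \<le> norm (z - y)}" using norm_triangle_ineq[of "x - z" "z - y"] xz by simp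
      qed
    qed (use r in simp)
    have "S - T f3 z = (LINT y:-D|lebesgue. (K x y - K z y) * f y)"
      unfolding S_def T3 left_diff_distrib by (rule set_integral_diff(2)[OF i1 i2, symmetric])
    then have "ennreal (cmod (S - T f3 z)) \<le> (\<integral>\<^sup>+y\<in>-D. ennreal (cmod ((K x y - K z y)
        * f y)) \<partial>lebesgue)"
      by (simp add: norm_set_integral_le)
    also have "\<dots> \<le> ennreal a"
      unfolding a_def by (rule kernel_diff_tail[OF fm g1 t r xz Dsub])
    finally have "cmod (S - T f3 z) \<le> a" using a by simp
    then have "cmod S \<le> a + cmod (T f z) + cmod (T f1 z)"
      using norm_triangle_ineq[of "S - T f3 z" "T f3 z"] norm_triangle_ineq4[of "T f z" "T f1 z"] z1 by simp
    then have "(cmod S)\<^sup>2 \<le> (a + cmod (T f z) + cmod (T f1 z))\<^sup>2"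
      by (intro power_mono) auto
    also have "\<dots> \<le> 3 * a\<^sup>2 + 3 * (cmod (T f z))\<^sup>2 + 3 * (cmod (T f1 z))\<^sup>2"
      using zero_le_power2[of "a - cmod (T f z)"] zero_le_power2[of "a - cmod (T f1 z)"]
        zero_le_power2[of "cmod (T f z) - cmod (T f1 z)"]
      by (simp add: power2_eq_square algebra_simps)
    finally show ?thesis .
  qed
  have u: "unit_ball_vol ?n \<noteq> 0"
    using unit_ball_vol_pos[OF of_nat_0_le_iff, of ?n] by linarith
  define V where "V = unit_ball_vol ?n * (r / 2) ^ ?n"
  have V: "0 < V" using r unit_ball_vol_pos[of "real ?n"] by (simp add: V_def)
  have eV: "emeasure lebesgue (ball x (r / 2)) = ennreal V"
    unfolding V_def using r by (intro emeasure_lebesgue_ball) simp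
  have Tm: "T f \<in> borel_measurable lebesgue" "T f1 \<in> borel_measurable lebesgue"
    using T_square_integrable[OF f2] T_square_integrable[OF sq1] by (auto simp: square_integrable_def)
  let ?b = "indicator (ball x (r / 2)) :: 'a \<Rightarrow> ennreal"
  have bm: "?b \<in> borel_measurable lebesgue"
    by (rule borel_measurable_indicator[OF ball_in_sets_lebesgue])
  have "ennreal ((cmod S)\<^sup>2 * V) = (\<integral>\<^sup>+z. ennreal ((cmod S)\<^sup>2) * ?b z \<partial>lebesgue)"
    using V ball_in_sets_lebesgue[of x "r/2"] by (subst nn_integral_cmult_indicator) (auto simp: eV ennreal_mult)
  \<comment> \<open>The indicator stays on \<open>T f\<close>, which \<open>g3\<close> controls on
    balls, and is dropped from \<open>T f1\<close>, for which only the global bound on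
    \<open>T\<close> is available.\<close>
  also have "\<dots> \<le> (\<integral>\<^sup>+z. ennreal (3 * a\<^sup>2) * ?b z + (3
      * (ennreal ((cmod (T f z))\<^sup>2) * ?b z) + 3 * ennreal ((cmod (T f1 z))\<^sup>2)) \<partial>lebesgue)"
  proof (rule nn_integral_mono_AE)
    show "AE z in lebesgue. ennreal ((cmod S)\<^sup>2) * ?b z \<le> ennreal (3 * a\<^sup>2) * ?b z + (3
        * (ennreal ((cmod (T f z))\<^sup>2) * ?b z) + 3 * ennreal ((cmod (T f1 z))\<^sup>2))"
      using AE1 T_kernel[OF sq3]
    proof eventually_elim
      case (elim z)
      show ?case
      proof (cases "z \<in> ball x (r / 2)")
        case True
        have "ennreal ((cmod S)\<^sup>2) \<le> ennreal (3 * a\<^sup>2 + 3 * (cmod (T f z))\<^sup>2 + 3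
            * (cmod (T f1 z))\<^sup>2)"
          by (rule ennreal_leI[OF key[OF True elim]])
        also have "\<dots> = ennreal (3 * a\<^sup>2) + (3 * ennreal ((cmod (T f z))\<^sup>2) + 3
            * ennreal ((cmod (T f1 z))\<^sup>2))"
          by (simp add: ennreal_mult add.assoc)
        finally show ?thesis using True by simp
      qed simp
    qed
  qed
  also have "\<dots> = (\<integral>\<^sup>+z. ennreal (3 * a\<^sup>2) * ?b z \<partial>lebesgue)
      + ((\<integral>\<^sup>+z. 3 * (ennreal ((cmod (T f z))\<^sup>2) * ?b z) \<partial>lebesgue)
      + (\<integral>\<^sup>+z. 3 * ennreal ((cmod (T f1 z))\<^sup>2) \<partial>lebesgue))"
    using Tm bm by (subst nn_integral_add nn_integral_add[OF borel_measurable_times_ennreal]; (measurable | simp))+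
  also have "\<dots> = ennreal (3 * a\<^sup>2) * ennreal V + (3
      * (\<integral>\<^sup>+z\<in>ball x (r/2). ennreal ((cmod (T f z))\<^sup>2) \<partial>lebesgue)
      + 3 * (\<integral>\<^sup>+z. ennreal ((cmod (T f1 z))\<^sup>2) \<partial>lebesgue))"
    using Tm bm ball_in_sets_lebesgue[of x "r/2"]
    by (subst nn_integral_cmult_indicator, simp, subst nn_integral_cmult, simp, subst nn_integral_cmult, simp) (simp add: eV)
  also have "\<dots> \<le> ennreal (3 * a\<^sup>2) * ennreal V + (3 * ennreal (t\<^sup>2 * (r/2) ^ ?n) + 3
      * ennreal (B * (t\<^sup>2 * (2 * r) ^ ?n)))"
  proof (intro add_mono mult_left_mono order_refl)
    show "(\<integral>\<^sup>+z\<in>ball x (r/2). ennreal ((cmod (T f z))\<^sup>2) \<partial>lebesgue)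
        \<le> ennreal (t\<^sup>2 * (r/2) ^ ?n)"
      using r by (intro not_HL_setD[OF g3]) auto
    have "(\<integral>\<^sup>+z. ennreal ((cmod (T f1 z))\<^sup>2) \<partial>lebesgue) \<le> ennreal B
        * (\<integral>\<^sup>+z. ennreal ((cmod (f1 z))\<^sup>2) \<partial>lebesgue)"
      by (rule T_bound[OF sq1])
    also have "(\<integral>\<^sup>+z. ennreal ((cmod (f1 z))\<^sup>2) \<partial>lebesgue)
        = (\<integral>\<^sup>+z\<in>D. ennreal ((cmod (f z))\<^sup>2) \<partial>lebesgue)"
      by (intro nn_integral_cong) (auto simp: f1_def indicator_def)
    also have "\<dots> \<le> ennreal (t\<^sup>2 * (2 * r) ^ ?n)"
    proof (rule not_HL_setD[OF g2])
      show "D \<subseteq> ball x (2 * r)" using D(3) r by auto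
    qed (use r in simp)
    finally show "(\<integral>\<^sup>+z. ennreal ((cmod (T f1 z))\<^sup>2) \<partial>lebesgue) \<le> ennreal (B
        * (t\<^sup>2 * (2 * r) ^ ?n))"
      using B r by (simp add: ennreal_mult mult_left_mono)
  qed auto
  also have "\<dots> = ennreal (3 * a\<^sup>2 * V + (3 * (t\<^sup>2 * (r/2) ^ ?n) + 3 * (B * (t\<^sup>2 * (2
      * r) ^ ?n))))"
    using B r V by (simp add: ennreal_mult ennreal_plus)
  finally have "(cmod S)\<^sup>2 * V \<le> 3 * a\<^sup>2 * V + (3 * (t\<^sup>2 * (r/2) ^ ?n) + 3 * (B
      * (t\<^sup>2 * (2 * r) ^ ?n)))"
    using B r V by (subst (asm) ennreal_le_iff) auto
  \<comment> \<open>Both powers of \<open>r\<close> are expressed by the volume \<open>V\<close> of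
    the averaging ball, which then cancels.\<close>
  also have "(2 * r) ^ ?n = 4 ^ ?n * (r / 2) ^ ?n"
    by (simp only: power_mult_distrib[symmetric]) simp
  also have "(r / 2) ^ ?n = V / unit_ball_vol ?n"
    using u by (simp add: V_def)
  also have "3 * a\<^sup>2 * V + (3 * (t\<^sup>2 * (V / unit_ball_vol ?n)) + 3 * (B * (t\<^sup>2 * (4 ^ ?n
      * (V / unit_ball_vol ?n)))))
     = (t\<^sup>2 * (3 * (c * tail_const)\<^sup>2 + (3 + 3 * B * 4 ^ ?n) / unit_ball_vol ?n)) * V"
    by (simp add: a_def power_mult_distrib algebra_simps add_divide_distrib)
  finally have "(cmod S)\<^sup>2 \<le> t\<^sup>2 * (3 * (c * tail_const)\<^sup>2 + (3 + 3 * B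
      * 4 ^ ?n) / unit_ball_vol ?n)"
    using V by simp
  then have "sqrt ((cmod S)\<^sup>2) \<le> sqrt (t\<^sup>2 * (3 * (c * tail_const)\<^sup>2 + (3 + 3 * B
      * 4 ^ ?n) / unit_ball_vol ?n))"
    by (rule real_sqrt_le_mono)
  then show ?thesis
    using t by (simp add: S_def cotlar_const_def real_sqrt_mult mult.commute)
qed

text \<open>The annulus is open at both ends: it is the complement of the closed ball of radius
  \<open>e\<close> without the complement of the open ball of radius \<open>v\<close>. This is why
  \<open>cotlar_exterior\<close> admits every set between an open ball and its closure.\<close>

lemma cotlar:
  assumes f: "integrable lebesgue f" and f2: "square_integrable f" and t: "0 \<le> t"
    and g1: "x \<notin> HL_set (\<lambda>y. ennreal (cmod (f y))) t"
    and g2: "x \<notin> HL_set (\<lambda>y. ennreal ((cmod (f y))\<^sup>2)) (t\<^sup>2)"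
    and g3: "x \<notin> HL_set (\<lambda>y. ennreal ((cmod (T f y))\<^sup>2)) (t\<^sup>2)"
  shows "maximal_truncation K f x \<le> ennreal (cotlar_const * t)"
  unfolding maximal_truncation_le_iff
proof (intro allI impI)
  fix e v :: real assume e: "0 < e" "e < v"
  have sets: "- cball x e \<in> sets lebesgue" "- ball x v \<in> sets lebesgue"
    by (auto intro!: open_in_sets_lebesgue lebesgue_closedin)
  have i: "set_integrable lebesgue (- ball x v) (\<lambda>y. K x y * f y)"
    using e by (intro kernel_integrable[OF integrable_imp_set_integrable[OF f sets(2)], where r=v]) (auto simp: dist_norm)
  have i': "set_integrable lebesgue (annulus x e v) (\<lambda>y. K x y * f y)"
    by (rule truncation_integrable[OF integrable_imp_loc_integrable[OF f] e(1)])
  have U: "- cball x e = annulus x e v \<union> - ball x v"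
  proof (rule set_eqI)
    fix y show "y \<in> - cball x e \<longleftrightarrow> y \<in> annulus x e v \<union> - ball x v"
      using e by (simp add: annulus_def dist_norm) linarith
  qed
  have disj: "annulus x e v \<inter> - ball x v = {}" by (auto simp: annulus_def dist_norm)
  have "(LINT y:-cball x e|lebesgue. K x y * f y) = truncation K f e v x + (LINT y:-ball x v|lebesgue. K x y * f y)"
    unfolding U truncation_def by (rule set_integral_Un[OF disj i' i])
  then have "cmod (truncation K f e v x) \<le> cmod (LINT y:-cball x e|lebesgue. K x y * f y)
      + cmod (LINT y:-ball x v|lebesgue. K x y * f y)"
    using norm_triangle_ineq4[of "LINT y:-cball x e|lebesgue. K x y * f y" "LINT y:-ball x v|lebesgue. K x y
        * f y"] by simp
  also have "\<dots> \<le> cotlar_const / 2 * t + cotlar_const / 2 * t"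
  proof (rule add_mono)
    show "cmod (LINT y:-cball x e|lebesgue. K x y * f y) \<le> cotlar_const / 2 * t"
      using e by (intro cotlar_exterior[OF f f2 t g1 g2 g3, where r=e]) auto
    show "cmod (LINT y:-ball x v|lebesgue. K x y * f y) \<le> cotlar_const / 2 * t"
      using e by (intro cotlar_exterior[OF f f2 t g1 g2 g3, where r=v]) auto
  qed
  finally show "ennreal (cmod (truncation K f e v x)) \<le> ennreal (cotlar_const * t)"
    by (intro ennreal_leI) (simp add: mult.commute)
qed

end

section \<open>Calderon--Zygmund decomposition\<close>

text \<open>
  Continuity of \<open>f\<close> makes \<open>|f| \<le> t\<close> off the selected cubes evident and avoids the Lebesgue
  differentiation theorem; it is removed by density in the weak type estimate below.
\<close>

lemma calderon_zygmund_decomposition: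
  fixes f :: "'a::euclidean_space \<Rightarrow> complex"
  assumes f: "integrable lebesgue f" and cont: "continuous_on UNIV f" and t: "0 < t"
  obtains S g where "countable S" "disjoint_family_on (\<lambda>Q. Q) S"
    "\<And>Q. Q \<in> S \<Longrightarrow> \<exists>j z. Q = dyadic j z"
    "ennreal t * emeasure lebesgue (\<Union>S) \<le> (\<integral>\<^sup>+y. ennreal (cmod (f y)) \<partial>lebesgue)"
    "integrable lebesgue g" "\<And>x. cmod (g x) \<le> 2 ^ DIM('a) * t"
    "(\<integral>\<^sup>+y. ennreal (cmod (g y)) \<partial>lebesgue)
        \<le> (\<integral>\<^sup>+y. ennreal (cmod (f y)) \<partial>lebesgue)"
    "\<And>x. x \<notin> \<Union>S \<Longrightarrow> g x = f x"
    "\<And>Q. Q \<in> S \<Longrightarrow> (LINT y:Q|lebesgue. f y - g y) = 0"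
    "\<And>Q. Q \<in> S \<Longrightarrow> (\<integral>\<^sup>+y\<in>Q. ennreal (cmod (f y - g y)) \<partial>lebesgue) \<le> ennreal (2 * 2 ^ DIM('a) * t) * emeasure lebesgue Q"
proof -
  let ?n = "DIM('a)" and ?L = "lebesgue :: 'a measure"
  let ?F = "\<lambda>y. ennreal (cmod (f y))"
  have fm: "f \<in> borel_measurable ?L" using f by simp
  have Fm: "?F \<in> borel_measurable ?L" using fm by simp
  have fI: "(\<integral>\<^sup>+y. ?F y \<partial>?L) < \<infinity>" using f by (simp add: integrable_iff_bounded)
  obtain I where I: "0 \<le> I" "(\<integral>\<^sup>+y. ?F y \<partial>?L) = ennreal I"
    using fI by (cases "(\<integral>\<^sup>+y. ?F y \<partial>?L)") auto
  define P where "P Q \<longleftrightarrow> ennreal t * emeasure ?L Q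
      < (\<integral>\<^sup>+y\<in>Q. ?F y \<partial>?L)" for Q
  define S where "S = maximal_dyadic P"
  obtain m :: nat where m: "I / t < 2 ^ m" using real_arch_pow[of 2 "I / t"] by auto
  \<comment> \<open>Integrability of \<open>f\<close> bounds the scale of the cubes on which its
    average exceeds \<open>t\<close>, so maximal ones exist.\<close>
  have bdd: "j \<le> int m" if "P (dyadic j x)" for j x
  proof (rule ccontr)
    assume "\<not> j \<le> int m"
    then have j: "int m \<le> j" by simp
    have "ennreal (t * (2 powi j) ^ ?n) < (\<integral>\<^sup>+y\<in>dyadic j x. ?F y \<partial>?L)"
      using that t by (simp add: P_def emeasure_dyadic ennreal_mult)
    also have "\<dots> \<le> ennreal I" unfolding I(2)[symmetric]
      by (intro nn_integral_mono) (auto simp: indicator_def)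
    finally have "t * (2 powi j) ^ ?n < I" using t I by (simp add: ennreal_less_iff)
    then have "(2 powi j) ^ ?n < I / t" using t by (simp add: field_simps)
    moreover have "(2::real) powi (int m) \<le> 2 powi j" using j by (intro power_int_increasing) auto
    then have "2 ^ m \<le> (2::real) powi j" by simp
    moreover have "(2::real) powi j \<le> (2 powi j) ^ ?n"
    proof (rule self_le_power)
      have "(1::real) \<le> 2 ^ m" by simp
      then show "(1::real) \<le> 2 powi j" using \<open>2 ^ m \<le> (2::real) powi j\<close> by linarith
    qed simp
    ultimately show False using m by linarith
  qed
  have cS: "countable S" unfolding S_def by (rule countable_maximal_dyadic)
  have dS: "disjoint_family_on (\<lambda>Q. Q) S" unfolding S_def by (rule disjoint_maximal_dyadic)
  have sS: "Q \<in> sets ?L" if "Q \<in> S" for Q using that unfolding S_def by (rule sets_maximal_dyadic)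
  define \<Omega> where "\<Omega> = \<Union>S"
  have \<Omega>: "\<Omega> = {x. \<exists>j. P (dyadic j x)}"
    unfolding \<Omega>_def S_def by (rule Union_maximal_dyadic[where m="\<lambda>_. int m"]) (rule bdd)
  have s\<Omega>: "\<Omega> \<in> sets ?L" unfolding \<Omega>_def using cS sS by (intro sets.countable_Union) auto
  have SE: "\<exists>j z. Q = dyadic j z \<and> P Q \<and> (\<forall>i>j. \<not> P (dyadic i z))" if "Q \<in> S" for Q
    using that by (auto simp: S_def maximal_dyadic_def)
  have SP: "ennreal t * emeasure ?L Q \<le> (\<integral>\<^sup>+y\<in>Q. ?F y \<partial>?L)" if "Q \<in> S" for Q
    using SE[OF that] by (auto simp: P_def)
  \<comment> \<open>The parent of a maximal cube was not selected, so the average over it is at most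
    \<open>t\<close>; passing to the child costs the ratio \<open>2 ^ ?n\<close> of the
    volumes.\<close>
  have Sup: "(\<integral>\<^sup>+y\<in>Q. ?F y \<partial>?L) \<le> ennreal (2 ^ ?n * t)
      * emeasure ?L Q" if Q: "Q \<in> S" for Q
  proof -
    obtain j z where j: "Q = dyadic j z" "\<not> P (dyadic (j + 1) z)" using SE[OF Q] by auto
    have "(\<integral>\<^sup>+y\<in>Q. ?F y \<partial>?L) \<le> (\<integral>\<^sup>+y\<in>dyadic (j
        + 1) z. ?F y \<partial>?L)"
      unfolding j by (rule nn_set_integral_mono_set[OF dyadic_mono_Suc])
    also have "\<dots> \<le> ennreal t * emeasure ?L (dyadic (j + 1) z)" using j(2) by (simp add: P_def)
    also have "\<dots> = ennreal (2 ^ ?n * t) * emeasure ?L Q"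
      using t by (simp add: j(1) emeasure_dyadic powi_two_Suc power_mult_distrib mult_ac flip: ennreal_mult)
    finally show ?thesis .
  qed
  have I\<Omega>: "(\<integral>\<^sup>+y\<in>\<Omega>. h y \<partial>?L)
      = (\<integral>\<^sup>+Q. (\<integral>\<^sup>+y\<in>Q. h y \<partial>?L) \<partial>count_space S)"
    if "h \<in> borel_measurable ?L" for h
    unfolding \<Omega>_def using nn_integral_UN_disjoint[OF cS sS that dS] by simp
  have m\<Omega>: "ennreal t * emeasure ?L \<Omega> \<le> (\<integral>\<^sup>+y. ?F y \<partial>?L)"
  proof -
    have "ennreal t * emeasure ?L \<Omega> = (\<integral>\<^sup>+y\<in>\<Omega>. ennreal t \<partial>?L)"
      using s\<Omega> by (simp add: nn_integral_cmult_indicator)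
    also have "\<dots> = (\<integral>\<^sup>+Q. (\<integral>\<^sup>+y\<in>Q. ennreal t \<partial>?L) \<partial>count_space S)" by (rule I\<Omega>) simp
    also have "\<dots> \<le> (\<integral>\<^sup>+Q. (\<integral>\<^sup>+y\<in>Q. ?F y \<partial>?L) \<partial>count_space S)"
    proof (rule nn_integral_mono)
      fix Q assume "Q \<in> space (count_space S)"
      then have Q: "Q \<in> S" by simp
      show "(\<integral>\<^sup>+y\<in>Q. ennreal t \<partial>?L)
          \<le> (\<integral>\<^sup>+y\<in>Q. ?F y \<partial>?L)"
        using SP[OF Q] nn_integral_cmult_indicator[OF sS[OF Q], of "ennreal t"] by (simp del: emeasure_completion)
    qed
    also have "\<dots> = (\<integral>\<^sup>+y\<in>\<Omega>. ?F y \<partial>?L)" by (rule I\<Omega>[symmetric, OF Fm])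
    also have "\<dots> \<le> (\<integral>\<^sup>+y. ?F y \<partial>?L)"
        by (intro nn_integral_mono) (auto simp: indicator_def)
    finally show ?thesis .
  qed
  have out: "cmod (f x) \<le> t" if "x \<notin> \<Omega>" for x
  proof (rule ccontr)
    assume "\<not> cmod (f x) \<le> t"
    then obtain \<tau> where \<tau>: "t < \<tau>" "\<tau> < cmod (f x)" using dense[of t "cmod (f x)"] by auto
    have "open {y. \<tau> < cmod (f y)}" by (intro open_Collect_less continuous_intros cont)
    moreover have "x \<in> {y. \<tau> < cmod (f y)}" using \<tau> by simp
    ultimately obtain j where j: "dyadic j x \<subseteq> {y. \<tau> < cmod (f y)}"
      by (rule dyadic_subset_open) (meson order_refl)
    have "ennreal t * emeasure ?L (dyadic j x) < ennreal \<tau> * emeasure ?L (dyadic j x)"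
    proof -
      have "t * (2 powi j) ^ ?n < \<tau> * (2 powi j) ^ ?n" "0 < \<tau> * (2 powi j) ^ ?n"
        using \<tau> t by (auto intro!: mult_strict_right_mono)
      then have "ennreal (t * (2 powi j) ^ ?n) < ennreal (\<tau> * (2 powi j) ^ ?n)"
        by (rule ennreal_lessI[rotated])
      then show ?thesis using \<tau> t by (simp only: emeasure_dyadic) (simp add: ennreal_mult)
    qed
    also have "\<dots> = (\<integral>\<^sup>+y\<in>dyadic j x. ennreal \<tau> \<partial>?L)"
      by (rule nn_integral_cmult_indicator[OF sets_dyadic, symmetric])
    also have "\<dots> \<le> (\<integral>\<^sup>+y\<in>dyadic j x. ?F y \<partial>?L)"
      using j by (intro nn_integral_mono) (auto simp: indicator_def intro!: ennreal_leI less_imp_le)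
    finally have "P (dyadic j x)" by (simp add: P_def)
    then show False using that \<Omega> by auto
  qed
  \<comment> \<open>\<open>g\<close> is the average of \<open>f\<close> over the selected cube
    through the point; \<open>cub\<close> finds this cube, which is unique by disjointness.\<close>
  define cub where "cub y = (THE Q. Q \<in> S \<and> y \<in> Q)" for y
  have cub: "cub y = Q" if "Q \<in> S" "y \<in> Q" for Q y
    unfolding cub_def using that dS by (intro the_equality) (auto simp: disjoint_family_on_def)
  define av where "av Q = (LINT y:Q|?L. f y) / of_real (measure ?L Q)" for Q
  define g where "g y = (if y \<in> \<Omega> then av (cub y) else f y)" for y
  have gQ: "g y = av Q" if "Q \<in> S" "y \<in> Q" for Q y
    using that cub by (auto simp: g_def \<Omega>_def)
  have mQ: "0 < measure ?L Q" "emeasure ?L Q = ennreal (measure ?L Q)" if Q: "Q \<in> S" for Q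
  proof -
    obtain j z where "Q = dyadic j z" using SE[OF Q] by auto
    then have "emeasure ?L Q = ennreal ((2 powi j) ^ ?n)" by (simp add: emeasure_dyadic)
    then show "0 < measure ?L Q" "emeasure ?L Q = ennreal (measure ?L Q)"
      by (auto simp: measure_def)
  qed
  have avQ: "ennreal (cmod (av Q)) * emeasure ?L Q
      \<le> (\<integral>\<^sup>+y\<in>Q. ?F y \<partial>?L)" if Q: "Q \<in> S" for Q
  proof -
    have "ennreal (cmod (av Q)) * emeasure ?L Q = ennreal (cmod (LINT y:Q|?L. f y))"
      using mQ[OF Q] by (simp add: av_def norm_divide flip: ennreal_mult)
    also have "\<dots> \<le> (\<integral>\<^sup>+y\<in>Q. ?F y \<partial>?L)" by (rule norm_set_integral_le)
    finally show ?thesis .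
  qed
  have avt: "cmod (av Q) \<le> 2 ^ ?n * t" if Q: "Q \<in> S" for Q
  proof -
    have "ennreal (cmod (av Q)) * emeasure ?L Q \<le> ennreal (2 ^ ?n * t) * emeasure ?L Q"
      using avQ[OF Q] Sup[OF Q] by (rule order_trans)
    then have "ennreal (cmod (av Q) * measure ?L Q) \<le> ennreal (2 ^ ?n * t * measure ?L Q)"
      using mQ[OF Q] t by (simp add: ennreal_mult)
    then have "cmod (av Q) * measure ?L Q \<le> 2 ^ ?n * t * measure ?L Q"
      using t mQ(1)[OF Q] by (simp add: ennreal_le_iff)
    then show ?thesis using mQ(1)[OF Q] by simp
  qed
  have gb: "cmod (g x) \<le> 2 ^ ?n * t" for x
  proof (cases "x \<in> \<Omega>")
    case True
    then show ?thesis using gQ avt by (auto simp: \<Omega>_def)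
  next
    case False
    have "1 * t \<le> 2 ^ ?n * t" using t by (intro mult_right_mono) auto
    then show ?thesis using out[OF False] False by (simp add: g_def)
  qed
  have gm: "g \<in> borel_measurable ?L"
  proof (rule measurable_piecewise_restrict[of "insert (-\<Omega>) S"])
    show "countable (insert (-\<Omega>) S)" using cS by simp
    have c: "-\<Omega> \<in> sets ?L" using sets.compl_sets[OF s\<Omega>] by (simp add: Compl_eq_Diff_UNIV)
    show "space ?L \<subseteq> \<Union>(insert (-\<Omega>) S)" by (auto simp: \<Omega>_def)
    fix R assume R: "R \<in> insert (-\<Omega>) S"
    then show "R \<inter> space ?L \<in> sets ?L" using sS c by auto
    show "g \<in> borel_measurable (restrict_space ?L R)"
    proof (cases "R \<in> S")
      case True
      then show ?thesis
        using gQ by (subst measurable_cong[where g="\<lambda>_. av R"]) (auto simp: space_restrict_space)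
    next
      case False
      then have "R = -\<Omega>" using R by simp
      then show ?thesis
        by (subst measurable_cong[where g=f]) (auto simp: space_restrict_space g_def intro!: measurable_restrict_space1 fm)
    qed
  qed
  have gm': "(\<lambda>y. ennreal (cmod (g y))) \<in> borel_measurable ?L" using gm by simp
  have gI: "(\<integral>\<^sup>+y\<in>Q. ennreal (cmod (g y)) \<partial>?L)
      \<le> (\<integral>\<^sup>+y\<in>Q. ?F y \<partial>?L)" if Q: "Q \<in> S" for Q
  proof -
    have "(\<integral>\<^sup>+y\<in>Q. ennreal (cmod (g y)) \<partial>?L)
        = (\<integral>\<^sup>+y\<in>Q. ennreal (cmod (av Q)) \<partial>?L)"
      by (intro nn_integral_cong) (auto simp: indicator_def gQ[OF Q])
    also have "\<dots> = ennreal (cmod (av Q)) * emeasure ?L Q"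
      by (rule nn_integral_cmult_indicator[OF sS[OF Q]])
    also have "\<dots> \<le> (\<integral>\<^sup>+y\<in>Q. ?F y \<partial>?L)" by (rule avQ[OF Q])
    finally show ?thesis .
  qed
  have gle: "(\<integral>\<^sup>+y. ennreal (cmod (g y)) \<partial>?L)
      \<le> (\<integral>\<^sup>+y. ?F y \<partial>?L)"
  proof -
    have split: "(\<integral>\<^sup>+y. h y \<partial>?L)
        = (\<integral>\<^sup>+y\<in>\<Omega>. h y \<partial>?L)
            + (\<integral>\<^sup>+y\<in>-\<Omega>. h y \<partial>?L)"
      if "h \<in> borel_measurable ?L" for h :: "'a \<Rightarrow> ennreal"
    proof -
      have c: "-\<Omega> \<in> sets ?L" using sets.compl_sets[OF s\<Omega>] by (simp add: Compl_eq_Diff_UNIV)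
      have "(\<integral>\<^sup>+y. h y \<partial>?L) = (\<integral>\<^sup>+y. h y * indicator \<Omega> y + h y
          * indicator (-\<Omega>) y \<partial>?L)"
        by (intro nn_integral_cong) (auto simp: indicator_def)
      also have "\<dots> = (\<integral>\<^sup>+y\<in>\<Omega>. h y \<partial>?L)
          + (\<integral>\<^sup>+y\<in>-\<Omega>. h y \<partial>?L)"
        using that s\<Omega> c by (intro nn_integral_add borel_measurable_times_ennreal borel_measurable_indicator)
      finally show ?thesis .
    qed
    have "(\<integral>\<^sup>+y\<in>\<Omega>. ennreal (cmod (g y)) \<partial>?L)
        \<le> (\<integral>\<^sup>+y\<in>\<Omega>. ?F y \<partial>?L)"
      unfolding I\<Omega>[OF Fm] I\<Omega>[OF gm'] by (rule nn_integral_mono) (simp add: gI)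
    moreover have "(\<integral>\<^sup>+y\<in>-\<Omega>. ennreal (cmod (g y)) \<partial>?L)
        = (\<integral>\<^sup>+y\<in>-\<Omega>. ?F y \<partial>?L)"
      by (intro nn_integral_cong) (auto simp: indicator_def g_def)
    ultimately show ?thesis unfolding split[OF Fm] split[OF gm'] by (intro add_mono) auto
  qed
  have gi: "integrable ?L g"
    using gm le_less_trans[OF gle fI] by (intro integrableI_bounded) auto
  show ?thesis
  proof (rule that[of S g])
    show "countable S" "disjoint_family_on (\<lambda>Q. Q) S" by (fact cS dS)+
    show "\<exists>j z. Q = dyadic j z" if "Q \<in> S" for Q using SE[OF that] by auto
    show "ennreal t * emeasure lebesgue (\<Union>S) \<le> (\<integral>\<^sup>+y. ?F y \<partial>?L)"
        using m\<Omega> by (simp add: \<Omega>_def)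
    show "integrable ?L g" "\<And>x. cmod (g x) \<le> 2 ^ ?n * t"
      "(\<integral>\<^sup>+y. ennreal (cmod (g y)) \<partial>?L) \<le> (\<integral>\<^sup>+y. ?F y \<partial>?L)"
          by (fact gi gb gle)+
    show "g x = f x" if "x \<notin> \<Union>S" for x using that by (simp add: g_def \<Omega>_def)
    show "(LINT y:Q|?L. f y - g y) = 0" if Q: "Q \<in> S" for Q
    proof -
      have "(LINT y:Q|?L. g y) = (LINT y:Q|?L. av Q)"
        unfolding set_lebesgue_integral_def
        by (intro Bochner_Integration.integral_cong) (auto simp: indicator_def gQ[OF Q])
      also have "\<dots> = (LINT y:Q|?L. f y)"
      proof -
        have "emeasure ?L Q < \<infinity>" using mQ(2)[OF Q] by (simp only: ennreal_less_top infinity_ennreal_def)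
        then have "integrable ?L (indicator Q :: 'a \<Rightarrow> real)"
          by (rule integrable_real_indicator[OF sS[OF Q]])
        then have "(LINT y:Q|?L. av Q) = measure ?L Q *\<^sub>R av Q"
          unfolding set_lebesgue_integral_def by (subst integral_scaleR_left) simp_all
        then show ?thesis using mQ(1)[OF Q] by (simp add: av_def scaleR_conv_of_real)
      qed
      finally show ?thesis
        by (subst set_integral_diff(2)) (auto intro!: integrable_imp_set_integrable f gi sS Q)
    qed
    show "(\<integral>\<^sup>+y\<in>Q. ennreal (cmod (f y - g y)) \<partial>?L) \<le> ennreal (2 * 2 ^ ?n * t)
        * emeasure ?L Q" if Q: "Q \<in> S" for Q
    proof -
      have "(\<integral>\<^sup>+y\<in>Q. ennreal (cmod (f y - g y)) \<partial>?L)
          \<le> (\<integral>\<^sup>+y. ?F y * indicator Q y + ennreal (cmod (g y)) * indicator Q y \<partial>?L)"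
        by (intro nn_integral_mono) (auto simp: indicator_def norm_triangle_ineq4 simp flip: ennreal_plus)
      also have "\<dots> = (\<integral>\<^sup>+y\<in>Q. ?F y \<partial>?L)
          + (\<integral>\<^sup>+y\<in>Q. ennreal (cmod (g y)) \<partial>?L)"
        using Fm gm' sS[OF Q] by (intro nn_integral_add borel_measurable_times_ennreal borel_measurable_indicator)
      also have "\<dots> \<le> ennreal (2 ^ ?n * t) * emeasure ?L Q + ennreal (2 ^ ?n * t) * emeasure ?L Q"
        using Sup[OF Q] gI[OF Q] by (intro add_mono) (auto intro: order_trans)
      also have "\<dots> = ennreal (2 * 2 ^ ?n * t) * emeasure ?L Q"
        using t by (simp add: mult.assoc flip: distrib_right ennreal_plus)
      finally show ?thesis .
    qed
  qed
qed

text \<open>The modulus is taken only after integrating over a piece, so cancellation inside a piece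
  is preserved; all pieces are compared with one majorant \<open>G\<close>, whose integral collects
  the bounds.\<close>

lemma norm_set_integral_pieces_le:
  fixes F :: "'b \<Rightarrow> complex" and G :: "'b \<Rightarrow> ennreal"
  assumes S: "countable S" "disjoint_family_on (\<lambda>Q. Q) S" "\<And>Q. Q \<in> S
      \<Longrightarrow> Q \<in> sets M"
    and A: "A \<in> sets M" and F: "set_integrable M A F" and F0: "\<And>x. x \<notin> \<Union>S
        \<Longrightarrow> F x = 0"
    and G: "G \<in> borel_measurable M"
    and le: "\<And>Q. Q \<in> S \<Longrightarrow> ennreal (cmod (LINT x:A \<inter> Q|M. F x))
        \<le> (\<integral>\<^sup>+x\<in>Q. G x \<partial>M)"
  shows "ennreal (cmod (LINT x:A|M. F x)) \<le> (\<integral>\<^sup>+x. G x \<partial>M)"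
proof -
  \<comment> \<open>Countable additivity is formulated for sequences, so \<open>S\<close> is
    enumerated, with the empty set at indices that no member occupies.\<close>
  define X where "X k = \<Union>{Q\<in>S. to_nat_on S Q = k}" for k
  have X: "X k \<in> S \<or> X k = {}" for k
  proof (cases "\<exists>Q\<in>S. to_nat_on S Q = k")
    case True
    then obtain Q where "Q \<in> S" "to_nat_on S Q = k" by auto
    then have "{Q\<in>S. to_nat_on S Q = k} = {Q}"
      using S(1) by (auto dest: inj_on_to_nat_on[THEN inj_onD])
    then show ?thesis using \<open>Q \<in> S\<close> by (simp add: X_def)
  next
    case False
    then have "{Q\<in>S. to_nat_on S Q = k} = {}" by auto
    then have "X k = {}" unfolding X_def by (simp only: Union_empty)
    then show ?thesis by simp
  qed
  have Xs: "X k \<in> sets M" for k using X[of k] S(3) by auto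
  have UX: "(\<Union>k. X k) = \<Union>S" by (auto simp: X_def)
  have Xd: "disjoint_family X"
    unfolding disjoint_family_on_def
  proof (intro ballI impI)
    fix k l :: nat assume "k \<noteq> l"
    show "X k \<inter> X l = {}"
    proof (rule ccontr)
      assume "X k \<inter> X l \<noteq> {}"
      then obtain x Q R where *: "Q \<in> S" "to_nat_on S Q = k" "x \<in> Q" "R \<in> S" "to_nat_on S R
          = l" "x \<in> R"
        unfolding X_def by blast
      then have "Q = R" using disjoint_family_onD[OF S(2), of Q R] by blast
      then show False using * \<open>k \<noteq> l\<close> by simp
    qed
  qed
  have lX: "ennreal (cmod (LINT x:A \<inter> X k|M. F x)) \<le> (\<integral>\<^sup>+x\<in>X k. G x \<partial>M)" for k
    using X[of k] le[of "X k"] by (auto simp: set_lebesgue_integral_def)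
  have eq: "(LINT x:A|M. F x) = (LINT x:(\<Union>k. A \<inter> X k)|M. F x)"
    unfolding set_lebesgue_integral_def using UX F0
    by (intro Bochner_Integration.integral_cong refl) (auto simp: indicator_def)
  have "(LINT x:(\<Union>k. A \<inter> X k)|M. F x) = (\<Sum>k. LINT x:A \<inter> X k|M. F x)"
    using A Xs Xd
    by (intro lebesgue_integral_countable_add set_integrable_subset[OF F])
      (auto simp: disjoint_family_on_def)
  then have "ennreal (cmod (LINT x:A|M. F x)) = ennreal (cmod (\<Sum>k. LINT x:A \<inter> X k|M. F x))"
    using eq by simp
  also have "\<dots> \<le> (\<Sum>k. ennreal (cmod (LINT x:A \<inter> X k|M. F x)))"
  proof (cases "(\<Sum>k. ennreal (cmod (LINT x:A \<inter> X k|M. F x))) = \<infinity>")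
    case False
    then have s: "summable (\<lambda>k. cmod (LINT x:A \<inter> X k|M. F x))"
      by (intro summable_suminf_not_top) auto
    then have "cmod (\<Sum>k. LINT x:A \<inter> X k|M. F x) \<le> (\<Sum>k. cmod (LINT x:A \<inter> X k|M. F x))"
      by (rule summable_norm)
    then have "ennreal (cmod (\<Sum>k. LINT x:A \<inter> X k|M. F x))
        \<le> ennreal (\<Sum>k. cmod (LINT x:A \<inter> X k|M. F x))"
      by (rule ennreal_leI)
    also have "\<dots> = (\<Sum>k. ennreal (cmod (LINT x:A \<inter> X k|M. F x)))"
      using s by (intro suminf_ennreal2[symmetric]) auto
    finally show ?thesis .
  qed simp
  also have "\<dots> \<le> (\<Sum>k. \<integral>\<^sup>+x\<in>X k. G x \<partial>M)"
    by (intro suminf_le summableI lX)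
  also have "\<dots> = (\<integral>\<^sup>+k. (\<integral>\<^sup>+x\<in>X k. G x \<partial>M) \<partial>count_space UNIV)"
    by (rule nn_integral_count_space_nat[symmetric])
  also have "\<dots> = (\<integral>\<^sup>+x\<in>(\<Union>k. X k). G x \<partial>M)"
    using Xs Xd G by (intro nn_integral_UN_disjoint[symmetric]) auto
  also have "\<dots> \<le> (\<integral>\<^sup>+x. G x \<partial>M)"
    by (intro nn_integral_mono) (auto simp: indicator_def)
  finally show ?thesis .
qed

section \<open>Functions with mean zero on disjoint dyadic cubes\<close>

context cz_kernel
begin

text \<open>The 2 counts the two boundary spheres of the annulus; 6 is the ratio of
  \<open>3 * r\<close> to \<open>r / 2\<close> for the neighbourhood of a sphere of radius
  \<open>r\<close>.\<close>

definition mean_zero_const :: real where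
  "mean_zero_const = 2 * c * 6 ^ DIM('a) * unit_ball_vol DIM('a)"

lemma mean_zero_const_pos: "0 < mean_zero_const"
  using c unit_ball_vol_pos[OF of_nat_0_le_iff, of "DIM('a)"]
      by (simp add: mean_zero_const_def del: unit_ball_vol_pos)

text \<open>
  The cancellation of \<open>b\<close> is used on the cubes contained in the annulus; a cube that is only
  partly contained in it lies in a neighbourhood of one of the two boundary spheres.
\<close>

lemma maximal_truncation_mean_zero_le:
  fixes l :: "'a set \<Rightarrow> int" and z :: "'a set \<Rightarrow> 'a"
  assumes S: "countable S" "disjoint_family_on (\<lambda>Q. Q) S" "\<And>Q. Q \<in> S \<Longrightarrow> Q
      = dyadic (l Q) (z Q)"
    and b: "integrable lebesgue b" and b0: "\<And>x. x \<notin> \<Union>S \<Longrightarrow> b x = 0"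
    and bQ: "\<And>Q. Q \<in> S \<Longrightarrow> (LINT y:Q|lebesgue. b y) = 0"
    and t: "0 \<le> t" and bt: "\<And>Q. Q \<in> S
        \<Longrightarrow> (\<integral>\<^sup>+y\<in>Q. ennreal (cmod (b y)) \<partial>lebesgue) \<le> ennreal t
            * emeasure lebesgue Q"
    and x: "\<And>Q. Q \<in> S \<Longrightarrow> 4 * real DIM('a) * 2 powi l Q \<le> norm (x - z Q)"
  shows "maximal_truncation K b x \<le>
     (\<integral>\<^sup>+Q. ennreal (c * ((real DIM('a)
         * 2 powi l Q) powr d / norm (x - z Q) powr (real DIM('a) + d))) *
        (\<integral>\<^sup>+y\<in>Q. ennreal (cmod (b y)) \<partial>lebesgue) \<partial>count_space S)
            + ennreal (mean_zero_const * t)"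
  unfolding maximal_truncation_le_iff
proof (intro allI impI)
  fix e v :: real assume e: "0 < e" "e < v"
  then have v: "0 < v" by simp
  let ?n = "DIM('a)" and ?L = "lebesgue :: 'a measure"
  let ?A = "annulus x e v"
  let ?N = "\<lambda>r. {y. r / 2 \<le> norm (x - y) \<and> norm (x - y) \<le> 2 * r}"
  define co where "co Q = ennreal (c * ((real ?n * 2 powi l Q) powr d / norm (x - z Q) powr (real ?n + d)))" for Q
  define k where "k r = ennreal (c / (r / 2) ^ ?n * t)" for r
  \<comment> \<open>The cubes are disjoint, so at most one term is nonzero at each point and the
    supremum acts as a sum.\<close>
  define G0 where "G0 y = (SUP Q\<in>S. co Q * (ennreal (cmod (b y)) * indicator Q y))" for y
  define G where "G y = G0 y + (k e * indicator (?N e) y + k v * indicator (?N v) y)" for y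
  have bm: "b \<in> borel_measurable ?L" using b by simp
  have sQ: "Q \<in> sets ?L" if "Q \<in> S" for Q using S(3)[OF that] sets_dyadic by metis
  have N: "?N r \<in> sets ?L" for r
  proof -
    have "closed (?N r)" by (intro closed_Collect_conj closed_Collect_le continuous_intros)
    then show ?thesis by simp
  qed
  have bQm: "(\<lambda>y. ennreal (cmod (b y)) * indicator Q y) \<in> borel_measurable ?L" if "Q \<in> S" for Q
    using bm sQ[OF that] by (intro borel_measurable_times_ennreal borel_measurable_indicator) auto
  have cbQm: "(\<lambda>y. co Q * (ennreal (cmod (b y))
      * indicator Q y)) \<in> borel_measurable ?L" if "Q \<in> S" for Q
    by (rule borel_measurable_times_ennreal[OF borel_measurable_const bQm[OF that]])
  have G0m: "G0 \<in> borel_measurable ?L"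
    unfolding G0_def using S(1) cbQm by (intro borel_measurable_SUP) auto
  have km: "(\<lambda>y. k r * indicator (?N r) y) \<in> borel_measurable ?L" for r
    by (rule borel_measurable_times_ennreal[OF borel_measurable_const borel_measurable_indicator[OF N]])
  have Gm: "G \<in> borel_measurable ?L"
    unfolding G_def by (intro borel_measurable_add G0m km)
  have i: "set_integrable ?L ?A (\<lambda>y. K x y * b y)"
    by (rule truncation_integrable[OF integrable_imp_loc_integrable[OF b] e(1)])
  have "ennreal (cmod (LINT y:?A|?L. K x y * b y)) \<le> (\<integral>\<^sup>+y. G y \<partial>?L)"
  proof (rule norm_set_integral_pieces_le[OF S(1,2) sQ sets_annulus i _ Gm])
    show "K x y * b y = 0" if "y \<notin> \<Union>S" for y using b0[OF that] by simp
    fix Q assume Q: "Q \<in> S"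
    define s where "s = real ?n * 2 powi l Q"
    define r0 where "r0 = norm (x - z Q)"
    have s: "0 < s" by (simp add: s_def)
    have r0: "4 * s \<le> r0" using x[OF Q] by (simp add: s_def r0_def)
    have dz: "norm (z Q - y) \<le> s" if "y \<in> Q" for y
      unfolding s_def using that S(3)[OF Q] by (metis dyadic_norm_diff dyadic_refl)
    have xy: "norm (x - y) \<le> r0 + s" "r0 \<le> norm (x - y) + s" if "y \<in> Q" for y
      using dz[OF that] norm_triangle_ineq[of "x - z Q" "z Q - y"] norm_triangle_ineq[of "x - y" "y - z Q"]
      by (auto simp: r0_def norm_minus_commute)
    have Qsub: "Q \<subseteq> {y. s \<le> norm (x - y)}" using xy(2) r0 s by fastforce
    have bi: "set_integrable ?L Q b" by (rule integrable_imp_set_integrable[OF b sQ[OF Q]])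
    have iK: "set_integrable ?L Q (\<lambda>y. K x y * b y)" by (rule kernel_integrable[OF bi Qsub s])
    consider "Q \<subseteq> ?A" | "?A \<inter> Q
        = {}" | y1 y2 where "y1 \<in> Q" "y1 \<in> ?A" "y2 \<in> Q" "y2 \<notin> ?A" by blast
    then show "ennreal (cmod (LINT y:?A \<inter> Q|?L. K x y * b y))
        \<le> (\<integral>\<^sup>+y\<in>Q. G y \<partial>?L)"
    proof cases
      case 1
      then have AQ: "?A \<inter> Q = Q" by auto
      have iz: "set_integrable ?L Q (\<lambda>y. K x (z Q) * b y)" using bi by simp
      \<comment> \<open>Since \<open>b\<close> has mean zero on \<open>Q\<close>, the constant
        \<open>K x (z Q)\<close> can be subtracted from the kernel.\<close>
      have "(LINT y:Q|?L. (K x y - K x (z Q)) * b y) = (LINT y:Q|?L. K x y * b y) - (LINT y:Q|?L. K x (z Q) * b y)"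
        unfolding left_diff_distrib by (rule set_integral_diff(2)[OF iK iz])
      also have "(LINT y:Q|?L. K x (z Q) * b y) = 0" using bQ[OF Q] by simp
      finally have "ennreal (cmod (LINT y:?A \<inter> Q|?L. K x y * b y))
          = ennreal (cmod (LINT y:Q|?L. (K x y - K x (z Q)) * b y))"
        by (simp add: AQ)
      also have "\<dots> \<le> (\<integral>\<^sup>+y\<in>Q. ennreal (cmod ((K x y - K x (z Q)) * b y)) \<partial>?L)"
        by (rule norm_set_integral_le)
      also have "\<dots> \<le> (\<integral>\<^sup>+y\<in>Q. G y \<partial>?L)"
      proof (rule nn_integral_mono)
        fix y
        show "ennreal (cmod ((K x y - K x (z Q)) * b y)) * indicator Q y \<le> G y * indicator Q y"
        proof (cases "y \<in> Q")
          case True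
          have "cmod (K x (z Q) - K x y) \<le> c * (norm (z Q - y) powr d / norm (z Q - x) powr (real ?n + d))"
            using dz[OF True] r0 s by (intro reg2) (simp add: r0_def norm_minus_commute)
          also have "\<dots> \<le> c * (s powr d / norm (x - z Q) powr (real ?n + d))"
            using dz[OF True] c d by (subst (2) norm_minus_commute) (intro mult_left_mono divide_right_mono powr_mono2, auto)
          finally have "ennreal (cmod ((K x y - K x (z Q)) * b y)) \<le> ennreal (c
              * (s powr d / norm (x - z Q) powr (real ?n + d)) * cmod (b y))"
            unfolding norm_mult by (intro ennreal_leI mult_right_mono) (simp_all add: norm_minus_commute)
          also have "\<dots> = co Q * (ennreal (cmod (b y)) * indicator Q y)"
            using c True by (subst ennreal_mult) (auto simp: co_def s_def)
          also have "\<dots> \<le> G0 y" unfolding G0_def by (rule SUP_upper[OF Q])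
          also have "\<dots> \<le> G y" by (simp add: G_def)
          finally show ?thesis using True by simp
        qed simp
      qed
      finally show ?thesis .
    next
      case 2
      then show ?thesis by (simp add: set_lebesgue_integral_def)
    next
      case 3
      have 3: "e < norm (x - y1)" "norm (x - y1) < v" "norm (x - y2) \<le> e \<or> v \<le> norm (x - y2)"
        "norm (x - y1) \<le> r0 + s" "r0 \<le> norm (x - y1) + s" "norm (x - y2) \<le> r0 + s" "r0
            \<le> norm (x - y2) + s"
        using 3 xy by (auto simp: annulus_def)
      \<comment> \<open>A cube that is neither inside nor outside the annulus crosses a sphere of
        radius \<open>r\<close>. All its distances to \<open>x\<close> lie between
        \<open>r0 - s\<close> and \<open>r0 + s\<close>, and so does \<open>r\<close>; as
        \<open>4 * s \<le> r0\<close>, they differ from \<open>r\<close> by a factor of at most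
        2.\<close>
      have "\<exists>r. (r = e \<or> r = v) \<and> Q \<subseteq> ?N r"
      proof (cases "norm (x - y2) \<le> e")
        case True
        have "Q \<subseteq> ?N e"
        proof
          fix y assume "y \<in> Q"
          from xy[OF this] show "y \<in> ?N e" using 3 True r0 s by simp
        qed
        then show ?thesis by blast
      next
        case False
        have "Q \<subseteq> ?N v"
        proof
          fix y assume "y \<in> Q"
          from xy[OF this] show "y \<in> ?N v" using 3 False r0 s by simp
        qed
        then show ?thesis by blast
      qed
      then obtain r where r: "r = e \<or> r = v" "Q \<subseteq> ?N r" by blast
      then have r_pos: "0 < r" using e v by auto
      have "ennreal (cmod (LINT y:?A \<inter> Q|?L. K x y * b y))
          \<le> (\<integral>\<^sup>+y\<in>?A \<inter> Q. ennreal (cmod (K x y * b y)) \<partial>?L)"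
        by (rule norm_set_integral_le)
      also have "\<dots> \<le> (\<integral>\<^sup>+y\<in>Q. ennreal (cmod (K x y * b y)) \<partial>?L)"
          by (rule nn_set_integral_mono_set) simp
      also have "\<dots> \<le> ennreal (c / (r / 2) ^ ?n)
          * (\<integral>\<^sup>+y\<in>Q. ennreal (cmod (b y)) \<partial>?L)"
        using r r_pos by (intro kernel_integral_le bm sQ Q) auto
      also have "\<dots> \<le> ennreal (c / (r / 2) ^ ?n) * (ennreal t * emeasure ?L Q)"
        by (intro mult_left_mono bt Q) simp
      also have "\<dots> = k r * emeasure ?L Q"
      proof -
        have "ennreal (c / (r / 2) ^ ?n * t) = ennreal (c / (r / 2) ^ ?n) * ennreal t"
          using c r_pos t by (intro ennreal_mult) auto
        then show ?thesis by (simp only: k_def mult.assoc)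
      qed
      also have "\<dots> = (\<integral>\<^sup>+y\<in>Q. k r \<partial>?L)"
          by (rule nn_integral_cmult_indicator[OF sQ[OF Q], symmetric])
      also have "\<dots> \<le> (\<integral>\<^sup>+y\<in>Q. G y \<partial>?L)"
      proof (rule nn_integral_mono)
        fix y
        show "k r * indicator Q y \<le> G y * indicator Q y"
        proof (cases "y \<in> Q")
          case True
          then have "y \<in> ?N r" using r by auto
          then have "k r \<le> k e * indicator (?N e) y + k v * indicator (?N v) y"
            using r(1) by (auto intro: add_increasing add_increasing2)
          also have "\<dots> \<le> G y" by (simp add: G_def)
          finally show ?thesis using True by simp
        qed simp
      qed
      finally show ?thesis .
    qed
  qed
  also have "(\<integral>\<^sup>+y. G y \<partial>?L) = (\<integral>\<^sup>+y. G0 y \<partial>?L)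
      + ((\<integral>\<^sup>+y. k e * indicator (?N e) y \<partial>?L) + (\<integral>\<^sup>+y. k v
          * indicator (?N v) y \<partial>?L))"
    unfolding G_def by (simp only: nn_integral_add[OF G0m borel_measurable_add[OF km km]] nn_integral_add[OF km km])
  also have "\<dots> \<le> (\<integral>\<^sup>+Q. co Q
      * (\<integral>\<^sup>+y\<in>Q. ennreal (cmod (b y)) \<partial>?L) \<partial>count_space S)
          + (ennreal (mean_zero_const / 2 * t) + ennreal (mean_zero_const / 2 * t))"
  proof (intro add_mono)
    have "(\<integral>\<^sup>+y. G0 y \<partial>?L) \<le> (\<integral>\<^sup>+y. \<integral>\<^sup>+Q. co Q
        * (ennreal (cmod (b y)) * indicator Q y) \<partial>count_space S \<partial>?L)"
      unfolding G0_def by (intro nn_integral_mono SUP_least nn_integral_ge_point)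
    also have "\<dots> = (\<integral>\<^sup>+Q. \<integral>\<^sup>+y. co Q * (ennreal (cmod (b y))
        * indicator Q y) \<partial>?L \<partial>count_space S)"
      by (rule nn_integral_count_space_nn_integral[OF S(1) cbQm])
    also have "\<dots> = (\<integral>\<^sup>+Q. co Q
        * (\<integral>\<^sup>+y\<in>Q. ennreal (cmod (b y)) \<partial>?L) \<partial>count_space S)"
      by (rule nn_integral_cong) (simp add: nn_integral_cmult[OF bQm])
    finally show "(\<integral>\<^sup>+y. G0 y \<partial>?L) \<le> (\<integral>\<^sup>+Q. co Q
        * (\<integral>\<^sup>+y\<in>Q. ennreal (cmod (b y)) \<partial>?L) \<partial>count_space S)" .
    have kr: "(\<integral>\<^sup>+y. k r * indicator (?N r) y \<partial>?L) \<le> ennreal (mean_zero_const / 2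
        * t)" if r: "0 < r" for r
    proof -
      have "(\<integral>\<^sup>+y. k r * indicator (?N r) y \<partial>?L) = k r * emeasure ?L (?N r)"
        by (rule nn_integral_cmult_indicator[OF N])
      also have "\<dots> \<le> k r * emeasure ?L (ball x (3 * r))"
        using r by (intro mult_left_mono emeasure_mono) (auto simp: dist_norm)
      also have "\<dots> = ennreal (c / (r / 2) ^ ?n * t) * ennreal (unit_ball_vol ?n * (3 * r) ^ ?n)"
        unfolding k_def using r by (subst emeasure_lebesgue_ball) auto
      also have "\<dots> = ennreal (c / (r / 2) ^ ?n * t * (unit_ball_vol ?n * (3 * r) ^ ?n))"
        using c r t by (intro ennreal_mult[symmetric]) auto
      also have "c / (r / 2) ^ ?n * t * (unit_ball_vol ?n * (3 * r) ^ ?n) = c * ((3 * r) / (r / 2)) ^ ?n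
          * unit_ball_vol ?n * t"
        by (simp only: power_divide) simp
      also have "(3 * r) / (r / 2) = 6" using r by simp
      finally show ?thesis by (simp add: mean_zero_const_def mult.assoc)
    qed
    show "(\<integral>\<^sup>+y. k e * indicator (?N e) y \<partial>?L) \<le> ennreal (mean_zero_const / 2 * t)"
      "(\<integral>\<^sup>+y. k v * indicator (?N v) y \<partial>?L) \<le> ennreal (mean_zero_const / 2 * t)"
      using kr e v by auto
  qed
  also have "ennreal (mean_zero_const / 2 * t) + ennreal (mean_zero_const / 2 * t) = ennreal (mean_zero_const * t)"
    using mean_zero_const_pos t by (subst ennreal_plus[symmetric]) auto
  finally show "ennreal (cmod (truncation K b e v x)) \<le>
     (\<integral>\<^sup>+Q. ennreal (c * ((real ?n * 2 powi l Q) powr d / norm (x - z Q) powr (real ?n + d))) *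
        (\<integral>\<^sup>+y\<in>Q. ennreal (cmod (b y)) \<partial>?L) \<partial>count_space S)
            + ennreal (mean_zero_const * t)"
    by (simp add: truncation_def co_def)
qed

end

section \<open>The weak type (1,1) estimate\<close>

context cz_kernel
begin

text \<open>The pointwise bound is a sum of tails, one per cube, plus a constant that the level
  absorbs. Each tail is integrated in \<open>x\<close> by \<open>nn_integral_tail_le\<close> applied
  to the constant function 1 about \<open>z Q\<close>, and Chebyshev's inequality does the
  rest.\<close>

lemma mean_zero_weak_type:
  fixes l :: "'a set \<Rightarrow> int" and z :: "'a set \<Rightarrow> 'a"
  assumes S: "countable S" "disjoint_family_on (\<lambda>Q. Q) S" "\<And>Q. Q \<in> S \<Longrightarrow> Q
      = dyadic (l Q) (z Q)"
    and b: "integrable lebesgue b" and b0: "\<And>x. x \<notin> \<Union>S \<Longrightarrow> b x = 0"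
    and bQ: "\<And>Q. Q \<in> S \<Longrightarrow> (LINT y:Q|lebesgue. b y) = 0"
    and \<tau>: "0 \<le> \<tau>" and bt: "\<And>Q. Q \<in> S
        \<Longrightarrow> (\<integral>\<^sup>+y\<in>Q. ennreal (cmod (b y)) \<partial>lebesgue)
            \<le> ennreal \<tau> * emeasure lebesgue Q"
    and t: "0 < t"
  defines "U \<equiv> \<Union>Q\<in>S. ball (z Q) (4 * real DIM('a) * 2 powi l Q)"
  shows "ennreal t * emeasure lebesgue ({x. ennreal (mean_zero_const * \<tau> + t) < maximal_truncation K b x} - U)
    \<le> ennreal (c * (tail_const * unit_ball_vol DIM('a)))
        * (\<integral>\<^sup>+y. ennreal (cmod (b y)) \<partial>lebesgue)"
proof -
  let ?n = "DIM('a)" and ?L = "lebesgue :: 'a measure"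
  define E where "E = {x. ennreal (mean_zero_const * \<tau> + t) < maximal_truncation K b x} - U"
  define \<beta> where "\<beta> Q = (\<integral>\<^sup>+y\<in>Q. ennreal (cmod (b y)) \<partial>?L)" for Q
  define s where "s Q = real ?n * 2 powi l Q" for Q
  define co where "co Q x = ennreal (c * (s Q powr d / norm (x - z Q) powr (real ?n + d)))" for Q x
  \<comment> \<open>The numerator is enlarged from \<open>s Q\<close> to \<open>4 * s Q\<close> so
    that it matches the excluded radius, as \<open>nn_integral_tail_le\<close> requires.\<close>
  define f where "f Q x = ennreal c * \<beta> Q * (ennreal ((4 * s Q) powr d / norm (z Q - x) powr (real ?n
      + d)) * 1 * indicator {y. 4 * s Q \<le> norm (z Q - y)} x)" for Q x
  have s: "0 < s Q" for Q by (simp add: s_def)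
  have "open U" unfolding U_def by auto
  then have Es: "E \<in> sets ?L"
    unfolding E_def using open_maximal_truncation[OF integrable_imp_loc_integrable[OF b]]
    by (intro sets.Diff open_in_sets_lebesgue) auto
  have fm0: "(\<lambda>x. ennreal ((4 * s Q) powr d / norm (z Q - x) powr (real ?n + d)) * 1 * indicator {y. 4
      * s Q \<le> norm (z Q - y)} x) \<in> borel_measurable ?L" for Q
  proof -
    have "(\<lambda>y. (4 * s Q) powr d / norm (z Q - y) powr (real DIM('a) + d)) \<in> borel_measurable borel"
      by measurable
    then have 1: "(\<lambda>y. (4 * s Q) powr d / norm (z Q - y) powr (real DIM('a)
        + d)) \<in> borel_measurable lebesgue"
      by (simp add: measurable_completion)
    have "closed {y. 4 * s Q \<le> norm (z Q - y)}" by (intro closed_Collect_le continuous_intros)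
    then have 2: "{y. 4 * s Q \<le> norm (z Q - y)} \<in> sets lebesgue" by simp
    show ?thesis
      by (intro borel_measurable_times_ennreal borel_measurable_indicator[OF 2] measurable_compose[OF 1 measurable_ennreal]) auto
  qed
  have fm: "f Q \<in> borel_measurable ?L" for Q
    unfolding f_def by (rule borel_measurable_times_ennreal[OF borel_measurable_const fm0])
  have "ennreal t * emeasure ?L E = (\<integral>\<^sup>+x. ennreal t * indicator E x \<partial>?L)"
    by (rule nn_integral_cmult_indicator[OF Es, symmetric])
  also have "\<dots> \<le> (\<integral>\<^sup>+x. \<integral>\<^sup>+Q. f Q x \<partial>count_space S \<partial>?L)"
  proof (rule nn_integral_mono)
    fix x
    show "ennreal t * indicator E x \<le> (\<integral>\<^sup>+Q. f Q x \<partial>count_space S)"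
    proof (cases "x \<in> E")
      case True
      have far: "4 * s Q \<le> norm (x - z Q)" if "Q \<in> S" for Q
      proof -
        have "x \<notin> ball (z Q) (4 * real ?n * 2 powi l Q)" using True that by (auto simp: E_def U_def)
        then show ?thesis by (simp add: s_def dist_norm norm_minus_commute mult.assoc)
      qed
      have "maximal_truncation K b x \<le> (\<integral>\<^sup>+Q. co Q x * \<beta> Q \<partial>count_space S)
          + ennreal (mean_zero_const * \<tau>)"
        unfolding co_def \<beta>_def s_def
        using far by (intro maximal_truncation_mean_zero_le[OF S b b0 bQ \<tau> bt]) (auto simp: s_def mult.assoc)
      moreover have "ennreal t + ennreal (mean_zero_const * \<tau>) < maximal_truncation K b x"
        using True mean_zero_const_pos \<tau> t by (simp add: E_def add.commute flip: ennreal_plus)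
      ultimately have "ennreal t + ennreal (mean_zero_const * \<tau>) \<le> (\<integral>\<^sup>+Q. co Q x
          * \<beta> Q \<partial>count_space S) + ennreal (mean_zero_const * \<tau>)"
        by (meson less_le_trans less_imp_le)
      then have "ennreal t \<le> (\<integral>\<^sup>+Q. co Q x * \<beta> Q \<partial>count_space S)"
        by (simp only: add.commute[of _ "ennreal (mean_zero_const * \<tau>)"] ennreal_add_left_cancel_le) simp
      also have "\<dots> \<le> (\<integral>\<^sup>+Q. f Q x \<partial>count_space S)"
      proof (rule nn_integral_mono)
        fix Q assume "Q \<in> space (count_space S)"
        then have Q: "Q \<in> S" by simp
        have "co Q x \<le> ennreal (c * ((4 * s Q) powr d / norm (z Q - x) powr (real ?n + d)))"
          unfolding co_def norm_minus_commute[of x] using c d s[of Q]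
          by (intro ennreal_leI mult_left_mono divide_right_mono powr_mono2) auto
        also have "\<dots> = ennreal c * ennreal ((4 * s Q) powr d / norm (z Q - x) powr (real ?n + d))"
          using c by (intro ennreal_mult) auto
        finally have "co Q x * \<beta> Q \<le> ennreal c * ennreal ((4
            * s Q) powr d / norm (z Q - x) powr (real ?n + d)) * \<beta> Q"
          by (rule mult_right_mono) simp
        then show "co Q x * \<beta> Q \<le> f Q x"
          using far[OF Q] by (simp add: f_def norm_minus_commute mult_ac)
      qed
      finally show ?thesis using True by simp
    qed simp
  qed
  also have "\<dots> = (\<integral>\<^sup>+Q. \<integral>\<^sup>+x. f Q x \<partial>?L \<partial>count_space S)"
    by (rule nn_integral_count_space_nn_integral[OF S(1) fm])
  also have "\<dots> \<le> (\<integral>\<^sup>+Q. ennreal (c * (tail_const * unit_ball_vol ?n))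
      * \<beta> Q \<partial>count_space S)"
  proof (rule nn_integral_mono)
    fix Q assume "Q \<in> space (count_space S)"
    have "(\<integral>\<^sup>+x. f Q x \<partial>?L) = ennreal c * \<beta> Q * (\<integral>\<^sup>+x\<in>{y. 4
        * s Q \<le> norm (z Q - y)}. ennreal ((4 * s Q) powr d / norm (z Q - x) powr (real ?n + d)) * 1 \<partial>?L)"
      unfolding f_def by (rule nn_integral_cmult[OF fm0])
    also have "\<dots> \<le> ennreal c * \<beta> Q * ennreal (tail_const * unit_ball_vol ?n)"
      unfolding tail_const_def
    proof (intro mult_left_mono nn_integral_tail_le)
      show "(\<integral>\<^sup>+y\<in>ball (z Q) r. 1 \<partial>?L) \<le> ennreal (unit_ball_vol ?n
          * r ^ ?n)" if "0 < r" for r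
        using nn_integral_cmult_indicator[OF ball_in_sets_lebesgue, of 1 "z Q" r] emeasure_lebesgue_ball[of r "z Q"] that
        by simp
    qed (use s d in auto)
    also have "\<dots> = ennreal (c * (tail_const * unit_ball_vol ?n)) * \<beta> Q"
    proof -
      have "ennreal (c * (tail_const * unit_ball_vol ?n)) = ennreal c * ennreal (tail_const * unit_ball_vol ?n)"
        using c tail_const_pos by (intro ennreal_mult) auto
      then show ?thesis by (simp only: mult_ac)
    qed
    finally show "(\<integral>\<^sup>+x. f Q x \<partial>?L) \<le> \<dots>" .
  qed
  also have "\<dots> = ennreal (c * (tail_const * unit_ball_vol ?n))
      * (\<integral>\<^sup>+Q. \<beta> Q \<partial>count_space S)"
    by (rule nn_integral_cmult) simp
  also have "(\<integral>\<^sup>+Q. \<beta> Q \<partial>count_space S)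
      = (\<integral>\<^sup>+y\<in>(\<Union>Q\<in>S. Q). ennreal (cmod (b y)) \<partial>?L)"
    unfolding \<beta>_def
  proof (rule nn_integral_UN_disjoint[symmetric, OF S(1) _ _ S(2)])
    show "Q \<in> sets ?L" if "Q \<in> S" for Q using S(3)[OF that] sets_dyadic by metis
  qed (use b in simp)
  also have "\<dots> \<le> (\<integral>\<^sup>+y. ennreal (cmod (b y)) \<partial>?L)"
    by (intro nn_integral_mono) (auto simp: indicator_def)
  finally show ?thesis unfolding E_def by (simp add: mult_left_mono)
qed

definition HL_const :: real where
  "HL_const = unit_ball_vol DIM('a) * 5 ^ DIM('a)"

lemma HL_const_nonneg: "0 \<le> HL_const"
  by (simp add: HL_const_def)

lemma HL_weak_type:
  fixes h :: "'a \<Rightarrow> ennreal"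
  assumes "h \<in> borel_measurable lebesgue" "0 < t"
  shows "ennreal t * emeasure lebesgue (HL_set h t) \<le> ennreal HL_const
      * (\<integral>\<^sup>+x. h x \<partial>lebesgue)"
proof -
  have "ennreal t * emeasure lebesgue (HL_set h t)
      \<le> ennreal t * (ennreal (HL_const / t) * (\<integral>\<^sup>+x. h x \<partial>lebesgue))"
    using emeasure_HL_set_le[OF assms] by (intro mult_left_mono) (auto simp: HL_const_def)
  also have "\<dots> = ennreal (t * (HL_const / t)) * (\<integral>\<^sup>+x. h x \<partial>lebesgue)"
    using assms(2) HL_const_nonneg by (subst ennreal_mult) (auto simp: mult.assoc)
  finally show ?thesis using assms(2) by simp
qed

end

context cz_operator
begin

text \<open>By Cotlar's inequality the set lies in three Hardy-Littlewood sets. For the two at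
  height \<open>t^2\<close> the weak type bound carries a factor \<open>t^2\<close> on the left and,
  by the hypothesis on the square integral, one factor \<open>t\<close> on the right, which
  cancels.\<close>

lemma weak_type_2:
  assumes f: "integrable lebesgue f" and f2: "square_integrable f" and t: "0 < t"
    and ft: "(\<integral>\<^sup>+y. ennreal ((cmod (f y))\<^sup>2) \<partial>lebesgue) \<le> ennreal (k * t)
        * I" and k: "0 \<le> k"
    and fI: "(\<integral>\<^sup>+y. ennreal (cmod (f y)) \<partial>lebesgue) \<le> I"
  shows "ennreal t * emeasure lebesgue {x. ennreal (cotlar_const * t) < maximal_truncation K f x}
    \<le> ennreal (HL_const * (1 + (1 + B) * k)) * I"
proof -
  let ?L = "lebesgue :: 'a measure"
  let ?h1 = "\<lambda>y. ennreal (cmod (f y))" and ?h2 = "\<lambda>y. ennreal ((cmod (f y))\<^sup>2)" and ?h3 = "\<lambda>y. ennreal ((cmod (T f y))\<^sup>2)"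
  have m: "?h1 \<in> borel_measurable ?L" "?h2 \<in> borel_measurable ?L" "?h3 \<in> borel_measurable ?L"
    using f2 T_square_integrable[OF f2] by (auto simp: square_integrable_def)
  have s: "HL_set ?h1 t \<in> sets ?L" "HL_set ?h2 (t\<^sup>2) \<in> sets ?L" "HL_set ?h3 (t\<^sup>2) \<in> sets ?L"
    by (intro open_in_sets_lebesgue open_HL_set m)+
  have sub: "{x. ennreal (cotlar_const * t)
      < maximal_truncation K f x} \<subseteq> HL_set ?h1 t \<union> (HL_set ?h2 (t\<^sup>2) \<union> HL_set ?h3 (t\<^sup>2))"
  proof (rule subsetI, rule ccontr)
    fix x assume x: "x \<in> {x. ennreal (cotlar_const * t) < maximal_truncation K f x}"
      "x \<notin> HL_set ?h1 t \<union> (HL_set ?h2 (t\<^sup>2) \<union> HL_set ?h3 (t\<^sup>2))"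
    then have "maximal_truncation K f x \<le> ennreal (cotlar_const * t)"
      using t by (intro cotlar[OF f f2]) auto
    then show False using x by simp
  qed
  have sq: "ennreal t * emeasure ?L (HL_set h (t\<^sup>2)) \<le> ennreal (HL_const * \<kappa>) * I"
    if h: "h \<in> borel_measurable ?L" and hI: "(\<integral>\<^sup>+x. h x \<partial>?L)
        \<le> ennreal (\<kappa> * t) * I" and \<kappa>: "0 \<le> \<kappa>" for h \<kappa>
  proof -
    have "ennreal (t\<^sup>2) * emeasure ?L (HL_set h (t\<^sup>2)) \<le> ennreal HL_const
        * (\<integral>\<^sup>+x. h x \<partial>?L)"
      using t by (intro HL_weak_type[OF h]) simp
    also have "\<dots> \<le> ennreal HL_const * (ennreal (\<kappa> * t) * I)"
      by (intro mult_left_mono hI) simp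
    also have "\<dots> = ennreal t * (ennreal (HL_const * \<kappa>) * I)"
      using HL_const_nonneg \<kappa> t by (simp add: ennreal_mult mult_ac)
    also have "ennreal (t\<^sup>2) * emeasure ?L (HL_set h (t\<^sup>2)) = ennreal t * (ennreal t
        * emeasure ?L (HL_set h (t\<^sup>2)))"
      using t by (simp only: power2_eq_square ennreal_mult less_imp_le mult.assoc)
    finally show ?thesis
      using t by (simp add: ennreal_mult_le_mult_iff)
  qed
  have 3: "(\<integral>\<^sup>+x. ?h3 x \<partial>?L) \<le> ennreal (B * k * t) * I"
  proof -
    have "(\<integral>\<^sup>+x. ?h3 x \<partial>?L) \<le> ennreal B * (\<integral>\<^sup>+x. ?h2 x \<partial>?L)"
        by (rule T_bound[OF f2])
    also have "\<dots> \<le> ennreal B * (ennreal (k * t) * I)" by (intro mult_left_mono ft) simp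
    also have "\<dots> = ennreal (B * k * t) * I"
      using B k t by (simp add: ennreal_mult mult_ac)
    finally show ?thesis .
  qed
  have "ennreal t * emeasure ?L {x. ennreal (cotlar_const * t) < maximal_truncation K f x}
    \<le> ennreal t * (emeasure ?L (HL_set ?h1 t) + (emeasure ?L (HL_set ?h2 (t\<^sup>2))
        + emeasure ?L (HL_set ?h3 (t\<^sup>2))))"
  proof (intro mult_left_mono)
    have "emeasure ?L {x. ennreal (cotlar_const * t) < maximal_truncation K f x}
        \<le> emeasure ?L (HL_set ?h1 t \<union> (HL_set ?h2 (t\<^sup>2) \<union> HL_set ?h3 (t\<^sup>2)))"
      by (intro emeasure_mono sub sets.Un s)
    also have "\<dots> \<le> emeasure ?L (HL_set ?h1 t)
        + emeasure ?L (HL_set ?h2 (t\<^sup>2) \<union> HL_set ?h3 (t\<^sup>2))"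
      by (intro emeasure_subadditive sets.Un s)
    also have "\<dots> \<le> emeasure ?L (HL_set ?h1 t) + (emeasure ?L (HL_set ?h2 (t\<^sup>2))
        + emeasure ?L (HL_set ?h3 (t\<^sup>2)))"
      by (intro add_left_mono emeasure_subadditive s)
    finally show "emeasure ?L {x. ennreal (cotlar_const * t) < maximal_truncation K f x} \<le> \<dots>" .
  qed simp
  also have "\<dots> = ennreal t * emeasure ?L (HL_set ?h1 t) + (ennreal t
      * emeasure ?L (HL_set ?h2 (t\<^sup>2)) + ennreal t * emeasure ?L (HL_set ?h3 (t\<^sup>2)))"
    by (simp only: distrib_left)
  also have "\<dots> \<le> ennreal HL_const * I + (ennreal (HL_const * k) * I + ennreal (HL_const * (B * k)) * I)"
  proof (intro add_mono)
    show "ennreal t * emeasure ?L (HL_set ?h1 t) \<le> ennreal HL_const * I"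
      by (rule order_trans[OF HL_weak_type[OF m(1) t]]) (intro mult_left_mono fI, simp)
    show "ennreal t * emeasure ?L (HL_set ?h2 (t\<^sup>2)) \<le> ennreal (HL_const * k) * I"
      by (rule sq[OF m(2) ft k])
    show "ennreal t * emeasure ?L (HL_set ?h3 (t\<^sup>2)) \<le> ennreal (HL_const * (B * k)) * I"
      using B k 3 by (intro sq[OF m(3)]) auto
  qed
  also have "\<dots> = ennreal (HL_const + (HL_const * k + HL_const * (B * k))) * I"
    using HL_const_nonneg B k by (simp add: ennreal_plus distrib_right)
  also have "HL_const + (HL_const * k + HL_const * (B * k)) = HL_const * (1 + (1 + B) * k)"
    by (simp add: algebra_simps)
  finally show ?thesis .
qed

text \<open>The level splits into \<open>cotlar_const\<close> for the good part and the remainder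
  for the bad part, whose local averages are at most \<open>2 * 2 ^ DIM('a)\<close> times the height
  of the decomposition.\<close>

definition weak_level :: real where
  "weak_level = cotlar_const + mean_zero_const * (2 * 2 ^ DIM('a)) + 1"

text \<open>The summands belong to the good part, to the balls around the selected cubes, and to the
  bad part outside these balls.\<close>

definition weak_const :: real where
  "weak_const = HL_const * (1 + (1 + B) * 2 ^ DIM('a)) + unit_ball_vol DIM('a) * (4 * real DIM('a)) ^ DIM('a)
     + c * (tail_const * unit_ball_vol DIM('a)) * 2"

lemma weak_level_pos: "0 < weak_level"
  using cotlar_const_pos mean_zero_const_pos by (simp add: weak_level_def add_pos_pos)

lemma weak_const_nonneg: "0 \<le> weak_const"
  using HL_const_nonneg c tail_const_pos B by (simp add: weak_const_def)

lemma weak_type_continuous: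
  assumes f: "integrable lebesgue f" and cont: "continuous_on UNIV f" and t: "0 < t"
  shows "ennreal t * emeasure lebesgue {x. ennreal (weak_level * t) < maximal_truncation K f x}
    \<le> ennreal weak_const * (\<integral>\<^sup>+y. ennreal (cmod (f y)) \<partial>lebesgue)"
proof -
  let ?L = "lebesgue :: 'a measure" and ?n = "DIM('a)"
  define I where "I = (\<integral>\<^sup>+y. ennreal (cmod (f y)) \<partial>?L)"
  obtain S g where S: "countable S" "disjoint_family_on (\<lambda>Q. Q) S"
    "\<And>Q. Q \<in> S \<Longrightarrow> \<exists>j z. Q = dyadic j z"
    "ennreal t * emeasure lebesgue (\<Union>S) \<le> I"
    and g: "integrable ?L g" "\<And>x. cmod (g x) \<le> 2 ^ ?n * t"
    "(\<integral>\<^sup>+y. ennreal (cmod (g y)) \<partial>?L) \<le> I"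
    "\<And>x. x \<notin> \<Union>S \<Longrightarrow> g x = f x"
    "\<And>Q. Q \<in> S \<Longrightarrow> (LINT y:Q|?L. f y - g y) = 0"
    "\<And>Q. Q \<in> S \<Longrightarrow> (\<integral>\<^sup>+y\<in>Q. ennreal (cmod (f y - g y)) \<partial>?L)
        \<le> ennreal (2 * 2 ^ ?n * t) * emeasure ?L Q"
    unfolding I_def by (rule calderon_zygmund_decomposition[OF f cont t]) blast
  have "\<forall>Q\<in>S. \<exists>p. Q = dyadic (fst p) (snd p)" using S(3) by auto
  then obtain p where p: "\<forall>Q\<in>S. Q = dyadic (fst (p Q)) (snd (p Q))" by (rule bchoice[THEN exE])
  define l z where "l Q = fst (p Q)" and "z Q = snd (p Q)" for Q
  have lz: "Q = dyadic (l Q) (z Q)" if "Q \<in> S" for Q using p that by (simp add: l_def z_def)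
  have sS: "Q \<in> sets ?L" if "Q \<in> S" for Q using lz[OF that] sets_dyadic by metis
  define b where "b y = f y - g y" for y
  have b: "integrable ?L b" unfolding b_def using f g(1) by simp
  define U where "U = (\<Union>Q\<in>S. ball (z Q) (4 * real ?n * 2 powi l Q))"
  define E where "E = {x. ennreal (mean_zero_const * (2 * 2 ^ ?n * t) + t) < maximal_truncation K b x} - U"
  define A where "A = {x. ennreal (cotlar_const * t) < maximal_truncation K g x}"
  have "open U" unfolding U_def by auto
  then have sets: "A \<in> sets ?L" "U \<in> sets ?L" "E \<in> sets ?L"
    unfolding A_def E_def
    by (intro sets.Diff open_in_sets_lebesgue open_maximal_truncation integrable_imp_loc_integrable b g(1); assumption)+
  have sub: "{x. ennreal (weak_level * t) < maximal_truncation K f x} \<subseteq> A \<union> (U \<union> E)"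
  proof (rule subsetI, rule ccontr)
    fix x assume x: "x \<in> {x. ennreal (weak_level * t)
        < maximal_truncation K f x}" "x \<notin> A \<union> (U \<union> E)"
    have "f = (\<lambda>y. g y + b y)" by (simp add: b_def)
    then have "maximal_truncation K f x \<le> maximal_truncation K g x + maximal_truncation K b x"
      using maximal_truncation_add_le[OF integrable_imp_loc_integrable[OF g(1)] integrable_imp_loc_integrable[OF b]] by simp
    also have "\<dots> \<le> ennreal (cotlar_const * t) + ennreal (mean_zero_const * (2 * 2 ^ ?n * t) + t)"
      using x(2) by (intro add_mono) (auto simp: A_def E_def not_less)
    also have "\<dots> = ennreal (weak_level * t)"
      using t cotlar_const_pos mean_zero_const_pos
      by (subst ennreal_plus[symmetric]) (auto simp: weak_level_def algebra_simps)
    finally show False using x(1) by simp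
  qed
  have 1: "ennreal t * emeasure ?L A \<le> ennreal (HL_const * (1 + (1 + B) * 2 ^ ?n)) * I"
  proof -
    \<comment> \<open>The uniform bound \<open>2 ^ ?n * t\<close> on \<open>g\<close> turns its
      integral bound into the square integral bound of \<open>weak_type_2\<close> with
      \<open>k = 2 ^ ?n\<close>.\<close>
    have "(\<integral>\<^sup>+y. ennreal ((cmod (g y))\<^sup>2) \<partial>?L)
        \<le> (\<integral>\<^sup>+y. ennreal (2 ^ ?n * t) * ennreal (cmod (g y)) \<partial>?L)"
    proof (rule nn_integral_mono)
      fix y
      have "(cmod (g y))\<^sup>2 \<le> 2 ^ ?n * t * cmod (g y)"
        unfolding power2_eq_square by (intro mult_right_mono g(2)) simp
      then have "ennreal ((cmod (g y))\<^sup>2) \<le> ennreal (2 ^ ?n * t * cmod (g y))" by (rule ennreal_leI)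
      then show "ennreal ((cmod (g y))\<^sup>2) \<le> ennreal (2 ^ ?n * t) * ennreal (cmod (g y))"
        using t by (simp add: ennreal_mult)
    qed
    also have "\<dots> = ennreal (2 ^ ?n * t) * (\<integral>\<^sup>+y. ennreal (cmod (g y)) \<partial>?L)"
      using g(1) by (intro nn_integral_cmult) simp
    also have "\<dots> \<le> ennreal (2 ^ ?n * t) * I" by (intro mult_left_mono g(3)) simp
    finally have g2: "(\<integral>\<^sup>+y. ennreal ((cmod (g y))\<^sup>2) \<partial>?L) \<le> ennreal (2 ^ ?n
        * t) * I" .
    have "I < \<infinity>" using f by (simp add: I_def integrable_iff_bounded)
    then have "ennreal (2 ^ ?n * t) * I < \<infinity>" by (simp add: ennreal_mult_less_top)
    then have "square_integrable g" using g(1) le_less_trans[OF g2] by (simp add: square_integrable_def)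
    then show ?thesis unfolding A_def by (intro weak_type_2[OF g(1) _ t g2 _ g(3)]) auto
  qed
  have 2: "ennreal t * emeasure ?L U \<le> ennreal (unit_ball_vol ?n * (4 * real ?n) ^ ?n) * I"
  proof -
    let ?k = "ennreal (unit_ball_vol ?n * (4 * real ?n) ^ ?n)"
    have "emeasure ?L U \<le> (\<integral>\<^sup>+Q. emeasure ?L (ball (z Q) (4 * real ?n
        * 2 powi l Q)) \<partial>count_space S)"
      unfolding U_def using S(1) by (intro emeasure_UN_le) auto
    also have "\<dots> = (\<integral>\<^sup>+Q. ?k * emeasure ?L Q \<partial>count_space S)"
    proof (rule nn_integral_cong)
      fix Q assume "Q \<in> space (count_space S)"
      then have "emeasure ?L Q = ennreal ((2 powi l Q) ^ ?n)"
        using lz[of Q] emeasure_dyadic[of "l Q" "z Q"] by simp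
      then show "emeasure ?L (ball (z Q) (4 * real ?n * 2 powi l Q)) = ?k * emeasure ?L Q"
        by (subst emeasure_lebesgue_ball) (auto simp: power_mult_distrib mult_ac simp flip: ennreal_mult)
    qed
    also have "\<dots> = ?k * (\<integral>\<^sup>+Q. emeasure ?L Q \<partial>count_space S)"
        by (rule nn_integral_cmult) simp
    also have "(\<integral>\<^sup>+Q. emeasure ?L Q \<partial>count_space S) = emeasure ?L (\<Union>S)"
      using emeasure_UN_countable[OF sS S(1,2)] by simp
    finally have "ennreal t * emeasure ?L U \<le> ennreal t * (?k * emeasure ?L (\<Union>S))"
      by (rule mult_left_mono) simp
    also have "\<dots> = ?k * (ennreal t * emeasure ?L (\<Union>S))" by (rule mult.left_commute)
    also have "\<dots> \<le> ?k * I" by (intro mult_left_mono S(4)) simp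
    finally show ?thesis .
  qed
  have 3: "ennreal t * emeasure ?L E \<le> ennreal (c * (tail_const * unit_ball_vol ?n) * 2) * I"
  proof -
    have "ennreal t * emeasure ?L E \<le> ennreal (c * (tail_const * unit_ball_vol ?n))
        * (\<integral>\<^sup>+y. ennreal (cmod (b y)) \<partial>?L)"
      unfolding E_def U_def
    proof (rule mean_zero_weak_type[OF S(1,2) lz b])
      show "b x = 0" if "x \<notin> \<Union>S" for x using g(4)[OF that] by (simp add: b_def)
      show "(LINT y:Q|?L. b y) = 0" if "Q \<in> S" for Q using g(5)[OF that] by (simp add: b_def)
      show "(\<integral>\<^sup>+y\<in>Q. ennreal (cmod (b y)) \<partial>?L) \<le> ennreal (2 * 2 ^ ?n * t)
          * emeasure ?L Q" if "Q \<in> S" for Q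
        using g(6)[OF that] unfolding b_def .
    qed (use t in auto)
    also have "(\<integral>\<^sup>+y. ennreal (cmod (b y)) \<partial>?L)
        \<le> (\<integral>\<^sup>+y. ennreal (cmod (f y)) + ennreal (cmod (g y)) \<partial>?L)"
      by (intro nn_integral_mono) (auto simp: b_def norm_triangle_ineq4 simp flip: ennreal_plus)
    also have "\<dots> = I + (\<integral>\<^sup>+y. ennreal (cmod (g y)) \<partial>?L)"
      unfolding I_def using f g(1) by (intro nn_integral_add) auto
    also have "\<dots> \<le> I + I" by (intro add_left_mono g(3))
    finally have "ennreal t * emeasure ?L E \<le> ennreal (c * (tail_const * unit_ball_vol ?n)) * (I + I)"
      by (simp add: mult_left_mono)
    also have "\<dots> = ennreal (c * (tail_const * unit_ball_vol ?n) * 2) * I"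
      using c tail_const_pos by (subst ennreal_mult) (auto simp: mult.assoc mult_2)
    finally show ?thesis .
  qed
  have "ennreal t * emeasure ?L {x. ennreal (weak_level * t) < maximal_truncation K f x}
     \<le> ennreal t * (emeasure ?L A + (emeasure ?L U + emeasure ?L E))"
  proof (intro mult_left_mono)
    have "emeasure ?L {x. ennreal (weak_level * t) < maximal_truncation K f x}
        \<le> emeasure ?L (A \<union> (U \<union> E))"
      by (intro emeasure_mono sub sets.Un sets)
    also have "\<dots> \<le> emeasure ?L A + emeasure ?L (U \<union> E)" by (intro emeasure_subadditive sets.Un sets)
    also have "\<dots> \<le> emeasure ?L A + (emeasure ?L U + emeasure ?L E)"
      by (intro add_left_mono emeasure_subadditive sets)
    finally show "emeasure ?L {x. ennreal (weak_level * t) < maximal_truncation K f x} \<le> \<dots>" .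
  qed simp
  also have "\<dots> = ennreal t * emeasure ?L A + (ennreal t * emeasure ?L U + ennreal t * emeasure ?L E)"
    by (simp only: distrib_left)
  also have "\<dots> \<le> ennreal (HL_const * (1 + (1 + B) * 2 ^ ?n)) * I + (ennreal (unit_ball_vol ?n * (4
      * real ?n) ^ ?n) * I
      + ennreal (c * (tail_const * unit_ball_vol ?n) * 2) * I)"
    by (intro add_mono 1 2 3)
  also have "\<dots> = ennreal weak_const * I"
    using HL_const_nonneg B c tail_const_pos
    by (simp add: weak_const_def ennreal_plus distrib_right add.assoc)
  finally show ?thesis unfolding I_def .
qed

end

section \<open>Density of continuous functions and the weak type bound for all integrable
  functions\<close>

lemma integrable_approx_continuous:
  fixes f :: "'a::euclidean_space \<Rightarrow> complex"
  assumes "integrable lebesgue f" "0 < e"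
  shows "\<exists>g. integrable lebesgue g \<and> continuous_on UNIV g \<and> (\<integral>\<^sup>+x. ennreal (cmod (f x - g x)) \<partial>lebesgue) \<le> ennreal e"
  using assms
proof (induction f arbitrary: e rule: integrable_induct)
  case (base A z)
  let ?L = "lebesgue :: 'a measure"
  \<comment> \<open>The summand 1 keeps the denominator positive when \<open>z = 0\<close>.\<close>
  define e' where "e' = e / (2 * (cmod z + 1))"
  have e': "0 < e'" using base.prems by (simp add: e'_def add_nonneg_pos)
  \<comment> \<open>\<open>A\<close> is enclosed between a closed and an open set of nearly the same
    measure; a Urysohn function between them differs from the indicator of \<open>A\<close> only on
    the two small differences.\<close>
  obtain T where T: "open T" "A \<subseteq> T" "T - A \<in> lmeasurable" "emeasure ?L (T - A) < ennreal e'"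
    using sets_lebesgue_outer_open[OF base.hyps(1) e'] by metis
  obtain C where C: "closed C" "C \<subseteq> A" "A - C \<in> lmeasurable" "emeasure ?L (A - C) < ennreal e'"
    using sets_lebesgue_inner_closed[OF base.hyps(1) e'] by metis
  have CT: "closed C" "closed (-T)" "C \<inter> -T = {}" using C(1,2) T(1,2) by auto
  obtain \<phi> :: "'a \<Rightarrow> real" where \<phi>: "continuous_on UNIV \<phi>" "\<And>x. \<phi> x \<in> closed_segment 1 0"
      "\<And>x. x \<in> C \<Longrightarrow> \<phi> x = 1" "\<And>x. x \<in> -T \<Longrightarrow> \<phi> x = 0"
    by (rule Urysohn[OF CT, of "1::real" 0]) (rule that)
  have \<phi>01: "0 \<le> \<phi> x" "\<phi> x \<le> 1" for x using \<phi>(2)[of x]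
      by (auto simp: closed_segment_eq_real_ivl)
  have Ts: "T \<in> sets ?L" "A \<in> sets ?L" "C \<in> sets ?L" using T(1) base.hyps C(1) by auto
  define g where "g x = \<phi> x *\<^sub>R z" for x
  have gc: "continuous_on UNIV g" unfolding g_def by (intro continuous_intros \<phi>)
  then have gm: "g \<in> borel_measurable ?L" by (intro measurable_completion) (simp add: borel_measurable_continuous_onI)
  have "emeasure ?L T \<le> emeasure ?L (A \<union> (T - A))" using Ts by (intro emeasure_mono) auto
  also have "\<dots> \<le> emeasure ?L A + emeasure ?L (T - A)" using Ts by (intro emeasure_subadditive) auto
  also have "\<dots> < \<infinity>" using base.hyps(2) T(4) by (simp del: emeasure_completion add: less_top[symmetric]) (metis ennreal_less_top less_trans top.not_eq_extremum)
  finally have Tfin: "emeasure ?L T < \<infinity>" .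
  have gi: "integrable ?L g"
  proof (rule Bochner_Integration.integrable_bound)
    show "integrable ?L (\<lambda>x. indicator T x *\<^sub>R z)"
      using Ts Tfin by (intro integrable_scaleR_left integrable_real_indicator)
    show "AE x in ?L. norm (g x) \<le> norm (indicator T x *\<^sub>R z)"
      using \<phi>01 \<phi>(4) by (intro AE_I2) (auto simp: g_def indicator_def intro: mult_left_le_one_le)
  qed (rule gm)
  have "(\<integral>\<^sup>+x. ennreal (cmod (indicator A x *\<^sub>R z - g x)) \<partial>?L)
      \<le> (\<integral>\<^sup>+x. ennreal (cmod z) * indicator ((T - A) \<union> (A - C)) x \<partial>?L)"
  proof (rule nn_integral_mono)
    fix x
    have "indicator A x *\<^sub>R z - g x = (indicator A x - \<phi> x) *\<^sub>R z"
        by (simp add: g_def scaleR_left_diff_distrib)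
    then have eq: "cmod (indicator A x *\<^sub>R z - g x) = \<bar>indicator A x - \<phi> x\<bar> * cmod z" by simp
    have "\<bar>indicator A x - \<phi> x\<bar> \<le> (indicator ((T - A) \<union> (A - C)) x :: real)"
      using \<phi>01[of x] \<phi>(3,4)[of x] T(2) C(2) by (auto simp: indicator_def)
    then have "\<bar>indicator A x - \<phi> x\<bar> * cmod z \<le> indicator ((T - A) \<union> (A - C)) x * cmod z"
        by (rule mult_right_mono) simp
    then show "ennreal (cmod (indicator A x *\<^sub>R z - g x)) \<le> ennreal (cmod z)
        * indicator ((T - A) \<union> (A - C)) x"
      unfolding eq using \<phi>(3,4)[of x] C(2) T(2)
      by (cases "x \<in> (T - A) \<union> (A - C)") (auto intro!: ennreal_leI simp: indicator_def split: if_splits)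
  qed
  also have "\<dots> = ennreal (cmod z) * emeasure ?L ((T - A) \<union> (A - C))"
    using Ts by (intro nn_integral_cmult_indicator) auto
  also have "\<dots> \<le> ennreal (cmod z) * (emeasure ?L (T - A) + emeasure ?L (A - C))"
    using Ts by (intro mult_left_mono emeasure_subadditive) auto
  also have "\<dots> \<le> ennreal (cmod z) * (ennreal e' + ennreal e')"
    using T(4) C(4) by (intro mult_left_mono add_mono) (auto intro: less_imp_le)
  also have "\<dots> = ennreal (cmod z * (e' + e'))"
    using e' by (subst ennreal_plus[symmetric]) (auto intro: ennreal_mult[symmetric])
  also have "\<dots> \<le> ennreal e"
  proof (rule ennreal_leI)
    have "cmod z * (e' + e') \<le> (cmod z + 1) * (2 * e')" using e' by (intro mult_mono) auto
    also have "\<dots> = e"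
    proof -
      have "cmod z + 1 \<noteq> 0" using norm_ge_zero[of z] by linarith
      then show ?thesis unfolding e'_def by (simp add: field_simps)
    qed
    finally show "cmod z * (e' + e') \<le> e" .
  qed
  finally show ?case using gi gc by auto
next
  case (add f g)
  have "0 < e / 2" using add.prems by simp
  obtain f' where f': "integrable lebesgue f'" "continuous_on UNIV f'" "(\<integral>\<^sup>+x. ennreal (cmod (f x - f' x)) \<partial>lebesgue) \<le> ennreal (e / 2)"
    using add.IH(1)[OF \<open>0 < e / 2\<close>] by blast
  obtain g' where g': "integrable lebesgue g'" "continuous_on UNIV g'" "(\<integral>\<^sup>+x. ennreal (cmod (g x - g' x)) \<partial>lebesgue) \<le> ennreal (e / 2)"
    using add.IH(2)[OF \<open>0 < e / 2\<close>] by blast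
  have "(\<integral>\<^sup>+x. ennreal (cmod (f x + g x - (f' x + g' x))) \<partial>lebesgue)
      \<le> (\<integral>\<^sup>+x. ennreal (cmod (f x - f' x)) + ennreal (cmod (g x - g' x)) \<partial>lebesgue)"
    by (intro nn_integral_mono) (simp add: norm_diff_triangle_ineq flip: ennreal_plus)
  also have "\<dots> = (\<integral>\<^sup>+x. ennreal (cmod (f x - f' x)) \<partial>lebesgue)
      + (\<integral>\<^sup>+x. ennreal (cmod (g x - g' x)) \<partial>lebesgue)"
    using add.hyps f'(1) g'(1) by (intro nn_integral_add) auto
  also have "\<dots> \<le> ennreal (e / 2) + ennreal (e / 2)" by (intro add_mono f' g')
  also have "\<dots> = ennreal e" using add.prems by (subst ennreal_plus[symmetric]) auto
  finally show ?case
    using f' g' by (intro exI[of _ "\<lambda>x. f' x + g' x"]) (auto intro: continuous_intros)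
next
  case (lim f s)
  let ?L = "lebesgue :: 'a measure"
  have "0 < e / 2" using lim.prems by simp
  have "(\<lambda>i. \<integral>\<^sup>+x. norm (f x - s i x) \<partial>?L) \<longlonglongrightarrow> 0"
  proof (rule nn_integral_dominated_convergence_norm[where w = "\<lambda>x. 2 * norm (f x)"])
    show "\<And>i. s i \<in> borel_measurable ?L" "f \<in> borel_measurable ?L" using lim.hyps by auto
    have "(\<integral>\<^sup>+x. ennreal (norm (f x)) \<partial>?L) < \<infinity>" using lim.hyps
        by (simp add: integrable_iff_bounded)
    then show "(\<integral>\<^sup>+x. ennreal (2 * norm (f x)) \<partial>?L) < \<infinity>"
      using lim.hyps by (simp add: ennreal_mult nn_integral_cmult ennreal_mult_less_top)
  qed (use lim.hyps in auto)
  then have "\<forall>\<^sub>F i in sequentially. (\<integral>\<^sup>+x. norm (f x - s i x) \<partial>?L)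
      < ennreal (e / 2)"
    using \<open>0 < e / 2\<close> by (intro order_tendstoD) auto
  then obtain i where i: "(\<integral>\<^sup>+x. norm (f x - s i x) \<partial>?L) < ennreal (e / 2)"
    by (auto simp: eventually_sequentially)
  obtain g where g: "integrable ?L g" "continuous_on UNIV g" "(\<integral>\<^sup>+x. ennreal (cmod (s i x - g x)) \<partial>?L) \<le> ennreal (e / 2)"
    using lim.IH[OF \<open>0 < e / 2\<close>, of i] by blast
  have "(\<integral>\<^sup>+x. ennreal (cmod (f x - g x)) \<partial>?L)
      \<le> (\<integral>\<^sup>+x. ennreal (norm (f x - s i x)) + ennreal (cmod (s i x - g x)) \<partial>?L)"
  proof (rule nn_integral_mono)
    fix x
    have "cmod (f x - g x) \<le> norm (f x - s i x) + cmod (s i x - g x)"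
      using norm_triangle_ineq[of "f x - s i x" "s i x - g x"] by (simp add: norm_minus_commute)
    then show "ennreal (cmod (f x - g x)) \<le> ennreal (norm (f x - s i x)) + ennreal (cmod (s i x - g x))"
      by (simp flip: ennreal_plus)
  qed
  also have "\<dots> = (\<integral>\<^sup>+x. ennreal (norm (f x - s i x)) \<partial>?L)
      + (\<integral>\<^sup>+x. ennreal (cmod (s i x - g x)) \<partial>?L)"
    using lim.hyps g(1) by (intro nn_integral_add) auto
  also have "\<dots> \<le> ennreal (e / 2) + ennreal (e / 2)" using i g(3) by (intro add_mono) auto
  also have "\<dots> = ennreal e" using lim.prems by (subst ennreal_plus[symmetric]) auto
  finally show ?case using g by auto
qed

context cz_operator
begin

text \<open>At a fixed point and fixed radii, a truncation depends continuously on \<open>f\<close>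
  in the integral norm, since the kernel is at most \<open>c / e ^ DIM('a)\<close> there. Hence a
  point of the superlevel set lies in the sets \<open>V k\<close> of all sufficiently close
  approximants, though how close depends on the point.\<close>

lemma weak_type:
  assumes f: "integrable lebesgue f" and t: "0 < t"
  shows "ennreal t * emeasure lebesgue {x. ennreal (weak_level * t) < maximal_truncation K f x}
    \<le> ennreal weak_const * (\<integral>\<^sup>+y. ennreal (cmod (f y)) \<partial>lebesgue)"
proof -
  let ?L = "lebesgue :: 'a measure"
  have "\<forall>k::nat. \<exists>g. integrable ?L g \<and> continuous_on UNIV g \<and> (\<integral>\<^sup>+x. ennreal (cmod (f x - g x)) \<partial>?L) \<le> ennreal (1 / real (Suc k))"
    by (intro allI integrable_approx_continuous f) simp
  then obtain g where g: "\<And>k. integrable ?L (g k)" "\<And>k. continuous_on UNIV (g k)"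
      "\<And>k. (\<integral>\<^sup>+x. ennreal (cmod (f x - g k x)) \<partial>?L) \<le> ennreal (1 / real (Suc k))"
    by metis
  define V where "V k = {x. ennreal (weak_level * t) < maximal_truncation K (g k) x}" for k
  \<comment> \<open>The union of the increasing sets \<open>U m\<close> is the lower limit of the
    \<open>V k\<close>; continuity from below reduces the estimate to a single \<open>U m\<close>,
    which lies in every \<open>V k\<close> with \<open>k \<ge> m\<close>.\<close>
  define U where "U m = (\<Inter>k\<in>{m..}. V k)" for m
  have Vs: "V k \<in> sets ?L" for k
    unfolding V_def by (intro open_in_sets_lebesgue open_maximal_truncation integrable_imp_loc_integrable g)
  have Us: "U m \<in> sets ?L" for m unfolding U_def using Vs by (intro sets.countable_INT') auto
  have "{x. ennreal (weak_level * t) < maximal_truncation K f x} \<subseteq> (\<Union>m. U m)"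
  proof
    fix x assume "x \<in> {x. ennreal (weak_level * t) < maximal_truncation K f x}"
    then have "\<not> maximal_truncation K f x \<le> ennreal (weak_level * t)" by (simp add: not_le)
    then obtain e v where ev: "0 < e" "e < v" "\<not> ennreal (cmod (truncation K f e v x))
        \<le> ennreal (weak_level * t)"
      unfolding maximal_truncation_le_iff by blast
    define \<delta> where "\<delta> = cmod (truncation K f e v x) - weak_level * t"
    have \<delta>: "0 < \<delta>" using ev(3) weak_level_pos t by (simp add: \<delta>_def ennreal_le_iff2 not_le)
    define q where "q = c / e ^ DIM('a)"
    have q: "0 < q" using c ev by (simp add: q_def)
    obtain m :: nat where m: "q / \<delta> < real (Suc m)" using reals_Archimedean2 less_Suc_eq
        by (metis less_trans of_nat_less_iff lessI)
    have "x \<in> V k" if "m \<le> k" for k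
    proof -
      have fg: "integrable ?L (\<lambda>y. f y - g k y)" using f g(1) by simp
      have "truncation K f e v x = truncation K (g k) e v x + truncation K (\<lambda>y. f y - g k y) e v x"
        using truncation_add[OF integrable_imp_loc_integrable[OF g(1)] integrable_imp_loc_integrable[OF fg] ev(1), of k v x]
        by simp
      moreover have "cmod (truncation K (\<lambda>y. f y - g k y) e v x) < \<delta>"
      proof -
        have "ennreal (cmod (truncation K (\<lambda>y. f y - g k y) e v x)) \<le> ennreal q
            * (\<integral>\<^sup>+y. ennreal (cmod (f y - g k y)) \<partial>?L)"
          unfolding q_def using fg by (intro truncation_le ev) simp
        also have "\<dots> \<le> ennreal q * ennreal (1 / real (Suc k))" by (intro mult_left_mono g) simp
        also have "\<dots> = ennreal (q / real (Suc k))" using q by (simp add: ennreal_mult[symmetric])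
        finally have "cmod (truncation K (\<lambda>y. f y - g k y) e v x) \<le> q / real (Suc k)" using q
            by (simp add: ennreal_le_iff)
        also have "\<dots> < \<delta>"
        proof -
          have "q / \<delta> < real (Suc k)" using m that by linarith
          then show ?thesis using \<delta> by (simp add: field_simps)
        qed
        finally show ?thesis .
      qed
      ultimately have "weak_level * t < cmod (truncation K (g k) e v x)"
        using norm_triangle_ineq[of "truncation K (g k) e v x" "truncation K (\<lambda>y. f y - g k y) e v x"]
        by (simp add: \<delta>_def)
      then have "ennreal (weak_level * t) < ennreal (cmod (truncation K (g k) e v x))"
        using weak_level_pos t by (simp add: ennreal_less_iff)
      also have "\<dots> \<le> maximal_truncation K (g k) x" by (rule truncation_le_maximal_truncation[OF ev(1,2)])
      finally show ?thesis by (simp add: V_def)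
    qed
    then show "x \<in> (\<Union>m. U m)" by (auto simp: U_def)
  qed
  then have "emeasure ?L {x. ennreal (weak_level * t) < maximal_truncation K f x} \<le> emeasure ?L (\<Union>m. U m)"
    using Us by (intro emeasure_mono) auto
  also have "\<dots> = (SUP m. emeasure ?L (U m))"
  proof (rule SUP_emeasure_incseq[symmetric])
    show "incseq U" by (intro incseq_SucI) (auto simp: U_def)
  qed (use Us in auto)
  finally have "ennreal t * emeasure ?L {x. ennreal (weak_level * t) < maximal_truncation K f x}
      \<le> ennreal t * (SUP m. emeasure ?L (U m))"
    by (rule mult_left_mono) simp
  also have "\<dots> = (SUP m. ennreal t * emeasure ?L (U m))" by (rule SUP_mult_left_ennreal)
  also have "\<dots> \<le> ennreal weak_const * (\<integral>\<^sup>+y. ennreal (cmod (f y)) \<partial>?L)"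
  proof (rule SUP_least, rule ennreal_le_epsilon)
    fix m :: nat and e :: real assume e: "0 < e"
    obtain k0 :: nat where k0: "weak_const / e < real k0" using reals_Archimedean2 by blast
    define k where "k = max k0 m"
    have "weak_const / e < real (Suc k)" using k0 by (simp add: k_def)
    then have k: "weak_const * (1 / real (Suc k)) \<le> e" using e by (simp add: field_simps)
    have "ennreal t * emeasure ?L (U m) \<le> ennreal t * emeasure ?L (V k)"
      using Vs by (intro mult_left_mono emeasure_mono) (auto simp: U_def k_def)
    also have "\<dots> \<le> ennreal weak_const * (\<integral>\<^sup>+y. ennreal (cmod (g k y)) \<partial>?L)"
      unfolding V_def by (rule weak_type_continuous[OF g(1,2) t])
    also have "\<dots> \<le> ennreal weak_const * (\<integral>\<^sup>+y. ennreal (cmod (f y))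
        + ennreal (cmod (f y - g k y)) \<partial>?L)"
    proof (intro mult_left_mono nn_integral_mono)
      fix y
      have "cmod (g k y) \<le> cmod (f y) + cmod (f y - g k y)"
        using norm_triangle_ineq4[of "f y" "f y - g k y"] by simp
      then show "ennreal (cmod (g k y)) \<le> ennreal (cmod (f y)) + ennreal (cmod (f y - g k y))"
        by (simp flip: ennreal_plus)
    qed simp
    also have "(\<integral>\<^sup>+y. ennreal (cmod (f y)) + ennreal (cmod (f y - g k y)) \<partial>?L)
        = (\<integral>\<^sup>+y. ennreal (cmod (f y)) \<partial>?L)
            + (\<integral>\<^sup>+y. ennreal (cmod (f y - g k y)) \<partial>?L)"
      using f g(1)[of k] by (intro nn_integral_add) auto
    also have "ennreal weak_const * \<dots> = ennreal weak_const
        * (\<integral>\<^sup>+y. ennreal (cmod (f y)) \<partial>?L) + ennreal weak_const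
            * (\<integral>\<^sup>+y. ennreal (cmod (f y - g k y)) \<partial>?L)"
      by (rule distrib_left)
    also have "\<dots> \<le> ennreal weak_const * (\<integral>\<^sup>+y. ennreal (cmod (f y)) \<partial>?L)
        + ennreal e"
    proof (rule add_left_mono)
      have "ennreal weak_const * (\<integral>\<^sup>+y. ennreal (cmod (f y - g k y)) \<partial>?L)
          \<le> ennreal weak_const * ennreal (1 / real (Suc k))"
        by (intro mult_left_mono g) simp
      also have "\<dots> = ennreal (weak_const * (1 / real (Suc k)))" using weak_const_nonneg
          by (intro ennreal_mult[symmetric]) auto
      also have "\<dots> \<le> ennreal e" by (rule ennreal_leI[OF k])
      finally show "ennreal weak_const * (\<integral>\<^sup>+y. ennreal (cmod (f y - g k y)) \<partial>?L)
          \<le> ennreal e" .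
    qed
    finally show "ennreal t * emeasure ?L (U m) \<le> ennreal weak_const
        * (\<integral>\<^sup>+y. ennreal (cmod (f y)) \<partial>?L) + ennreal e" .
  qed
  finally show ?thesis .
qed

end

section \<open>Stopping cubes\<close>

lemma dyadic_subset_imp_le:
  assumes "dyadic i (y::'a::euclidean_space) \<subseteq> dyadic j x"
  shows "i \<le> j"
proof (rule ccontr)
  assume "\<not> i \<le> j"
  have "emeasure lebesgue (dyadic i y) \<le> emeasure lebesgue (dyadic j x)"
    using assms by (intro emeasure_mono sets_dyadic)
  then have "((2::real) powi i) ^ DIM('a) \<le> (2 powi j) ^ DIM('a)"
    unfolding emeasure_dyadic by (subst (asm) ennreal_le_iff) auto
  moreover have "(2::real) powi j < 2 powi i"
    using \<open>\<not> i \<le> j\<close> by (intro power_int_strict_increasing) auto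
  then have "((2::real) powi j) ^ DIM('a) < (2 powi i) ^ DIM('a)"
    by (intro power_strict_mono) (auto intro: less_imp_le)
  ultimately show False by linarith
qed

context cz_operator
begin

text \<open>At height \<open>stop_factor * t\<close> the weak type bounds leave an exceptional set
  of at most \<open>2 ^ -(DIM('a) + 2)\<close> of the cube. This is half of the density at which
  cubes are selected, so the selected cubes fill at most half of it. The summand 1 ensures
  positivity.\<close>

definition stop_factor :: real where
  "stop_factor = (weak_const + HL_const + 1) * 2 ^ (DIM('a) + 2)"

text \<open>\<open>weak_level\<close> bounds the maximal truncation at a good point, and
  \<open>away_const\<close> is the cost of carrying this bound to another point of the same
  cube.\<close>

definition stop_const :: real where
  "stop_const = (weak_level + away_const) * stop_factor"

lemma stop_factor_pos: "0 < stop_factor"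
  using weak_const_nonneg HL_const_nonneg by (simp add: stop_factor_def)

lemma stop_const_pos: "0 < stop_const"
  using stop_factor_pos weak_level_pos away_const_pos by (simp add: stop_const_def)

text \<open>
  The exceptional set is open, so it is covered by the selected cubes without a density theorem; the
  parent of a selected cube was rejected, so the cube contains a point outside the exceptional set.
\<close>

lemma stopping_cubes:
  fixes f :: "'a \<Rightarrow> complex"
  assumes f: "loc_integrable f" and t: "0 < t"
    and tQ: "(\<integral>\<^sup>+y\<in>dyadic_triple j x. ennreal (cmod (f y)) \<partial>lebesgue) = ennreal t
        * emeasure lebesgue (dyadic j x)"
  defines "h \<equiv> \<lambda>y. f y * indicator (dyadic_triple j x) y"
  obtains S where "countable S" "disjoint_family_on (\<lambda>Q. Q) S"
    "\<And>P. P \<in> S \<Longrightarrow> \<exists>i y. P = dyadic i y" "\<And>P. P \<in> S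
        \<Longrightarrow> P \<subseteq> dyadic j x"
    "2 * emeasure lebesgue (\<Union>S) \<le> emeasure lebesgue (dyadic j x)"
    "\<And>y. y \<in> dyadic j x \<Longrightarrow> y \<notin> \<Union>S
        \<Longrightarrow> maximal_truncation K h y \<le> ennreal (stop_const * t)"
    "\<And>i z y. dyadic i z \<in> S \<Longrightarrow> y \<in> dyadic i z
        \<Longrightarrow> maximal_truncation K h y \<le>
        ennreal (stop_const * t) + maximal_truncation K (\<lambda>y. f y * indicator (dyadic_triple i z) y) y"
proof -
  let ?L = "lebesgue :: 'a measure" and ?n = "DIM('a)"
  let ?Q = "dyadic j x"
  define \<tau> where "\<tau> = stop_factor * t"
  have \<tau>: "0 < \<tau>" using t stop_factor_pos by (simp add: \<tau>_def)
  have bdd: "bounded (dyadic_triple i z)" for i and z :: 'a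
    by (simp add: dyadic_triple_def cube_def)
  have h: "integrable ?L h" unfolding h_def by (rule loc_integrable_set[OF f sets_dyadic_triple bdd])
  have hl: "loc_integrable h" by (rule integrable_imp_loc_integrable[OF h])
  have hm: "(\<lambda>y. ennreal (cmod (h y))) \<in> borel_measurable ?L" using h by simp
  have hI: "(\<integral>\<^sup>+y. ennreal (cmod (h y)) \<partial>?L) = ennreal t * emeasure ?L ?Q"
    unfolding tQ[symmetric] h_def by (intro nn_integral_cong) (auto simp: indicator_def)
  define E where "E = {y. ennreal (weak_level * \<tau>)
      < maximal_truncation K h y} \<union> HL_set (\<lambda>y. ennreal (cmod (h y))) \<tau>"
  have oE: "open E" unfolding E_def by (intro open_Un open_maximal_truncation hl open_HL_set hm)
  have sE: "E \<in> sets ?L" by (rule open_in_sets_lebesgue[OF oE])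
  define q :: real where "q = (2 powi j) ^ ?n"
  have q: "0 < q" "emeasure ?L ?Q = ennreal q" by (auto simp: q_def emeasure_dyadic)
  have mE: "ennreal (2 ^ (?n + 2)) * emeasure ?L E \<le> ennreal q"
  proof -
    have "ennreal \<tau> * emeasure ?L E \<le> ennreal \<tau> * (emeasure ?L {y. ennreal (weak_level * \<tau>)
        < maximal_truncation K h y}
        + emeasure ?L (HL_set (\<lambda>y. ennreal (cmod (h y))) \<tau>))"
      unfolding E_def
      by (intro mult_left_mono emeasure_subadditive open_in_sets_lebesgue open_maximal_truncation hl open_HL_set hm) simp
    also have "\<dots> = ennreal \<tau> * emeasure ?L {y. ennreal (weak_level * \<tau>) < maximal_truncation K h y}
        + ennreal \<tau> * emeasure ?L (HL_set (\<lambda>y. ennreal (cmod (h y))) \<tau>)" by (rule distrib_left)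
    also have "\<dots> \<le> ennreal weak_const * (ennreal t * ennreal q) + ennreal HL_const * (ennreal t
        * ennreal q)"
      unfolding q(2)[symmetric] hI[symmetric] by (intro add_mono weak_type h \<tau> HL_weak_type hm)
    also have "\<dots> = ennreal ((weak_const + HL_const) * (t * q))"
      using weak_const_nonneg HL_const_nonneg t q by (simp add: ennreal_mult ennreal_plus distrib_right)
    finally have le: "ennreal \<tau> * emeasure ?L E \<le> ennreal ((weak_const + HL_const) * (t * q))" .
    have "emeasure ?L E \<noteq> \<infinity>"
    proof
      assume "emeasure ?L E = \<infinity>"
      then have "ennreal \<tau> * emeasure ?L E = \<infinity>" using \<tau> by (simp add: ennreal_mult_top)
      then show False using le by (simp add: top_unique)
    qed
    then obtain e where e: "0 \<le> e" "emeasure ?L E = ennreal e" by (cases "emeasure ?L E") auto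
    have "ennreal (\<tau> * e) \<le> ennreal ((weak_const + HL_const) * (t * q))"
      using le e \<tau> by (simp add: ennreal_mult)
    then have "\<tau> * e \<le> (weak_const + HL_const) * (t * q)"
      using weak_const_nonneg HL_const_nonneg t q by (subst (asm) ennreal_le_iff) auto
    also have "\<dots> \<le> (weak_const + HL_const + 1) * (t * q)" using t q by (intro mult_right_mono) auto
    finally have "(weak_const + HL_const + 1) * t * (2 ^ (?n + 2) * e) \<le> (weak_const + HL_const + 1) * t * q"
      by (simp add: \<tau>_def stop_factor_def mult_ac)
    moreover have "0 < (weak_const + HL_const + 1) * t" using weak_const_nonneg HL_const_nonneg t by simp
    ultimately have "2 ^ (?n + 2) * e \<le> q" by (simp only: mult_le_cancel_left_pos)
    then have "ennreal (2 ^ (?n + 2) * e) \<le> ennreal q" by (rule ennreal_leI)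
    then show ?thesis using e by (simp add: ennreal_mult)
  qed
  \<comment> \<open>The threshold is half of the density that a single child contained in
    \<open>E\<close> would already give its parent.\<close>
  define P where "P R \<longleftrightarrow> R \<subseteq> ?Q \<and> emeasure ?L R < ennreal (2 ^ (?n + 1))
      * emeasure ?L (R \<inter> E)" for R
  define S where "S = maximal_dyadic P"
  have cS: "countable S" unfolding S_def by (rule countable_maximal_dyadic)
  have dS: "disjoint_family_on (\<lambda>Q. Q) S" unfolding S_def by (rule disjoint_maximal_dyadic)
  have sS: "R \<in> sets ?L" if "R \<in> S" for R using that unfolding S_def by (rule sets_maximal_dyadic)
  have US: "\<Union>S = {y. \<exists>i. P (dyadic i y)}"
    unfolding S_def by (rule Union_maximal_dyadic[where m="\<lambda>_. j"]) (auto simp: P_def dest: dyadic_subset_imp_le)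
  have sUS: "\<Union>S \<in> sets ?L" using cS sS by (intro sets.countable_Union) auto
  have SP: "P R" if "R \<in> S" for R using that by (auto simp: S_def maximal_dyadic_def)
  have Ssub: "R \<subseteq> ?Q" if "R \<in> S" for R using SP[OF that] by (simp add: P_def)
  have m1: "2 * emeasure ?L (\<Union>S) \<le> emeasure ?L ?Q"
  proof -
    have "emeasure ?L (\<Union>S) = (\<integral>\<^sup>+R. emeasure ?L R \<partial>count_space S)"
      using emeasure_UN_countable[OF sS cS dS] by simp
    also have "\<dots> \<le> (\<integral>\<^sup>+R. ennreal (2 ^ (?n + 1))
        * emeasure ?L (R \<inter> E) \<partial>count_space S)"
      by (rule nn_integral_mono) (use SP in \<open>auto simp: P_def simp del: emeasure_completion intro: less_imp_le\<close>)
    also have "\<dots> = ennreal (2 ^ (?n + 1))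
        * (\<integral>\<^sup>+R. emeasure ?L (R \<inter> E) \<partial>count_space S)"
      by (rule nn_integral_cmult) simp
    also have "(\<integral>\<^sup>+R. emeasure ?L (R \<inter> E) \<partial>count_space S)
        = emeasure ?L (\<Union>R\<in>S. R \<inter> E)"
      using cS sS sE dS by (intro emeasure_UN_countable[symmetric]) (auto simp: disjoint_family_on_def)
    also have "\<dots> \<le> emeasure ?L E" using sE by (intro emeasure_mono) auto
    finally have "2 * emeasure ?L (\<Union>S) \<le> 2 * (ennreal (2 ^ (?n + 1)) * emeasure ?L E)"
      by (simp add: mult_left_mono del: emeasure_completion)
    also have "\<dots> = ennreal (2 ^ (?n + 2)) * emeasure ?L E"
      by (simp add: ennreal_mult mult.assoc[symmetric] del: emeasure_completion)
    also have "\<dots> \<le> emeasure ?L ?Q" using mE q by simp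
    finally show ?thesis .
  qed
  have good: "maximal_truncation K h y \<le> ennreal (weak_level * \<tau>)" if "y \<notin> E" for y
    using that by (simp add: E_def not_less)
  \<comment> \<open>The whole cube is not selected, so every selected cube has its parent inside
    \<open>?Q\<close>, where rejection of the parent says something about \<open>E\<close>.\<close>
  have notPQ: "\<not> P ?Q"
  proof
    assume "P ?Q"
    then have "ennreal q < ennreal (2 ^ (?n + 1)) * emeasure ?L (?Q \<inter> E)" using q
        by (simp add: P_def del: emeasure_completion)
    also have "\<dots> \<le> ennreal (2 ^ (?n + 2)) * emeasure ?L E"
      using sE by (intro mult_mono emeasure_mono ennreal_leI power_increasing) auto
    also have "\<dots> \<le> ennreal q" by (rule mE)
    finally show False by simp
  qed
  have out: "maximal_truncation K h y \<le> ennreal (stop_const * t)" if y: "y \<in> ?Q" "y \<notin> \<Union>S" for y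
  proof -
    have "y \<notin> E"
    proof
      assume "y \<in> E"
      obtain m where m: "\<And>i. i \<le> m \<Longrightarrow> dyadic i y \<subseteq> E"
        by (rule dyadic_subset_open[OF oE \<open>y \<in> E\<close>]) (rule that)
      define i where "i = min m j"
      have iE: "dyadic i y \<inter> E = dyadic i y" using m[of i] by (auto simp: i_def)
      have "dyadic i y \<subseteq> dyadic j y" by (rule dyadic_mono) (simp add: i_def)
      then have "dyadic i y \<subseteq> ?Q" using dyadic_eqD(1)[OF y(1)] by simp
      moreover have "emeasure ?L (dyadic i y) < ennreal (2 ^ (?n + 1)) * emeasure ?L (dyadic i y)"
      proof -
        have "(2 powi i) ^ ?n < (2::real) ^ (?n + 1) * (2 powi i) ^ ?n"
          using one_less_power[of "2::real" "?n + 1"] by simp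
        then have "ennreal ((2 powi i) ^ ?n) < ennreal (2 ^ (?n + 1) * (2 powi i) ^ ?n)"
          by (intro ennreal_lessI) auto
        also have "\<dots> = ennreal (2 ^ (?n + 1)) * ennreal ((2 powi i) ^ ?n)" by (intro ennreal_mult) auto
        finally show ?thesis unfolding emeasure_dyadic .
      qed
      ultimately have "P (dyadic i y)" by (simp add: P_def iE del: emeasure_completion)
      then show False using y(2) US by auto
    qed
    then have "maximal_truncation K h y \<le> ennreal (weak_level * \<tau>)" by (rule good)
    also have "\<dots> \<le> ennreal (stop_const * t)"
      using weak_level_pos away_const_pos stop_factor_pos t by (intro ennreal_leI) (simp add: \<tau>_def stop_const_def distrib_right)
    finally show ?thesis .
  qed
  have inner: "maximal_truncation K h y \<le> ennreal (stop_const * t) + maximal_truncation K (\<lambda>y. f y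
      * indicator (dyadic_triple i z) y) y"
    if R: "dyadic i z \<in> S" and y: "y \<in> dyadic i z" for i z y
  proof -
    \<comment> \<open>Membership in \<open>S\<close> may come with another scale and point for the
      same cube; the scales agree by measure, and the points share their ancestors.\<close>
    obtain i' z' where i': "dyadic i z = dyadic i' z'" "\<And>k. k > i' \<Longrightarrow> \<not> P (dyadic k z')"
      using R by (auto simp: S_def maximal_dyadic_def)
    have ii: "i = i'" using i'(1) dyadic_subset_imp_le[of i z i' z'] dyadic_subset_imp_le[of i' z' i z] by auto
    have zz: "z' \<in> dyadic i z" using i'(1) by simp
    have Rsub: "dyadic i z \<subseteq> ?Q" by (rule Ssub[OF R])
    have "i \<le> j" by (rule dyadic_subset_imp_le[OF Rsub])
    have zx: "z \<in> ?Q" using Rsub by auto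
    have "i \<noteq> j"
    proof
      assume "i = j"
      then have "dyadic i z = ?Q" using dyadic_eqD(1)[OF zx] by simp
      then show False using SP[OF R] notPQ by simp
    qed
    then have ij: "i + 1 \<le> j" using \<open>i \<le> j\<close> by simp
    have "dyadic (i + 1) z' = dyadic (i + 1) z"
      using zz dyadic_mono_Suc[of i z] by (intro dyadic_eqD) auto
    then have "\<not> P (dyadic (i + 1) z)" using i'(2)[of "i + 1"] ii by simp
    moreover have "dyadic (i + 1) z \<subseteq> ?Q"
      using dyadic_mono[OF ij, of z] dyadic_eqD(1)[OF zx] by simp
    ultimately have "ennreal (2 ^ (?n + 1)) * emeasure ?L (dyadic (i + 1) z \<inter> E)
        \<le> emeasure ?L (dyadic (i + 1) z)"
      by (simp add: P_def not_less del: emeasure_completion)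
    \<comment> \<open>Were the cube contained in \<open>E\<close>, its parent would have density at
      least \<open>2 ^ -DIM('a)\<close>, twice the threshold at which the parent was
      rejected.\<close>
    have "\<exists>y'. y' \<in> dyadic i z \<and> y' \<notin> E"
    proof (rule ccontr)
      assume "\<not> (\<exists>y'. y' \<in> dyadic i z \<and> y' \<notin> E)"
      then have "dyadic i z \<subseteq> dyadic (i + 1) z \<inter> E" using dyadic_mono_Suc[of i z] by auto
      then have "emeasure ?L (dyadic i z) \<le> emeasure ?L (dyadic (i + 1) z \<inter> E)"
        using sE sets_dyadic by (intro emeasure_mono sets.Int)
      then have "ennreal (2 ^ (?n + 1)) * emeasure ?L (dyadic i z) \<le> emeasure ?L (dyadic (i + 1) z)"
        using \<open>ennreal (2 ^ (?n + 1)) * emeasure ?L (dyadic (i + 1) z \<inter> E) \<le> emeasure ?L (dyadic (i + 1) z)\<close>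
        by (meson mult_left_mono order_trans zero_le)
      then have "ennreal (2 ^ (?n + 1) * (2 powi i) ^ ?n) \<le> ennreal ((2 powi (i + 1)) ^ ?n)"
        unfolding emeasure_dyadic by (subst ennreal_mult) auto
      then have "2 ^ (?n + 1) * (2 powi i) ^ ?n \<le> (2 powi (i + 1) :: real) ^ ?n"
        by (subst (asm) ennreal_le_iff) auto
      then have "2 * (2 ^ ?n * (2 powi i) ^ ?n) \<le> (2 ^ ?n * (2 powi i) ^ ?n :: real)"
        by (simp add: powi_two_Suc power_mult_distrib)
      moreover have "0 < (2 ^ ?n * (2 powi i) ^ ?n :: real)" by simp
      ultimately show False by linarith
    qed
    then obtain y' where y': "y' \<in> dyadic i z" "y' \<notin> E" by blast
    let ?R = "dyadic_triple i z"
    \<comment> \<open>\<open>h1\<close> is the recursive part on the smaller triple;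
      \<open>h2\<close> is seen from a distance, so its maximal truncation at \<open>y\<close> is
      controlled from the good point \<open>y'\<close>.\<close>
    define h1 where "h1 y = f y * indicator ?R y" for y
    define h2 where "h2 y = h y * indicator (- ?R) y" for y
    have "?R \<subseteq> dyadic_triple j z" by (rule dyadic_triple_mono[OF \<open>i \<le> j\<close>])
    then have Rsub3: "?R \<subseteq> dyadic_triple j x" using dyadic_eqD(3)[OF zx] by simp
    have heq: "h = (\<lambda>y. h1 y + h2 y)"
      using Rsub3 by (auto simp: h1_def h2_def h_def indicator_def fun_eq_iff)
    have h1: "integrable ?L h1" unfolding h1_def by (rule loc_integrable_set[OF f sets_dyadic_triple bdd])
    have h2: "integrable ?L h2"
    proof -
      have "integrable ?L (\<lambda>y. h y - h1 y)" using h h1 by simp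
      then show ?thesis by (simp add: heq)
    qed
    have "maximal_truncation K h y \<le> maximal_truncation K h1 y + maximal_truncation K h2 y"
      unfolding heq by (intro maximal_truncation_add_le integrable_imp_loc_integrable h1 h2)
    also have "maximal_truncation K h2 y \<le> maximal_truncation K h y' + ennreal (away_const * \<tau>)"
      unfolding h2_def using y'(2) \<tau> by (intro maximal_truncation_away_le[OF h y y'(1)]) (auto simp: E_def)
    also have "maximal_truncation K h y' \<le> ennreal (weak_level * \<tau>)" by (rule good[OF y'(2)])
    also have "ennreal (weak_level * \<tau>) + ennreal (away_const * \<tau>) = ennreal (stop_const * t)"
    proof -
      have "0 \<le> weak_level * \<tau>" "0 \<le> away_const
          * \<tau>" using weak_level_pos away_const_pos \<tau> by auto
      then have "ennreal (weak_level * \<tau>) + ennreal (away_const * \<tau>) = ennreal (weak_level * \<tau>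
          + away_const * \<tau>)"
        by (rule ennreal_plus[symmetric])
      then show ?thesis by (simp add: \<tau>_def stop_const_def distrib_right mult.assoc)
    qed
    finally show ?thesis by (simp add: h1_def add.commute add_left_mono)
  qed
  show ?thesis
  proof (rule that[of S])
    show "\<exists>i y. R = dyadic i y" if "R \<in> S" for R using that by (auto simp: S_def maximal_dyadic_def)
  qed (use cS dS Ssub m1 out inner in auto)
qed

section \<open>Iteration over the stopping generations and passage to the whole space\<close>

lemma bounded_dyadic_triple: "bounded (dyadic_triple i (z :: 'a))"
  by (simp add: dyadic_triple_def cube_def)

lemma integrable_on_triple:
  "loc_integrable f \<Longrightarrow> integrable lebesgue (\<lambda>y. f y * indicator (dyadic_triple j (x :: 'a)) y)"
  by (rule loc_integrable_set[OF _ sets_dyadic_triple bounded_dyadic_triple])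

lemma measurable_maximal_truncation_triple:
  "loc_integrable f \<Longrightarrow> maximal_truncation K (\<lambda>y. f y
      * indicator (dyadic_triple j x) y) \<in> borel_measurable lebesgue"
  by (rule measurable_maximal_truncation[OF integrable_imp_loc_integrable[OF integrable_on_triple]])

lemma maximal_truncation_eq_0:
  assumes "h \<in> borel_measurable lebesgue" "(\<integral>\<^sup>+y. ennreal (cmod (h y)) \<partial>lebesgue) = 0"
  shows "maximal_truncation K h x = 0"
proof -
  have "maximal_truncation K h x \<le> 0"
    unfolding maximal_truncation_le_iff
  proof (intro allI impI)
    fix e v :: real assume "0 < e" "e < v"
    then show "ennreal (cmod (truncation K h e v x)) \<le> 0"
      using truncation_le[OF assms(1) \<open>0 < e\<close>, of v x] assms(2) by simp
  qed
  then show ?thesis by simp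
qed

text \<open>
  \<open>N\<close> is the union of the stopping cubes of generation \<open>k\<close>.
\<close>

lemma dyadic_bound_iterate:
  fixes f :: "'a \<Rightarrow> complex" and w G :: "'a \<Rightarrow> ennreal"
  assumes f: "loc_integrable f" and w: "w \<in> borel_measurable lebesgue" and G: "G \<in> borel_measurable lebesgue"
    and H: "\<And>j x y. y \<in> dyadic j x \<Longrightarrow>
      (\<integral>\<^sup>+z\<in>dyadic_triple j x. ennreal (cmod (f z)) \<partial>lebesgue)
          * (\<integral>\<^sup>+z\<in>dyadic j x. w z \<partial>lebesgue)
        \<le> (emeasure lebesgue (dyadic j x))\<^sup>2 * G y"
  shows "\<exists>N\<in>sets lebesgue. ennreal (2 ^ k) * emeasure lebesgue N
      \<le> emeasure lebesgue (dyadic j x) \<and>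
    (\<integral>\<^sup>+y\<in>dyadic j x - N. maximal_truncation K (\<lambda>z. f z
        * indicator (dyadic_triple j x) z) y * w y \<partial>lebesgue)
      \<le> ennreal (2 * stop_const) * (\<integral>\<^sup>+y\<in>dyadic j x. G y \<partial>lebesgue)"
proof (induction k arbitrary: j x)
  case 0
  show ?case by (intro bexI[of _ "dyadic j x"]) (auto simp: sets_dyadic simp del: emeasure_completion)
next
  case (Suc k)
  let ?L = "lebesgue :: 'a measure" and ?n = "DIM('a)" and ?Q = "dyadic j x"
  define h where "h = (\<lambda>y. f y * indicator (dyadic_triple j x) y)"
  define a where "a = (\<integral>\<^sup>+y\<in>dyadic_triple j x. ennreal (cmod (f y)) \<partial>?L)"
  have h: "integrable ?L h" unfolding h_def by (rule integrable_on_triple[OF f])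
  have a: "a = (\<integral>\<^sup>+y. ennreal (cmod (h y)) \<partial>?L)"
    unfolding a_def h_def by (intro nn_integral_cong) (auto simp: indicator_def)
  define q :: real where "q = (2 powi j) ^ ?n"
  have q: "0 < q" "emeasure ?L ?Q = ennreal q" by (auto simp: q_def emeasure_dyadic)
  have sQ: "?Q \<in> sets ?L" by (rule sets_dyadic)
  show ?case
  proof (cases "a = 0")
    \<comment> \<open>\<open>stopping_cubes\<close> requires a positive average; if \<open>f\<close>
      vanishes on the triple, so do all truncations.\<close>
    case True
    have "maximal_truncation K h y = 0" for y
      using h True a by (intro maximal_truncation_eq_0) auto
    then show ?thesis by (intro bexI[of _ "{}"]) (auto simp: h_def)
  next
    case False
    have "a < \<infinity>" using h by (simp add: a integrable_iff_bounded)
    then obtain a' where a': "0 < a'" "a = ennreal a'"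
      using False by (cases a) (auto simp: less_le)
    \<comment> \<open>The mass of \<open>f\<close> on the triple divided by the volume of the cube
      itself, not of the triple.\<close>
    define t where "t = a' / q"
    have t: "0 < t" using a' q by (simp add: t_def)
    have tQ: "a = ennreal t * emeasure ?L ?Q"
      using a' q by (simp add: t_def ennreal_mult[symmetric] del: emeasure_completion)
    obtain S where S: "countable S" "disjoint_family_on (\<lambda>Q. Q) S"
      "\<And>P. P \<in> S \<Longrightarrow> \<exists>i y. P = dyadic i y" "\<And>P. P \<in> S
          \<Longrightarrow> P \<subseteq> ?Q"
      "2 * emeasure ?L (\<Union>S) \<le> emeasure ?L ?Q"
      "\<And>y. y \<in> ?Q \<Longrightarrow> y \<notin> \<Union>S \<Longrightarrow> maximal_truncation K h y
          \<le> ennreal (stop_const * t)"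
      "\<And>i z y. dyadic i z \<in> S \<Longrightarrow> y \<in> dyadic i z
          \<Longrightarrow> maximal_truncation K h y \<le>
          ennreal (stop_const * t) + maximal_truncation K (\<lambda>y. f y * indicator (dyadic_triple i z) y) y"
      by (rule stopping_cubes[OF f t tQ[unfolded a_def], folded h_def]) (rule that)
    have "\<forall>P\<in>S. \<exists>p. P = dyadic (fst p) (snd p)" using S(3) by auto
    then obtain p where p: "\<forall>P\<in>S. P = dyadic (fst (p P)) (snd (p P))" by (rule bchoice[THEN exE])
    define l z where "l P = fst (p P)" and "z P = snd (p P)" for P
    have lz: "P = dyadic (l P) (z P)" if "P \<in> S" for P using p that by (simp add: l_def z_def)
    have sS: "P \<in> sets ?L" if "P \<in> S" for P using lz[OF that] sets_dyadic by metis
    define M where "M P = maximal_truncation K (\<lambda>y. f y * indicator (dyadic_triple (l P) (z P)) y)" for P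
    have Mm: "M P \<in> borel_measurable ?L" for P
      unfolding M_def by (rule measurable_maximal_truncation_triple[OF f])
    have "\<forall>P\<in>S. \<exists>N. N \<in> sets ?L \<and> ennreal (2 ^ k) * emeasure ?L N
        \<le> emeasure ?L P \<and>
      (\<integral>\<^sup>+y\<in>P - N. M P y * w y \<partial>?L) \<le> ennreal (2 * stop_const)
          * (\<integral>\<^sup>+y\<in>P. G y \<partial>?L)"
    proof
      fix P assume P: "P \<in> S"
      from Suc.IH[of "l P" "z P"]
      show "\<exists>N. N \<in> sets ?L \<and> ennreal (2 ^ k) * emeasure ?L N \<le> emeasure ?L P \<and>
          (\<integral>\<^sup>+y\<in>P - N. M P y * w y \<partial>?L) \<le> ennreal (2 * stop_const)
              * (\<integral>\<^sup>+y\<in>P. G y \<partial>?L)"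
        unfolding lz[OF P, symmetric] M_def by blast
    qed
    from bchoice[OF this] obtain N where N: "\<And>P. P \<in> S \<Longrightarrow> N P \<in> sets ?L"
      "\<And>P. P \<in> S \<Longrightarrow> ennreal (2 ^ k) * emeasure ?L (N P) \<le> emeasure ?L P"
      "\<And>P. P \<in> S \<Longrightarrow> (\<integral>\<^sup>+y\<in>P - N P. M P y * w y \<partial>?L)
          \<le> ennreal (2 * stop_const) * (\<integral>\<^sup>+y\<in>P. G y \<partial>?L)"
      by blast
    define N' where "N' = (\<Union>P\<in>S. N P)"
    define U where "U = \<Union>S"
    have sN': "N' \<in> sets ?L" unfolding N'_def using S(1) N(1) by (intro sets.countable_UN') auto
    have sU: "U \<in> sets ?L" unfolding U_def using S(1) sS by (intro sets.countable_Union) auto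
    have UQ: "U \<subseteq> ?Q" unfolding U_def using S(4) by blast
    have "ennreal (2 ^ Suc k) * emeasure ?L N' \<le> ennreal (2 ^ Suc k)
        * (\<integral>\<^sup>+P. emeasure ?L (N P) \<partial>count_space S)"
      unfolding N'_def by (intro mult_left_mono emeasure_UN_le S N) auto
    also have "\<dots> = 2 * (\<integral>\<^sup>+P. ennreal (2 ^ k) * emeasure ?L (N P) \<partial>count_space S)"
      by (subst nn_integral_cmult) (auto simp: ennreal_mult mult.assoc simp del: emeasure_completion)
    also have "\<dots> \<le> 2 * (\<integral>\<^sup>+P. emeasure ?L P \<partial>count_space S)"
      by (intro mult_left_mono nn_integral_mono) (auto intro: N(2) simp del: emeasure_completion)
    also have "(\<integral>\<^sup>+P. emeasure ?L P \<partial>count_space S) = emeasure ?L U"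
      using emeasure_UN_countable[OF sS S(1,2)] by (simp add: U_def)
    also have "2 * \<dots> \<le> emeasure ?L ?Q" unfolding U_def by (rule S(5))
    finally have size: "ennreal (2 ^ Suc k) * emeasure ?L N' \<le> emeasure ?L ?Q" .
    let ?W = "\<integral>\<^sup>+y\<in>?Q. w y \<partial>?L"
    let ?g = "\<lambda>P y. M P y * w y * indicator (P - N P) y"
    have gm: "?g P \<in> borel_measurable ?L" if "P \<in> S" for P
      using sS[OF that] N(1)[OF that] Mm w by (intro borel_measurable_times_ennreal borel_measurable_indicator sets.Diff) auto
    have "(\<integral>\<^sup>+y\<in>?Q - N'. maximal_truncation K h y * w y \<partial>?L)
      \<le> (\<integral>\<^sup>+y. ennreal (stop_const * t) * (w y * indicator ?Q y)
          + (SUP P\<in>S. ?g P y) \<partial>?L)"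
    proof (rule nn_integral_mono)
      fix y
      show "maximal_truncation K h y * w y * indicator (?Q - N') y \<le> ennreal (stop_const * t) * (w y
          * indicator ?Q y) + (SUP P\<in>S. ?g P y)"
      proof (cases "y \<in> ?Q - N'")
        case True
        show ?thesis
        proof (cases "y \<in> U")
          case False
          then have "maximal_truncation K h y \<le> ennreal (stop_const * t)" using S(6)[of y] True
              by (simp add: U_def)
          then have "maximal_truncation K h y * w y \<le> ennreal (stop_const * t) * w y"
              by (rule mult_right_mono) simp
          then show ?thesis using True by (simp add: add_increasing2)
        next
          case yU: True
          then obtain P where P: "P \<in> S" "y \<in> P" by (auto simp: U_def)
          have "maximal_truncation K h y \<le> ennreal (stop_const * t) + M P y"
            using S(7)[of "l P" "z P" y] P lz[OF P(1)] by (simp add: M_def)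
          then have "maximal_truncation K h y * w y \<le> (ennreal (stop_const * t) + M P y) * w y"
              by (rule mult_right_mono) simp
          also have "\<dots> = ennreal (stop_const * t) * w y + M P y * w y" by (rule distrib_right)
          also have "M P y * w y = ?g P y" using P True by (auto simp: N'_def)
          also have "\<dots> \<le> (SUP P\<in>S. ?g P y)" by (rule SUP_upper[OF P(1)])
          finally show ?thesis using True by (simp add: add_left_mono)
        qed
      qed simp
    qed
    also have "\<dots> = (\<integral>\<^sup>+y. ennreal (stop_const * t) * (w y * indicator ?Q y) \<partial>?L)
        + (\<integral>\<^sup>+y. (SUP P\<in>S. ?g P y) \<partial>?L)"
      using w sQ by (intro nn_integral_add[OF _ borel_measurable_SUP[OF S(1) gm]] borel_measurable_times_ennreal borel_measurable_indicator) auto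
    \<comment> \<open>The constant does not grow with \<open>k\<close>: the new term is charged to
      \<open>?Q - U\<close> and the inductive terms to the disjoint cubes that make up
      \<open>U\<close>.\<close>
    also have "\<dots> \<le> ennreal (2 * stop_const) * (\<integral>\<^sup>+y\<in>?Q - U. G y \<partial>?L)
        + ennreal (2 * stop_const) * (\<integral>\<^sup>+y\<in>U. G y \<partial>?L)"
    proof (rule add_mono)
      have "(\<integral>\<^sup>+y. (SUP P\<in>S. ?g P y) \<partial>?L)
          \<le> (\<integral>\<^sup>+y. \<integral>\<^sup>+P. ?g P y \<partial>count_space S \<partial>?L)"
        by (intro nn_integral_mono SUP_least nn_integral_ge_point)
      also have "\<dots> = (\<integral>\<^sup>+P. \<integral>\<^sup>+y. ?g P y \<partial>?L \<partial>count_space S)"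
        by (rule nn_integral_count_space_nn_integral[OF S(1) gm])
      also have "\<dots> \<le> (\<integral>\<^sup>+P. ennreal (2 * stop_const)
          * (\<integral>\<^sup>+y\<in>P. G y \<partial>?L) \<partial>count_space S)"
        by (rule nn_integral_mono) (simp add: N(3))
      also have "\<dots> = ennreal (2 * stop_const)
          * (\<integral>\<^sup>+P. (\<integral>\<^sup>+y\<in>P. G y \<partial>?L) \<partial>count_space S)"
        by (rule nn_integral_cmult) simp
      also have "(\<integral>\<^sup>+P. (\<integral>\<^sup>+y\<in>P. G y \<partial>?L) \<partial>count_space S)
          = (\<integral>\<^sup>+y\<in>U. G y \<partial>?L)"
        using nn_integral_UN_disjoint[OF S(1) sS G S(2)] by (simp add: U_def)
      finally show "(\<integral>\<^sup>+y. (SUP P\<in>S. ?g P y) \<partial>?L) \<le> ennreal (2 * stop_const)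
          * (\<integral>\<^sup>+y\<in>U. G y \<partial>?L)" .
      \<comment> \<open>The hypothesis \<open>H\<close>, divided by the volume of the cube. It holds
        at each point of \<open>?Q\<close>, so the points used for averaging may be
        restricted.\<close>
      have tw: "ennreal t * ?W \<le> ennreal q * G y" if "y \<in> ?Q" for y
      proof -
        have "ennreal q * (ennreal t * ?W) = a * ?W" by (simp add: tQ q mult_ac del: emeasure_completion)
        also have "\<dots> \<le> (ennreal q)\<^sup>2 * G y" using H[OF that] unfolding a_def q .
        also have "\<dots> = ennreal q * (ennreal q * G y)" by (simp add: power2_eq_square mult.assoc)
        finally show ?thesis using q(1) by (simp add: ennreal_mult_le_mult_iff)
      qed
      \<comment> \<open>The part left by the stopping cubes is at least half of \<open>?Q\<close>;
        this allows averaging over it alone and is the source of the 2 in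
        \<open>2 * stop_const\<close>.\<close>
      have "ennreal q \<le> 2 * emeasure ?L (?Q - U)"
      proof -
        have "emeasure ?L U \<le> ennreal q" using emeasure_mono[OF UQ sQ] unfolding q .
        then obtain u where u: "0 \<le> u" "emeasure ?L U = ennreal u"
            by (cases "emeasure ?L U") (auto simp: top_unique)
        have "2 * ennreal u \<le> ennreal q" using S(5) unfolding U_def[symmetric] u q .
        then have "ennreal (2 * u) \<le> ennreal q" using u by (simp add: ennreal_mult)
        then have "2 * u \<le> q" using q by (simp add: ennreal_le_iff)
        have "emeasure ?L (?Q - U) = ennreal q - ennreal u"
          using emeasure_Diff[OF _ sQ sU UQ] u q by simp
        also have "\<dots> = ennreal (q - u)" using u by (simp add: ennreal_minus)
        finally have e: "emeasure ?L (?Q - U) = ennreal (q - u)" .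
        have "2 * emeasure ?L (?Q - U) = ennreal (2 * (q - u))"
          unfolding e using \<open>2 * u \<le> q\<close> u by (subst ennreal_mult) auto
        then show ?thesis using \<open>2 * u \<le> q\<close> by (simp add: ennreal_leI)
      qed
      then have "ennreal q * (ennreal t * ?W) \<le> 2 * emeasure ?L (?Q - U) * (ennreal t * ?W)"
        by (rule mult_right_mono) simp
      also have "\<dots> = 2 * (ennreal t * ?W * emeasure ?L (?Q - U))" by (simp only: mult_ac)
      also have "ennreal t * ?W * emeasure ?L (?Q - U) = (\<integral>\<^sup>+y\<in>?Q - U. ennreal t
          * ?W \<partial>?L)"
        using sQ sU by (intro nn_integral_cmult_indicator[symmetric] sets.Diff)
      also have "2 * \<dots> \<le> 2 * (\<integral>\<^sup>+y. ennreal q * (G y * indicator (?Q - U) y) \<partial>?L)"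
      proof (intro mult_left_mono nn_integral_mono)
        fix y show "ennreal t * ?W * indicator (?Q - U) y \<le> ennreal q * (G y * indicator (?Q - U) y)"
          using tw[of y] by (cases "y \<in> ?Q - U") auto
      qed simp
      also have "(\<integral>\<^sup>+y. ennreal q * (G y * indicator (?Q - U) y) \<partial>?L) = ennreal q
          * (\<integral>\<^sup>+y\<in>?Q - U. G y \<partial>?L)"
        using G sQ sU by (intro nn_integral_cmult borel_measurable_times_ennreal borel_measurable_indicator sets.Diff) auto
      also have "2 * (ennreal q * (\<integral>\<^sup>+y\<in>?Q - U. G y \<partial>?L)) = ennreal q * (2
          * (\<integral>\<^sup>+y\<in>?Q - U. G y \<partial>?L))" by (simp only: mult_ac)
      finally have tW: "ennreal t * ?W \<le> 2 * (\<integral>\<^sup>+y\<in>?Q - U. G y \<partial>?L)" using q(1)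
          by (simp add: ennreal_mult_le_mult_iff)
      have "(\<integral>\<^sup>+y. ennreal (stop_const * t) * (w y * indicator ?Q y) \<partial>?L)
          = ennreal (stop_const * t) * ?W"
        using w sQ by (intro nn_integral_cmult) auto
      also have "\<dots> = ennreal stop_const * (ennreal t * ?W)"
        using stop_const_pos t by (simp add: ennreal_mult mult.assoc)
      also have "\<dots> \<le> ennreal stop_const * (2 * (\<integral>\<^sup>+y\<in>?Q - U. G y \<partial>?L))"
          by (intro mult_left_mono tW) simp
      also have "\<dots> = ennreal (2 * stop_const) * (\<integral>\<^sup>+y\<in>?Q - U. G y \<partial>?L)"
        using stop_const_pos by (simp add: ennreal_mult mult_ac)
      finally show "(\<integral>\<^sup>+y. ennreal (stop_const * t) * (w y * indicator ?Q y) \<partial>?L)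
          \<le> ennreal (2 * stop_const) * (\<integral>\<^sup>+y\<in>?Q - U. G y \<partial>?L)" .
    qed
    also have "\<dots> = ennreal (2 * stop_const) * ((\<integral>\<^sup>+y\<in>?Q - U. G y \<partial>?L)
        + (\<integral>\<^sup>+y\<in>U. G y \<partial>?L))" by (rule distrib_left[symmetric])
    also have "(\<integral>\<^sup>+y\<in>?Q - U. G y \<partial>?L)
        + (\<integral>\<^sup>+y\<in>U. G y \<partial>?L) = (\<integral>\<^sup>+y. G y * indicator (?Q - U) y
            + G y * indicator U y \<partial>?L)"
      using G sQ sU by (intro nn_integral_add[symmetric] borel_measurable_times_ennreal borel_measurable_indicator sets.Diff) auto
    also have "\<dots> = (\<integral>\<^sup>+y\<in>?Q. G y \<partial>?L)" using UQ
        by (intro nn_integral_cong) (auto simp: indicator_def)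
    finally have bound: "(\<integral>\<^sup>+y\<in>?Q - N'. maximal_truncation K h y * w y \<partial>?L)
        \<le> ennreal (2 * stop_const) * (\<integral>\<^sup>+y\<in>?Q. G y \<partial>?L)" .
    show ?thesis using sN' size bound unfolding h_def by blast
  qed
qed

text \<open>The sets left over for different \<open>k\<close> are chosen independently and need not
  decrease, but their measures are summable, so by Borel-Cantelli almost every point avoids all but
  finitely many of them. The integrand may have infinite integral, hence the limit is taken by
  Fatou's lemma.\<close>

lemma dyadic_bound:
  fixes f :: "'a \<Rightarrow> complex" and w G :: "'a \<Rightarrow> ennreal"
  assumes f: "loc_integrable f" and w: "w \<in> borel_measurable lebesgue" and G: "G \<in> borel_measurable lebesgue"
    and H: "\<And>j x y. y \<in> dyadic j x \<Longrightarrow>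
      (\<integral>\<^sup>+z\<in>dyadic_triple j x. ennreal (cmod (f z)) \<partial>lebesgue)
          * (\<integral>\<^sup>+z\<in>dyadic j x. w z \<partial>lebesgue)
        \<le> (emeasure lebesgue (dyadic j x))\<^sup>2 * G y"
  shows "(\<integral>\<^sup>+y\<in>dyadic j x. maximal_truncation K (\<lambda>z. f z
      * indicator (dyadic_triple j x) z) y * w y \<partial>lebesgue)
      \<le> ennreal (2 * stop_const) * (\<integral>\<^sup>+y\<in>dyadic j x. G y \<partial>lebesgue)"
proof -
  let ?L = "lebesgue :: 'a measure" and ?Q = "dyadic j x"
  define F where "F y = maximal_truncation K (\<lambda>z. f z * indicator (dyadic_triple j x) z) y * w y" for y
  define R where "R = ennreal (2 * stop_const) * (\<integral>\<^sup>+y\<in>?Q. G y \<partial>?L)"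
  have Fm: "F \<in> borel_measurable ?L"
    unfolding F_def by (intro borel_measurable_times_ennreal measurable_maximal_truncation_triple f w)
  have "\<forall>k. \<exists>N. N \<in> sets ?L \<and> ennreal (2 ^ k) * emeasure ?L N
      \<le> emeasure ?L ?Q \<and> (\<integral>\<^sup>+y\<in>?Q - N. F y \<partial>?L) \<le> R"
    using dyadic_bound_iterate[OF f w G H] unfolding F_def R_def by blast
  then obtain N where N: "\<And>k. N k \<in> sets ?L" "\<And>k. ennreal (2 ^ k) * emeasure ?L (N k)
      \<le> emeasure ?L ?Q"
     "\<And>k. (\<integral>\<^sup>+y\<in>?Q - N k. F y \<partial>?L) \<le> R"
    by metis
  define q :: real where "q = (2 powi j) ^ DIM('a)"
  have q: "0 < q" "emeasure ?L ?Q = ennreal q" by (auto simp: q_def emeasure_dyadic)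
  have fin: "emeasure ?L (N k) \<le> ennreal (q * (1 / 2) ^ k)" for k
  proof -
    have "ennreal (2 ^ k) * emeasure ?L (N k) \<le> ennreal (2 ^ k) * ennreal (q * (1 / 2) ^ k)"
      using N(2)[of k] q by (subst ennreal_mult[symmetric]) (auto simp: power_divide simp del: emeasure_completion)
    then show ?thesis by (subst (asm) ennreal_mult_le_mult_iff) auto
  qed
  have fin': "emeasure ?L (N k) < \<infinity>" for k using le_less_trans[OF fin ennreal_less_top] by simp
  have "summable (\<lambda>k. measure ?L (N k))"
  proof (rule summable_comparison_test')
    show "summable (\<lambda>k. q * (1 / 2) ^ k)" by (intro summable_mult summable_geometric) simp
    show "norm (measure ?L (N k)) \<le> q * (1 / 2) ^ k" for k
      using enn2real_mono[OF fin[of k]] q by (simp add: measure_def)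
  qed
  then have "AE y in ?L. eventually (\<lambda>k. y \<in> space ?L - N k) sequentially"
    by (intro borel_cantelli_AE1 N fin')
  then have "AE y in ?L. F y * indicator ?Q y \<le> liminf (\<lambda>k. F y * indicator (?Q - N k) y)"
  proof eventually_elim
    case (elim y)
    then have "eventually (\<lambda>k. F y * indicator ?Q y = F y * indicator (?Q - N k) y) sequentially"
      by eventually_elim (auto simp: indicator_def)
    then have "eventually (\<lambda>k. F y * indicator ?Q y \<le> F y * indicator (?Q - N k) y) sequentially"
      by eventually_elim simp
    then show ?case by (rule Liminf_bounded)
  qed
  then have "(\<integral>\<^sup>+y\<in>?Q. F y \<partial>?L)
      \<le> (\<integral>\<^sup>+y. liminf (\<lambda>k. F y * indicator (?Q - N k) y) \<partial>?L)"
    by (rule nn_integral_mono_AE)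
  also have "\<dots> \<le> liminf (\<lambda>k. \<integral>\<^sup>+y\<in>?Q - N k. F y \<partial>?L)"
    using Fm N(1) sets_dyadic by (intro nn_integral_liminf borel_measurable_times_ennreal borel_measurable_indicator sets.Diff)
  also have "\<dots> \<le> liminf (\<lambda>k::nat. R)"
    by (intro Liminf_mono always_eventually allI N(3))
  also have "\<dots> = R" by (simp add: Liminf_const)
  finally show ?thesis by (simp add: F_def R_def)
qed

text \<open>A growing chain of dyadic cubes stays in one orthant, so all cubes of one generation
  \<open>m\<close> are used at once. With outer radius at most \<open>2 ^ m\<close>, a truncation at
  a point of such a cube sees \<open>f\<close> only on its triple; the local bounds are added up and
  \<open>m\<close> tends to infinity by monotone convergence.\<close>

lemma global_bound:
  fixes f :: "'a \<Rightarrow> complex" and w G :: "'a \<Rightarrow> ennreal"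
  assumes f: "loc_integrable f" and w: "w \<in> borel_measurable lebesgue" and G: "G \<in> borel_measurable lebesgue"
    and H: "\<And>j x y. y \<in> dyadic j x \<Longrightarrow>
      (\<integral>\<^sup>+z\<in>dyadic_triple j x. ennreal (cmod (f z)) \<partial>lebesgue)
          * (\<integral>\<^sup>+z\<in>dyadic j x. w z \<partial>lebesgue)
        \<le> (emeasure lebesgue (dyadic j x))\<^sup>2 * G y"
  shows "(\<integral>\<^sup>+y. maximal_truncation K f y * w y \<partial>lebesgue) \<le> ennreal (2
      * stop_const) * (\<integral>\<^sup>+y. G y \<partial>lebesgue)"
proof -
  let ?L = "lebesgue :: 'a measure"
  define J where "J m = {(e::real, v::real). 0 < e \<and> e < v \<and> v \<le> 2 ^ m}" for m :: nat
  define Z where "Z m = sup_truncation K (J m) f" for m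
  have Zm: "Z m \<in> borel_measurable ?L" for m
    unfolding Z_def by (rule measurable_sup_truncation[OF f]) (auto simp: J_def)
  have ZT: "Z m y \<le> maximal_truncation K (\<lambda>z. f z * indicator (dyadic_triple (int m) x) z) y"
    if y: "y \<in> dyadic (int m) x" for m x y
    unfolding Z_def sup_truncation_def
  proof (rule SUP_least, clarify)
    fix e v assume "(e, v) \<in> J m"
    then have ev: "0 < e" "e < v" "v \<le> 2 ^ m" by (auto simp: J_def)
    have "annulus y e v \<subseteq> dyadic_triple (int m) x"
    proof
      fix z assume z: "z \<in> annulus y e v"
      show "z \<in> dyadic_triple (int m) x"
      proof (rule ccontr)
        assume "z \<notin> dyadic_triple (int m) x"
        from not_dyadic_triple_norm[OF this y] z ev show False by (simp add: annulus_def)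
      qed
    qed
    then have "truncation K f e v y = truncation K (\<lambda>z. f z * indicator (dyadic_triple (int m) x) z) e v y"
      unfolding truncation_def set_lebesgue_integral_def
      by (intro Bochner_Integration.integral_cong) (auto simp: indicator_def)
    then show "ennreal (cmod (truncation K f e v y)) \<le> maximal_truncation K (\<lambda>z. f z
        * indicator (dyadic_triple (int m) x) z) y"
      using truncation_le_maximal_truncation[OF ev(1,2)] by simp
  qed
  have ZI: "(\<integral>\<^sup>+y. Z m y * w y \<partial>?L) \<le> ennreal (2 * stop_const)
      * (\<integral>\<^sup>+y. G y \<partial>?L)" for m
  proof -
    define D where "D = range (dyadic (int m) :: 'a \<Rightarrow> 'a set)"
    have cD: "countable D" by (rule countable_subset[OF _ countable_dyadic_cubes]) (auto simp: D_def dyadic_cubes_def)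
    have sD: "Q \<in> sets ?L" if "Q \<in> D" for Q using that sets_dyadic by (auto simp: D_def)
    have dD: "disjoint_family_on (\<lambda>Q. Q) D"
      unfolding disjoint_family_on_def
    proof (intro ballI impI)
      fix Q R assume QR: "Q \<in> D" "R \<in> D" "Q \<noteq> R"
      then obtain x y where xy: "Q = dyadic (int m) x" "R = dyadic (int m) y" by (auto simp: D_def)
      show "Q \<inter> R = {}"
      proof (rule ccontr)
        assume "Q \<inter> R \<noteq> {}"
        then obtain z where "z \<in> dyadic (int m) x" "z \<in> dyadic (int m) y" using xy by auto
        then have "Q = R" using dyadic_eqD(1)[of z "int m" x] dyadic_eqD(1)[of z "int m" y] xy by simp
        then show False using QR by simp
      qed
    qed
    have UD: "(\<Union>Q\<in>D. Q) = UNIV"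
    proof (rule set_eqI)
      fix x :: 'a
      have "x \<in> dyadic (int m) x" by simp
      moreover have "dyadic (int m) x \<in> D" by (simp add: D_def)
      ultimately show "x \<in> (\<Union>Q\<in>D. Q) \<longleftrightarrow> x \<in> UNIV" by blast
    qed
    have "(\<integral>\<^sup>+y. Z m y * w y \<partial>?L)
        = (\<integral>\<^sup>+y\<in>(\<Union>Q\<in>D. Q). Z m y * w y \<partial>?L)" unfolding UD by simp
    also have "\<dots> = (\<integral>\<^sup>+Q. (\<integral>\<^sup>+y\<in>Q. Z m y
        * w y \<partial>?L) \<partial>count_space D)"
      using Zm w by (intro nn_integral_UN_disjoint[OF cD sD _ dD] borel_measurable_times_ennreal)
    also have "\<dots> \<le> (\<integral>\<^sup>+Q. ennreal (2 * stop_const)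
        * (\<integral>\<^sup>+y\<in>Q. G y \<partial>?L) \<partial>count_space D)"
    proof (rule nn_integral_mono)
      fix Q assume "Q \<in> space (count_space D)"
      then obtain x where x: "Q = dyadic (int m) x" by (auto simp: D_def)
      have "(\<integral>\<^sup>+y\<in>Q. Z m y * w y \<partial>?L)
          \<le> (\<integral>\<^sup>+y\<in>Q. maximal_truncation K (\<lambda>z. f z
              * indicator (dyadic_triple (int m) x) z) y * w y \<partial>?L)"
      proof (rule nn_integral_mono)
        fix y show "Z m y * w y * indicator Q y \<le> maximal_truncation K (\<lambda>z. f z
            * indicator (dyadic_triple (int m) x) z) y * w y * indicator Q y"
          using ZT[of y m x] x by (cases "y \<in> Q") (auto intro: mult_right_mono)
      qed
      also have "\<dots> \<le> ennreal (2 * stop_const) * (\<integral>\<^sup>+y\<in>Q. G y \<partial>?L)"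
        unfolding x by (rule dyadic_bound[OF f w G H])
      finally show "(\<integral>\<^sup>+y\<in>Q. Z m y * w y \<partial>?L) \<le> \<dots>" .
    qed
    also have "\<dots> = ennreal (2 * stop_const)
        * (\<integral>\<^sup>+Q. (\<integral>\<^sup>+y\<in>Q. G y \<partial>?L) \<partial>count_space D)"
      by (rule nn_integral_cmult) simp
    also have "(\<integral>\<^sup>+Q. (\<integral>\<^sup>+y\<in>Q. G y \<partial>?L) \<partial>count_space D)
        = (\<integral>\<^sup>+y. G y \<partial>?L)"
      using nn_integral_UN_disjoint[OF cD sD G dD] unfolding UD by simp
    finally show ?thesis .
  qed
  have SZ: "maximal_truncation K f y = (SUP m. Z m y)" for y
  proof (rule antisym)
    show "maximal_truncation K f y \<le> (SUP m. Z m y)"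
      unfolding maximal_truncation_le_iff
    proof (intro allI impI)
      fix e v :: real assume ev: "0 < e" "e < v"
      obtain m :: nat where "v < 2 ^ m" using real_arch_pow[of 2 v] by auto
      then have "(e, v) \<in> J m" using ev by (simp add: J_def)
      then have "ennreal (cmod (truncation K f e v y)) \<le> Z m y"
        unfolding Z_def sup_truncation_def by (rule SUP_upper2) simp
      also have "\<dots> \<le> (SUP m. Z m y)" by (rule SUP_upper) simp
      finally show "ennreal (cmod (truncation K f e v y)) \<le> \<dots>" .
    qed
    show "(SUP m. Z m y) \<le> maximal_truncation K f y"
      unfolding Z_def sup_truncation_def maximal_truncation_eq
      by (intro SUP_least SUP_subset_mono) (auto simp: J_def)
  qed
  have "incseq (\<lambda>m y. Z m y * w y)"
  proof (intro incseq_SucI le_funI mult_right_mono)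
    fix m y
    have "(2::real) ^ m \<le> 2 ^ Suc m" by simp
    then show "Z m y \<le> Z (Suc m) y"
      unfolding Z_def sup_truncation_def by (intro SUP_subset_mono) (auto simp: J_def intro: order_trans)
  qed simp
  then have "(\<integral>\<^sup>+y. (SUP m. Z m y * w y) \<partial>?L) = (SUP m. \<integral>\<^sup>+y. Z m y
      * w y \<partial>?L)"
    using Zm w by (intro nn_integral_monotone_convergence_SUP borel_measurable_times_ennreal)
  moreover have "(SUP m. Z m y * w y) = maximal_truncation K f y * w y" for y
    unfolding SZ by (rule SUP_mult_right_ennreal[symmetric])
  ultimately have "(\<integral>\<^sup>+y. maximal_truncation K f y * w y \<partial>?L)
      = (SUP m. \<integral>\<^sup>+y. Z m y * w y \<partial>?L)" by simp
  also have "\<dots> \<le> ennreal (2 * stop_const) * (\<integral>\<^sup>+y. G y \<partial>?L)"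
      by (rule SUP_least) (rule ZI)
  finally show ?thesis .
qed

end

section \<open>Powers and duality\<close>

lemma ennreal_powr_ennreal: "0 \<le> x \<Longrightarrow> ennreal_powr (ennreal x) a = ennreal (x powr a)"
  by (simp add: ennreal_powr_def)

lemma ennreal_powr_top [simp]: "ennreal_powr \<infinity> a = \<infinity>" "ennreal_powr top a = \<infinity>"
  by (simp_all add: ennreal_powr_def)

lemma ennreal_powr_mono:
  assumes "x \<le> y" "0 < a"
  shows "ennreal_powr x a \<le> ennreal_powr y a"
proof (cases y rule: ennreal_cases)
  case (real r)
  then obtain s where "0 \<le> s" "x = ennreal s" using assms(1)
      by (cases x rule: ennreal_cases) (auto simp: top_unique)
  then show ?thesis using real assms by (auto simp: ennreal_powr_ennreal intro!: ennreal_leI powr_mono2)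
qed simp

lemma ennreal_powr_inverse:
  assumes "0 < a"
  shows "ennreal_powr (ennreal_powr x a) (1 / a) = x" "ennreal_powr (ennreal_powr x (1 / a)) a = x"
  using assms by (cases x rule: ennreal_cases; simp add: ennreal_powr_ennreal powr_powr)+

lemma ennreal_powr_le_iff:
  assumes "0 < a"
  shows "ennreal_powr x (1 / a) \<le> y \<longleftrightarrow> x \<le> ennreal_powr y a"
  using ennreal_powr_mono[of "ennreal_powr x (1 / a)" y a] ennreal_powr_mono[of x "ennreal_powr y a" "1 / a"]
    ennreal_powr_inverse[OF assms] assms by auto

text \<open>Moves the weight from the measure into the function. The delicate case is infinite
  \<open>x\<close> with \<open>u = 0\<close>, where both sides are 0.\<close>

lemma ennreal_powr_mult_root:
  assumes "0 < p" "0 \<le> u"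
  shows "ennreal_powr (x * ennreal (u powr (1 / p))) p = ennreal_powr x p * ennreal u"
proof (cases x rule: ennreal_cases)
  case (real r)
  then show ?thesis
    using assms by (simp add: ennreal_powr_ennreal powr_mult powr_powr ennreal_mult[symmetric])
next
  case top
  show ?thesis
  proof (cases "u = 0")
    case True
    then show ?thesis using assms by (simp add: ennreal_powr_def)
  next
    case False
    then show ?thesis using assms top by (simp add: ennreal_top_mult)
  qed
qed

lemma measurable_ennreal_powr [measurable]: "(\<lambda>x. ennreal_powr x a) \<in> borel_measurable borel"
  unfolding ennreal_powr_def by measurable

lemma conjugate_exponent:
  fixes p p' :: real
  assumes "1 < p" and "p' = p / (p - 1)"
  shows "1 < p'" "(p - 1) * p' = p" "1 / p + 1 / p' = 1"
  unfolding assms(2) using assms(1) by (simp_all add: less_divide_eq field_simps)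

text \<open>Takes the role of Hoelder's inequality later: the functions there are normalised, so
  bounding the product by a sum of powers loses only a constant. The factors \<open>1 / p\<close>
  and \<open>1 / p'\<close> are dropped.\<close>

lemma ennreal_Youngs_inequality:
  assumes p: "1 < p" and p': "p' = p / (p - 1)"
  shows "x * y \<le> ennreal_powr x p + ennreal_powr y p'"
proof (cases "x = \<infinity> \<or> y = \<infinity>")
  case False
  then obtain a b where ab: "0 \<le> a" "x = ennreal a" "0 \<le> b" "y = ennreal b"
    by (cases x rule: ennreal_cases; cases y rule: ennreal_cases) auto
  note p'1 = conjugate_exponent(1)[OF p p']
  have "a * b \<le> a powr p / p + b powr p' / p'"
    using ab p p'1 conjugate_exponent(3)[OF p p'] by (intro Youngs_inequality) auto
  also have "\<dots> \<le> a powr p + b powr p'"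
  proof -
    have "z / q \<le> z" if "1 < q" "0 \<le> z" for z q :: real
      using that mult_left_mono[of 1 q z] by (simp add: divide_le_eq)
    then show ?thesis using p p'1 by (intro add_mono) auto
  qed
  finally show ?thesis
    using ab by (simp add: ennreal_powr_ennreal flip: ennreal_mult ennreal_plus)
qed (auto simp: ennreal_powr_def)

lemma Lp_norm_le_iff:
  assumes "0 < p"
  shows "Lp_norm p w f \<le> y \<longleftrightarrow> (\<integral>\<^sup>+x. ennreal_powr (f x) p
      * ennreal (w x) \<partial>lebesgue) \<le> ennreal_powr y p"
  unfolding Lp_norm_def by (rule ennreal_powr_le_iff[OF assms])

text \<open>Converse of Hoelder's inequality for a function that may have infinite norm or infinite
  values. The extremal test function is built from bounded, compactly supported truncations of
  \<open>F\<close>, which exhaust it monotonically.\<close>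

lemma nn_integral_powr_le_dual:
  fixes F :: "'a::euclidean_space \<Rightarrow> ennreal"
  assumes p: "1 < p" and p': "p' = p / (p - 1)" and F: "F \<in> borel_measurable lebesgue"
    and dual: "\<And>g. g \<in> borel_measurable lebesgue
        \<Longrightarrow> (\<integral>\<^sup>+x. ennreal_powr (g x) p' \<partial>lebesgue) \<le> 1 \<Longrightarrow>
      (\<integral>\<^sup>+x. F x * g x \<partial>lebesgue) \<le> D"
  shows "(\<integral>\<^sup>+x. ennreal_powr (F x) p \<partial>lebesgue) \<le> ennreal_powr D p"
proof -
  let ?L = "lebesgue :: 'a measure"
  \<comment> \<open>Cut off at height \<open>k\<close> and outside the ball of radius
    \<open>k\<close>, so that the integral of the power is finite and can be divided by.\<close>
  define h where "h k x = enn2real (min (F x) (ennreal (real k))) * indicator (ball 0 (real k)) x" for k :: nat and x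
  have h0: "0 \<le> h k x" for k x by (simp add: h_def)
  have min_fin: "min (F x) (ennreal (real k)) < \<infinity>" for k x by (simp add: min_less_iff_disj)
  have hF: "ennreal (h k x) \<le> F x" for k x
  proof (cases "x \<in> ball 0 (real k)")
    case True
    then have "ennreal (h k x) = min (F x) (ennreal (real k))" using min_fin[of x k] by (simp add: h_def)
    then show ?thesis by simp
  qed (simp add: h_def)
  have hk: "h k x \<le> real k * indicator (ball 0 (real k)) x" for k x
  proof -
    have "enn2real (min (F x) (ennreal (real k))) \<le> real k" by (rule enn2real_leI) auto
    then show ?thesis unfolding h_def by (rule mult_right_mono) simp
  qed
  have ball_m: "(indicator (ball 0 r) :: 'a \<Rightarrow> real) \<in> borel_measurable ?L" for r
    by (rule borel_measurable_indicator[OF ball_in_sets_lebesgue])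
  have hm: "h k \<in> borel_measurable ?L" for k
  proof -
    have "(\<lambda>x. enn2real (min (F x) (ennreal (real k)))) \<in> borel_measurable ?L"
      using F by measurable
    then show ?thesis unfolding h_def by (intro borel_measurable_times ball_m)
  qed
  have hpm: "(\<lambda>x. ennreal (h k x powr a)) \<in> borel_measurable ?L" for k a
  proof -
    have "(\<lambda>x. ennreal (x powr a)) \<in> borel_measurable borel" by measurable
    from measurable_compose[OF hm this] show ?thesis .
  qed
  have le: "(\<integral>\<^sup>+x. ennreal (h k x powr p) \<partial>?L) \<le> ennreal_powr D p" for k
  proof -
    define I where "I = (\<integral>\<^sup>+x. ennreal (h k x powr p) \<partial>?L)"
    have "I \<le> (\<integral>\<^sup>+x. ennreal (real k powr p) * indicator (ball 0 (real k)) x \<partial>?L)"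
      unfolding I_def
    proof (rule nn_integral_mono)
      fix x
      show "ennreal (h k x powr p) \<le> ennreal (real k powr p) * indicator (ball 0 (real k)) x"
        using hk[of k x] h0[of k x] p by (cases "x \<in> ball 0 (real k)") (auto intro!: ennreal_leI powr_mono2)
    qed
    also have "\<dots> = ennreal (real k powr p) * emeasure ?L (ball 0 (real k))"
      by (rule nn_integral_cmult_indicator[OF ball_in_sets_lebesgue])
    also have "\<dots> < \<infinity>" by (subst emeasure_lebesgue_ball) (auto simp: ennreal_mult_less_top)
    finally obtain i where i: "0 \<le> i" "I = ennreal i" by (cases I rule: ennreal_cases) auto
    show ?thesis
    proof (cases "i = 0")
      case True
      then show ?thesis using i by (simp add: I_def)
    next
      case False
      then have i0: "0 < i" using i by simp
      note p'1 = conjugate_exponent(1)[OF p p']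
      note pp = conjugate_exponent(2,3)[OF p p']
      \<comment> \<open>The extremal function \<open>h ^ (p - 1)\<close>; the power of
        \<open>i\<close> normalises it in the dual space because
        \<open>(p - 1) * p' = p\<close>.\<close>
      define g where "g x = ennreal (h k x powr (p - 1) * i powr (- 1 / p'))" for x
      have gm: "g \<in> borel_measurable ?L"
      proof -
        have "(\<lambda>x. ennreal (x powr (p - 1) * i powr (- 1 / p'))) \<in> borel_measurable borel" by measurable
        from measurable_compose[OF hm this] show ?thesis by (simp add: g_def[abs_def])
      qed
      have "ennreal_powr (g x) p' = ennreal (1 / i) * ennreal (h k x powr p)" for x
      proof -
        have "(i powr (- 1 / p')) powr p' = 1 / i"
          unfolding powr_powr using i0 p'1 by (simp add: powr_minus_divide)
        then have "(h k x powr (p - 1) * i powr (- 1 / p')) powr p' = h k x powr p * (1 / i)"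
          by (simp add: powr_mult powr_powr pp)
        then show ?thesis using i0 by (simp add: g_def ennreal_powr_ennreal ennreal_mult[symmetric] mult.commute)
      qed
      then have "(\<integral>\<^sup>+x. ennreal_powr (g x) p' \<partial>?L) = ennreal (1 / i) * I"
        unfolding I_def by (simp add: nn_integral_cmult[OF hpm])
      also have "\<dots> = 1" using i0 i by (simp add: ennreal_mult[symmetric])
      finally have "(\<integral>\<^sup>+x. F x * g x \<partial>?L) \<le> D" by (intro dual gm) simp
      moreover have "ennreal (i powr (1 / p)) \<le> (\<integral>\<^sup>+x. F x * g x \<partial>?L)"
      proof -
        have "i powr (1 / p) = i powr (- 1 / p') * i"
        proof -
          have e: "1 / p = - 1 / p' + 1" using pp(2) by simp
          show ?thesis unfolding e powr_add using i0 by simp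
        qed
        then have "ennreal (i powr (1 / p)) = ennreal (i powr (- 1 / p')) * I" using i by (simp add: ennreal_mult)
        also have "\<dots> = (\<integral>\<^sup>+x. ennreal (i powr (- 1 / p'))
            * ennreal (h k x powr p) \<partial>?L)"
          unfolding I_def by (rule nn_integral_cmult[OF hpm, symmetric])
        also have "\<dots> \<le> (\<integral>\<^sup>+x. F x * g x \<partial>?L)"
        proof (rule nn_integral_mono)
          fix x
          have "h k x powr p = h k x * h k x powr (p - 1)"
            using h0[of k x] p by (cases "h k x = 0") (auto simp: powr_diff)
          then have "ennreal (i powr (- 1 / p')) * ennreal (h k x powr p) = ennreal (h k x) * g x"
            using h0[of k x] by (simp add: g_def ennreal_mult[symmetric] mult_ac)
          also have "\<dots> \<le> F x * g x" by (intro mult_right_mono hF) simp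
          finally show "ennreal (i powr (- 1 / p')) * ennreal (h k x powr p) \<le> F x * g x" .
        qed
        finally show ?thesis .
      qed
      ultimately have "ennreal_powr I (1 / p) \<le> D" using i by (simp add: ennreal_powr_ennreal)
      then show ?thesis using p by (simp add: ennreal_powr_le_iff I_def)
    qed
  qed
  have "ennreal_powr (F x) p \<le> (SUP k. ennreal (h k x powr p))" for x
  proof (cases "F x" rule: ennreal_cases)
    case (real r)
    obtain k :: nat where k: "max r (norm x) < real k" using reals_Archimedean2 by blast
    then have "h k x = r" using real by (simp add: h_def min_def)
    then have "ennreal_powr (F x) p = ennreal (h k x powr p)" using real by (simp add: ennreal_powr_ennreal)
    also have "\<dots> \<le> (SUP k. ennreal (h k x powr p))" by (rule SUP_upper) simp
    finally show ?thesis .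
  next
    case top
    \<comment> \<open>Where \<open>F\<close> is infinite, \<open>h k x\<close> equals
      \<open>k\<close> for large \<open>k\<close>, and its power with exponent \<open>p > 1\<close>
      is unbounded.\<close>
    have "of_nat m \<le> (SUP k. ennreal (h k x powr p))" for m :: nat
    proof -
      obtain k0 :: nat where k0: "norm x < real k0" using reals_Archimedean2 by blast
      define k where "k = Suc (max k0 m)"
      have "x \<in> ball 0 (real k)" using k0 by (simp add: k_def)
      then have "h k x = real k" using top by (simp add: h_def min_def top_unique)
      moreover have "real k powr 1 \<le> real k powr p" using p by (intro powr_mono) (auto simp: k_def)
      ultimately have "real m \<le> h k x powr p" by (simp add: k_def)
      then have "of_nat m \<le> ennreal (h k x powr p)" unfolding ennreal_of_nat_eq_real_of_nat by (rule ennreal_leI)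
      also have "\<dots> \<le> (SUP k. ennreal (h k x powr p))" by (rule SUP_upper) simp
      finally show ?thesis .
    qed
    then have "(SUP k. ennreal (h k x powr p)) = \<infinity>"
      by (metis ennreal_SUP_of_nat_eq_top SUP_least infinity_ennreal_def top_unique)
    then show ?thesis by (simp only: infinity_ennreal_def top_greatest)
  qed
  then have "(\<integral>\<^sup>+x. ennreal_powr (F x) p \<partial>?L)
      \<le> (\<integral>\<^sup>+x. (SUP k. ennreal (h k x powr p)) \<partial>?L)"
    by (rule nn_integral_mono)
  also have "\<dots> = (SUP k. \<integral>\<^sup>+x. ennreal (h k x powr p) \<partial>?L)"
  proof (rule nn_integral_monotone_convergence_SUP[OF _ hpm])
    show "incseq (\<lambda>k x. ennreal (h k x powr p))"
    proof (intro incseq_SucI le_funI ennreal_leI powr_mono2)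
      fix k x
      have "enn2real (min (F x) (ennreal (real k))) \<le> enn2real (min (F x) (ennreal (real (Suc k))))"
        by (rule enn2real_mono[OF min.mono[OF order_refl ennreal_leI] min_fin[unfolded infinity_ennreal_def]]) simp
      then show "h k x \<le> h (Suc k) x" unfolding h_def by (intro mult_mono) (auto simp: indicator_def)
    qed (use p h0 in auto)
  qed
  also have "\<dots> \<le> ennreal_powr D p" by (rule SUP_least) (rule le)
  finally show ?thesis .
qed

section \<open>Banach function spaces\<close>

text \<open>Undoes the dilation in \<open>cube_average\<close>; the factor
  \<open>l ^ DIM('a)\<close> is the volume of the cube.\<close>

lemma nn_integral_scaleR:
  fixes F :: "'a::euclidean_space \<Rightarrow> ennreal"
  assumes F: "F \<in> borel_measurable lebesgue" and l: "0 < l"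
  shows "(\<integral>\<^sup>+x. F x \<partial>lebesgue) = ennreal (l ^ DIM('a))
      * (\<integral>\<^sup>+x. F (l *\<^sub>R x) \<partial>lebesgue)"
proof -
  have T: "(\<Sum>j\<in>Basis. (l * (x \<bullet> j)) *\<^sub>R j) = l *\<^sub>R x" for x :: 'a
    by (simp add: scaleR_scaleR[symmetric] scaleR_sum_right[symmetric] euclidean_representation del: scaleR_scaleR)
  have eq: "(lebesgue :: 'a measure)
      = density (distr lebesgue lebesgue (\<lambda>x. l *\<^sub>R x)) (\<lambda>_. ennreal (l ^ DIM('a)))"
    using lebesgue_affine_euclidean[of "\<lambda>_::'a. l" 0] l by (simp add: T prod_constant)
  have "(\<integral>\<^sup>+x. F x \<partial>lebesgue)
      = (\<integral>\<^sup>+x. F x \<partial>density (distr lebesgue lebesgue (\<lambda>x. l *\<^sub>R x)) (\<lambda>_. ennreal (l ^ DIM('a))))"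
    by (subst eq) (rule refl)
  also have "\<dots> = (\<integral>\<^sup>+x. ennreal (l ^ DIM('a))
      * F x \<partial>distr lebesgue lebesgue (\<lambda>x. l *\<^sub>R x))"
    using F by (intro nn_integral_density) auto
  also have "\<dots> = (\<integral>\<^sup>+x. ennreal (l ^ DIM('a)) * F (l *\<^sub>R x) \<partial>lebesgue)"
    using F by (intro nn_integral_distr lebesgue_measurable_scaling) auto
  also have "\<dots> = ennreal (l ^ DIM('a)) * (\<integral>\<^sup>+x. F (l *\<^sub>R x) \<partial>lebesgue)"
    by (intro nn_integral_cmult measurable_compose[OF lebesgue_measurable_scaling F])
  finally show ?thesis .
qed

lemma measurable_on_scaled_cube:
  fixes f :: "'a::euclidean_space \<Rightarrow> ennreal"
  assumes "f \<in> borel_measurable lebesgue"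
  shows "(\<lambda>x. f (l *\<^sub>R x) * indicator (cube a l) (l *\<^sub>R x)) \<in> borel_measurable lebesgue"
proof -
  have "cube a l \<in> sets lebesgue" by (simp add: cube_def)
  then have "(\<lambda>x. f x * indicator (cube a l) x) \<in> borel_measurable lebesgue"
    using assms by (intro borel_measurable_times_ennreal borel_measurable_indicator)
  from measurable_compose[OF lebesgue_measurable_scaling this] show ?thesis .
qed

lemma AE_eq_0_of_balls:
  fixes g :: "'a::euclidean_space \<Rightarrow> ennreal"
  assumes g: "g \<in> borel_measurable lebesgue" and "\<And>k::nat. (\<integral>\<^sup>+x\<in>ball 0 (real k). g x \<partial>lebesgue) = 0"
  shows "AE x in lebesgue. g x = 0"
proof -
  have "AE x in lebesgue. g x * indicator (ball 0 (real k)) x = 0" for k :: nat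
  proof (subst nn_integral_0_iff_AE[symmetric])
    show "(\<lambda>x. g x * indicator (ball 0 (real k)) x) \<in> borel_measurable lebesgue"
      by (rule borel_measurable_times_ennreal[OF g borel_measurable_indicator[OF ball_in_sets_lebesgue]])
  qed (rule assms(2))
  then have "AE x in lebesgue. \<forall>k::nat. g x * indicator (ball 0 (real k)) x = 0"
    by (subst AE_all_countable) blast
  then show ?thesis
  proof eventually_elim
    case (elim x)
    obtain k :: nat where k: "norm x < real k" using reals_Archimedean2 by blast
    have "g x * indicator (ball 0 (real k)) x = 0" using elim by blast
    then show ?case using k by simp
  qed
qed

context banach_function_norm
begin

lemma associate_norm_upper:
  assumes "g \<in> borel_measurable lebesgue" "\<rho> g \<le> 1"
  shows "(\<integral>\<^sup>+x. f x * g x \<partial>lebesgue) \<le> associate_norm \<rho> f"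
  unfolding associate_norm_def using assms by (intro SUP_upper) auto

text \<open>A positive multiple of the indicator of any ball lies in the unit ball of the space, so
  \<open>g\<close> has integral 0 over every ball. Needed for Hoelder's inequality when the other
  factor is infinite.\<close>

lemma associate_norm_eq_0:
  assumes g: "g \<in> borel_measurable lebesgue" and 0: "associate_norm \<rho> g = 0"
  shows "AE x in lebesgue. g x = 0"
proof (rule AE_eq_0_of_balls[OF g])
  fix k :: nat
  let ?i = "indicator (ball 0 (real k)) :: 'a \<Rightarrow> ennreal"
  have im: "?i \<in> borel_measurable lebesgue" by (rule borel_measurable_indicator[OF ball_in_sets_lebesgue])
  have "emeasure lebesgue (ball (0::'a) (real k)) < \<infinity>" by (subst emeasure_lebesgue_ball) auto
  then have "\<rho> ?i < \<infinity>" by (intro indicator_finite ball_in_sets_lebesgue)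
  then obtain r where r: "0 \<le> r" "\<rho> ?i = ennreal r" by (cases "\<rho> ?i" rule: ennreal_cases) auto
  define s where "s = 1 / (r + 1)"
  have s: "0 < s" "s * r \<le> 1" using r by (auto simp: s_def divide_simps)
  have "\<rho> (\<lambda>x. ennreal s * ?i x) = ennreal (s * r)"
    using s r by (subst scale[OF im]) (auto simp: ennreal_mult)
  then have "\<rho> (\<lambda>x. ennreal s * ?i x) \<le> 1" using s by (simp add: ennreal_le_1)
  then have "(\<integral>\<^sup>+x. g x * (ennreal s * ?i x) \<partial>lebesgue) \<le> 0"
    unfolding 0[symmetric] by (intro associate_norm_upper borel_measurable_times_ennreal im) auto
  then have "ennreal s * (\<integral>\<^sup>+x\<in>ball 0 (real k). g x \<partial>lebesgue) = 0"
    by (subst nn_integral_cmult[symmetric, OF borel_measurable_times_ennreal[OF g im]]) (simp add: mult_ac)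
  then show "(\<integral>\<^sup>+x\<in>ball 0 (real k). g x \<partial>lebesgue) = 0" using s by simp
qed

text \<open>The main case rescales \<open>f\<close> to norm 1. In the two degenerate products of 0
  and infinity the right-hand side is 0, so one of the functions must vanish almost
  everywhere.\<close>

lemma holder_associate:
  assumes f: "f \<in> borel_measurable lebesgue" and g: "g \<in> borel_measurable lebesgue"
  shows "(\<integral>\<^sup>+x. f x * g x \<partial>lebesgue) \<le> \<rho> f * associate_norm \<rho> g"
proof (cases "\<rho> f" rule: ennreal_cases)
  case (real r)
  show ?thesis
  proof (cases "r = 0")
    case True
    then have "AE x in lebesgue. f x = 0" using real eq_0_iff[OF f] by simp
    then have "AE x in lebesgue. f x * g x = 0" by eventually_elim simp
    then have "(\<integral>\<^sup>+x. f x * g x \<partial>lebesgue) = 0" using f g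
        by (subst nn_integral_0_iff_AE) auto
    then show ?thesis by simp
  next
    case False
    then have r: "0 < r" using real by simp
    have "\<rho> (\<lambda>x. ennreal (1 / r) * f x) = ennreal (1 / r) * ennreal r"
      using r real by (subst scale[OF f]) auto
    then have "\<rho> (\<lambda>x. ennreal (1 / r) * f x) \<le> 1" using r by (simp add: ennreal_mult[symmetric])
    then have "(\<integral>\<^sup>+x. g x * (ennreal (1 / r) * f x) \<partial>lebesgue) \<le> associate_norm \<rho> g"
      using f by (intro associate_norm_upper) auto
    also have "(\<lambda>x. g x * (ennreal (1 / r) * f x)) = (\<lambda>x. ennreal (1 / r) * (f x * g x))"
        by (simp add: fun_eq_iff mult_ac)
    finally have "ennreal (1 / r) * (\<integral>\<^sup>+x. f x * g x \<partial>lebesgue)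
        \<le> associate_norm \<rho> g"
      using f g by (simp add: nn_integral_cmult)
    then have "ennreal r * (ennreal (1 / r) * (\<integral>\<^sup>+x. f x * g x \<partial>lebesgue))
        \<le> ennreal r * associate_norm \<rho> g"
      by (rule mult_left_mono) simp
    moreover have "ennreal r * ennreal (1 / r) = 1" using r by (simp add: ennreal_mult[symmetric])
    ultimately show ?thesis using real by (simp add: mult.assoc[symmetric])
  qed
next
  case top
  show ?thesis
  proof (cases "associate_norm \<rho> g = 0")
    case True
    from associate_norm_eq_0[OF g this] have "AE x in lebesgue. f x * g x = 0" by eventually_elim simp
    then have "(\<integral>\<^sup>+x. f x * g x \<partial>lebesgue) = 0" using f g
        by (subst nn_integral_0_iff_AE) auto
    then show ?thesis by simp
  next
    case False
    then show ?thesis using top by (simp add: ennreal_top_mult)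
  qed
qed

lemma cube_average_holder:
  assumes f: "f \<in> borel_measurable lebesgue" and g: "g \<in> borel_measurable lebesgue" and l: "0 < l"
  shows "(\<integral>\<^sup>+x\<in>cube a l. f x * g x \<partial>lebesgue)
    \<le> ennreal (l ^ DIM('a)) * (cube_average \<rho> a l f * cube_average (associate_norm \<rho>) a l g)"
proof -
  have c: "cube a l \<in> sets lebesgue" by (simp add: cube_def)
  have "(\<integral>\<^sup>+x\<in>cube a l. f x * g x \<partial>lebesgue) = ennreal (l ^ DIM('a))
      * (\<integral>\<^sup>+x. f (l *\<^sub>R x) * g (l *\<^sub>R x)
          * indicator (cube a l) (l *\<^sub>R x) \<partial>lebesgue)"
    using f g c by (intro nn_integral_scaleR[OF _ l] borel_measurable_times_ennreal borel_measurable_indicator)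
  also have "(\<integral>\<^sup>+x. f (l *\<^sub>R x) * g (l *\<^sub>R x)
      * indicator (cube a l) (l *\<^sub>R x) \<partial>lebesgue)
     = (\<integral>\<^sup>+x. (f (l *\<^sub>R x) * indicator (cube a l) (l *\<^sub>R x)) * (g (l *\<^sub>R x)
         * indicator (cube a l) (l *\<^sub>R x)) \<partial>lebesgue)"
    by (intro nn_integral_cong) (auto simp: indicator_def)
  also have "\<dots> \<le> cube_average \<rho> a l f * cube_average (associate_norm \<rho>) a l g"
    unfolding cube_average_def by (intro holder_associate measurable_on_scaled_cube f g)
  finally show ?thesis by (simp add: mult_left_mono)
qed

lemma cube_average_eq_0D:
  assumes f: "f \<in> borel_measurable lebesgue" and l: "0 < l" and 0: "cube_average \<rho> a l f = 0"
  shows "AE x in lebesgue. x \<in> cube a l \<longrightarrow> f x = 0"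
proof -
  have c: "cube a l \<in> sets lebesgue" by (simp add: cube_def)
  have m: "(\<lambda>x. f x * indicator (cube a l) x) \<in> borel_measurable lebesgue"
    using f c by (intro borel_measurable_times_ennreal borel_measurable_indicator)
  have "AE x in lebesgue. f (l *\<^sub>R x) * indicator (cube a l) (l *\<^sub>R x) = 0"
    using 0 eq_0_iff[OF measurable_on_scaled_cube[OF f]] by (simp add: cube_average_def)
  then have "(\<integral>\<^sup>+x. f (l *\<^sub>R x) * indicator (cube a l) (l *\<^sub>R x) \<partial>lebesgue) = 0"
    by (subst nn_integral_0_iff_AE[OF measurable_on_scaled_cube[OF f]])
  then have "(\<integral>\<^sup>+x. f x * indicator (cube a l) x \<partial>lebesgue) = 0"
    using nn_integral_scaleR[OF m l] by simp
  then have "AE x in lebesgue. f x * indicator (cube a l) x = 0"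
    by (subst (asm) nn_integral_0_iff_AE[OF m])
  then show ?thesis by eventually_elim (auto simp: indicator_def split: if_splits)
qed

text \<open>The axiom \<open>integral_le\<close>, applied on the preimage \<open>E\<close> of the
  cube under the dilation, makes \<open>f\<close> integrable over the cube and hence finite almost
  everywhere there.\<close>

lemma cube_average_finiteD:
  assumes f: "f \<in> borel_measurable lebesgue" and l: "0 < l" and fin: "cube_average \<rho> a l f < \<infinity>"
  shows "AE x in lebesgue. x \<in> cube a l \<longrightarrow> f x < \<infinity>"
proof -
  have c: "cube a l \<in> sets lebesgue" by (simp add: cube_def)
  have m: "(\<lambda>x. f x * indicator (cube a l) x) \<in> borel_measurable lebesgue"
    using f c by (intro borel_measurable_times_ennreal borel_measurable_indicator)
  define E where "E = {x. l *\<^sub>R x \<in> cube a l}"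
  have im: "(\<lambda>x. indicator (cube a l) x :: ennreal) \<in> borel_measurable lebesgue"
    using c by (rule borel_measurable_indicator)
  have E: "E \<in> sets lebesgue"
    using measurable_sets[OF lebesgue_measurable_scaling[of l] c] by (simp add: E_def vimage_def)
  have "ennreal (l ^ DIM('a)) * emeasure lebesgue E = emeasure lebesgue (cube a l)"
  proof -
    have "emeasure lebesgue E = (\<integral>\<^sup>+x. indicator (cube a l) (l *\<^sub>R x) \<partial>lebesgue)"
      unfolding nn_integral_indicator[OF E, symmetric] by (intro nn_integral_cong) (auto simp: E_def indicator_def)
    then show ?thesis using nn_integral_scaleR[OF im l] c by simp
  qed
  then have "ennreal (l ^ DIM('a)) * emeasure lebesgue E < \<infinity>"
    using l emeasure_cube[of l a] by (simp del: emeasure_completion)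
  then have Efin: "emeasure lebesgue E < \<infinity>" using l
      by (auto simp: ennreal_mult_less_top simp del: emeasure_completion)
  obtain C :: real where C: "\<And>h. h \<in> borel_measurable lebesgue
      \<Longrightarrow> (\<integral>\<^sup>+x\<in>E. h x \<partial>lebesgue) \<le> ennreal C * \<rho> h"
    using integral_le[OF E Efin] by blast
  have "(\<integral>\<^sup>+x. f (l *\<^sub>R x) * indicator (cube a l) (l *\<^sub>R x) \<partial>lebesgue)
      = (\<integral>\<^sup>+x\<in>E. f (l *\<^sub>R x) * indicator (cube a l) (l *\<^sub>R x) \<partial>lebesgue)"
    by (intro nn_integral_cong) (auto simp: E_def indicator_def)
  also have "\<dots> \<le> ennreal C * cube_average \<rho> a l f"
    unfolding cube_average_def by (rule C[OF measurable_on_scaled_cube[OF f]])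
  also have "\<dots> < \<infinity>" using fin by (simp add: ennreal_mult_less_top)
  finally have "(\<integral>\<^sup>+x. f x * indicator (cube a l) x \<partial>lebesgue) < \<infinity>"
    using nn_integral_scaleR[OF m l] by (simp add: ennreal_mult_less_top)
  then have "AE x in lebesgue. f x * indicator (cube a l) x \<noteq> \<infinity>"
    by (intro nn_integral_PInf_AE m) auto
  then show ?thesis by eventually_elim (auto simp: indicator_def less_top split: if_splits)
qed

end

section \<open>The hypotheses on the maximal operators and a dyadic maximal function\<close>

lemma maximal_bounded_on_LpD:
  assumes "maximal_bounded_on_Lp \<rho> q" "0 < q"
  obtains C where "0 \<le> C" "\<And>f. f \<in> borel_measurable lebesgue
      \<Longrightarrow> (\<integral>\<^sup>+x. ennreal_powr (f x) q \<partial>lebesgue) \<le> 1 \<Longrightarrow>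
    (\<integral>\<^sup>+x. ennreal_powr (maximal_function \<rho> f x) q \<partial>lebesgue) \<le> ennreal C"
proof -
  obtain C :: real where C: "\<And>f. f \<in> borel_measurable lebesgue
      \<Longrightarrow> Lp_norm q (\<lambda>_. 1) f < \<infinity> \<Longrightarrow>
        Lp_norm q (\<lambda>_. 1) (maximal_function \<rho> f) \<le> ennreal C * Lp_norm q (\<lambda>_. 1) f"
    using assms(1) unfolding maximal_bounded_on_Lp_def by blast
  show ?thesis
  \<comment> \<open>\<open>C\<close> may be negative, in which case \<open>ennreal C\<close> is
    0.\<close>
  proof (rule that[of "max C 0 powr q"])
    fix f :: "'a \<Rightarrow> ennreal"
    assume f: "f \<in> borel_measurable lebesgue" "(\<integral>\<^sup>+x. ennreal_powr (f x) q \<partial>lebesgue) \<le> 1"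
    have 1: "ennreal_powr 1 q = 1" using ennreal_powr_ennreal[of 1 q] by simp
    then have N: "Lp_norm q (\<lambda>_. 1) f \<le> 1" using f(2) by (simp add: Lp_norm_le_iff[OF assms(2)])
    then have "Lp_norm q (\<lambda>_. 1) (maximal_function \<rho> f) \<le> ennreal C * Lp_norm q (\<lambda>_. 1) f"
      by (intro C f) (auto intro: le_less_trans)
    also have "\<dots> \<le> ennreal C * 1" by (intro mult_left_mono N) simp
    also have "\<dots> = ennreal (max C 0)" by (simp add: max_def ennreal_neg)
    finally show "(\<integral>\<^sup>+x. ennreal_powr (maximal_function \<rho> f x) q \<partial>lebesgue)
        \<le> ennreal (max C 0 powr q)"
      by (simp add: Lp_norm_le_iff[OF assms(2)] ennreal_powr_ennreal)
  qed simp
qed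

text \<open>
  The maximal function over the tripled dyadic cubes is used in place of \<open>maximal_function\<close>
  because it is a countable supremum of simple functions, hence measurable.
\<close>

definition dyadic_average ::
    "(('a::euclidean_space \<Rightarrow> ennreal) \<Rightarrow> ennreal) \<Rightarrow> ('a \<Rightarrow> ennreal) \<Rightarrow> int \<Rightarrow> 'a \<Rightarrow> ennreal" where
  "dyadic_average \<rho> f j x = cube_average \<rho> (dyadic_corner j x - 2 powi j *\<^sub>R One) (3 * 2 powi j) f"

definition dyadic_maximal ::
    "(('a::euclidean_space \<Rightarrow> ennreal) \<Rightarrow> ennreal) \<Rightarrow> ('a \<Rightarrow> ennreal) \<Rightarrow> 'a \<Rightarrow> ennreal" where
  "dyadic_maximal \<rho> f x = (SUP j. dyadic_average \<rho> f j x)"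

lemma dyadic_average_le_maximal:
  assumes "y \<in> dyadic j x"
  shows "dyadic_average \<rho> f j x \<le> dyadic_maximal \<rho> f y"
proof -
  have eq: "dyadic_average \<rho> f j x = dyadic_average \<rho> f j y"
    using dyadic_eqD(2)[OF assms] by (simp add: dyadic_average_def)
  show ?thesis unfolding dyadic_maximal_def eq by (rule SUP_upper) simp
qed

lemma dyadic_maximal_le: "dyadic_maximal \<rho> f x \<le> maximal_function \<rho> f x"
  unfolding dyadic_maximal_def
proof (rule SUP_least)
  fix j :: int
  have "x \<in> cube (dyadic_corner j x - 2 powi j *\<^sub>R One) (3 * 2 powi j)"
    using dyadic_subset_triple[of j x] by (auto simp: dyadic_triple_def)
  then show "dyadic_average \<rho> f j x \<le> maximal_function \<rho> f x"
    unfolding dyadic_average_def maximal_function_def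
    by (intro SUP_upper2[of "(dyadic_corner j x - 2 powi j *\<^sub>R One, 3 * 2 powi j)"]) auto
qed

lemma measurable_dyadic_maximal: "dyadic_maximal \<rho> f \<in> borel_measurable lebesgue"
proof -
  have "dyadic_average \<rho> f j \<in> borel_measurable lebesgue" for j
  proof (rule measurable_piecewise_restrict[of "range (dyadic j)"])
    show "countable (range (dyadic j :: 'a \<Rightarrow> 'a set))"
      by (rule countable_subset[OF _ countable_dyadic_cubes]) (auto simp: dyadic_cubes_def)
    show "space lebesgue \<subseteq> \<Union>(range (dyadic j :: 'a \<Rightarrow> 'a set))" using dyadic_refl by fastforce
    fix Q :: "'a set" assume "Q \<in> range (dyadic j)"
    then obtain x where Q: "Q = dyadic j x" by auto
    show "Q \<inter> space lebesgue \<in> sets lebesgue" using sets_dyadic[of j x] by (simp add: Q)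
    have "dyadic_average \<rho> f j y
        = dyadic_average \<rho> f j x" if "y \<in> space (restrict_space lebesgue Q)" for y
      using that dyadic_eqD(2)[of y j x] by (simp add: dyadic_average_def space_restrict_space Q)
    then show "dyadic_average \<rho> f j \<in> borel_measurable (restrict_space lebesgue Q)"
      by (rule measurable_cong[THEN iffD2, OF _ borel_measurable_const])
  qed
  then have "(\<lambda>x. SUP j. dyadic_average \<rho> f j x) \<in> borel_measurable lebesgue"
    by (rule borel_measurable_SUP[OF countableI_type])
  moreover have "dyadic_maximal \<rho> f = (\<lambda>x. SUP j. dyadic_average \<rho> f j x)"
    by (simp add: fun_eq_iff dyadic_maximal_def)
  ultimately show ?thesis by (simp only:)
qed

section \<open>The two-weight estimate\<close>

lemma weight_nonneg: "weight w \<Longrightarrow> 0 \<le> w x"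
  by (simp add: weight_def)

lemma measurable_weight:
  fixes w :: "'a::euclidean_space \<Rightarrow> real"
  assumes "weight w"
  shows "w \<in> borel_measurable lebesgue"
proof (rule borel_measurable_LIMSEQ_real)
  fix k :: nat
  have "w absolutely_integrable_on cball 0 (real k)" using assms by (simp add: weight_def)
  then show "(\<lambda>x. indicator (cball 0 (real k)) x *\<^sub>R w x) \<in> borel_measurable lebesgue"
    by (auto simp: set_integrable_def)
next
  fix x :: 'a
  obtain m :: nat where m: "norm x < real m" using reals_Archimedean2 by blast
  show "(\<lambda>k. indicator (cball 0 (real k)) x *\<^sub>R w x) \<longlonglongrightarrow> w x"
  proof (rule tendsto_eventually, rule eventually_sequentiallyI)
    fix k assume "m \<le> k"
    then have "norm x \<le> real k" using m by linarith
    then show "indicator (cball 0 (real k)) x *\<^sub>R w x = w x" by simp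
  qed
qed

lemma measurable_weight_powr:
  fixes w :: "'a::euclidean_space \<Rightarrow> real"
  assumes "weight w"
  shows "(\<lambda>x. ennreal (w x powr a)) \<in> borel_measurable lebesgue"
proof -
  have "(\<lambda>x. ennreal (x powr a)) \<in> borel_measurable borel" by measurable
  from measurable_compose[OF measurable_weight[OF assms] this] show ?thesis .
qed

text \<open>Centred cubes that exhaust the space and are themselves instances of
  \<open>cube\<close>, so that the bump condition applies to them directly.\<close>

definition big_cube :: "nat \<Rightarrow> 'a::euclidean_space set" where
  "big_cube m = cube (- real m *\<^sub>R One) (2 * real m)"

lemma mem_big_cube: "x \<in> big_cube m \<longleftrightarrow> (\<forall>b\<in>Basis. \<bar>x \<bullet> b\<bar>
    \<le> real m)"
  by (auto simp: big_cube_def cube_def mem_box abs_le_iff minus_le_iff inner_simps)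

lemma ball_subset_big_cube: "ball 0 (real m) \<subseteq> big_cube m"
proof
  fix x :: 'a assume "x \<in> ball 0 (real m)"
  then show "x \<in> big_cube m"
    unfolding mem_big_cube using Basis_le_norm[of _ x] by fastforce
qed

lemma big_cube_mono: "m \<le> k \<Longrightarrow> big_cube m \<subseteq> big_cube k"
  by (force simp: mem_big_cube)

lemma ex_big_cube: "\<exists>m. x \<in> big_cube m"
proof -
  obtain m :: nat where "norm x < real m" using reals_Archimedean2 by blast
  then show ?thesis using ball_subset_big_cube[of m] by auto
qed

lemma sets_big_cube: "big_cube m \<in> sets lebesgue"
  by (simp add: big_cube_def cube_def)

text \<open>Only large cubes are tested, because finiteness of the averages of the inverse weight is
  known only from some size on.\<close>

lemma loc_integrableI:
  fixes f :: "'a::euclidean_space \<Rightarrow> complex"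
  assumes f: "f \<in> borel_measurable lebesgue"
    and fin: "\<And>m. m0 \<le> m \<Longrightarrow> (\<integral>\<^sup>+x\<in>big_cube m. ennreal (cmod (f x)) \<partial>lebesgue) < \<infinity>"
  shows "loc_integrable f"
  unfolding loc_integrable_def
proof (intro ballI impI)
  fix A :: "'a set" assume A: "A \<in> sets lebesgue" "bounded A"
  obtain r where "A \<subseteq> ball 0 r" using bounded_subset_ballD[OF A(2)] by blast
  moreover obtain m :: nat where "max r (real m0) < real m" using reals_Archimedean2 by blast
  ultimately have m: "A \<subseteq> ball 0 (real m)" "m0 \<le> m" by (auto intro: order_trans[OF _ subset_ball])
  show "set_integrable lebesgue A f"
    unfolding set_integrable_def
  proof (rule integrableI_bounded)
    show "(\<lambda>x. indicator A x *\<^sub>R f x) \<in> borel_measurable lebesgue"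
      using f A(1) by (intro borel_measurable_scaleR borel_measurable_indicator)
    have "(\<integral>\<^sup>+x. ennreal (norm (indicator A x *\<^sub>R f x)) \<partial>lebesgue)
        \<le> (\<integral>\<^sup>+x\<in>big_cube m. ennreal (cmod (f x)) \<partial>lebesgue)"
      using m(1) ball_subset_big_cube[of m] by (intro nn_integral_mono) (auto simp: indicator_def)
    also have "\<dots> < \<infinity>" by (rule fin[OF m(2)])
    finally show "(\<integral>\<^sup>+x. ennreal (norm (indicator A x *\<^sub>R f x)) \<partial>lebesgue)
        < \<infinity>" .
  qed
qed

lemma two_weight_bump_upper:
  "0 < l \<Longrightarrow> cube_average X a l (\<lambda>x. ennreal (u x powr (1 / p))) *
     cube_average Y a l (\<lambda>x. inverse (ennreal (v x powr (1 / p)))) \<le> two_weight_bump X Y p u v"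
  unfolding two_weight_bump_def by (rule SUP_upper2[of "(a, l)"]) auto

locale bump_operator = cz_operator K c d T B + X: banach_function_norm X + Y: banach_function_norm Y
  for K :: "'a::euclidean_space \<Rightarrow> 'a \<Rightarrow> complex" and c d T B
  and X Y :: "('a \<Rightarrow> ennreal) \<Rightarrow> ennreal" +
  fixes p p' CX CY :: real
  assumes p: "1 < p" and p': "p' = p / (p - 1)" and CX: "0 \<le> CX" and CY: "0 \<le> CY"
    and MX: "f \<in> borel_measurable lebesgue
        \<Longrightarrow> (\<integral>\<^sup>+x. ennreal_powr (f x) p' \<partial>lebesgue) \<le> 1 \<Longrightarrow>
      (\<integral>\<^sup>+x. ennreal_powr (maximal_function (associate_norm X) f x) p' \<partial>lebesgue)
          \<le> ennreal CX"
    and MY: "f \<in> borel_measurable lebesgue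
        \<Longrightarrow> (\<integral>\<^sup>+x. ennreal_powr (f x) p \<partial>lebesgue) \<le> 1 \<Longrightarrow>
      (\<integral>\<^sup>+x. ennreal_powr (maximal_function (associate_norm Y) f x) p \<partial>lebesgue)
          \<le> ennreal CY"
begin

text \<open>\<open>9 ^ DIM('a)\<close> is the square of the volume ratio of a triple to its cube,
  \<open>CX + CY\<close> comes from Young's inequality, and the summand 1 ensures
  positivity.\<close>

definition bump_const :: real where
  "bump_const = 2 * stop_const * 9 ^ DIM('a) * (CX + CY + 1)"

lemma bump_const_pos: "0 < bump_const"
  using stop_const_pos CX CY by (simp add: bump_const_def)

lemma bilinear_bound:
  assumes u: "weight u" and v: "weight v" and vpos: "AE x in lebesgue. 0 < v x"
    and f: "f \<in> borel_measurable lebesgue" and fl: "loc_integrable f"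
    and fv: "(\<integral>\<^sup>+x. ennreal_powr (ennreal (cmod (f x))) p * ennreal (v x) \<partial>lebesgue) \<le> 1"
    and g: "g \<in> borel_measurable lebesgue" and gp: "(\<integral>\<^sup>+x. ennreal_powr (g x) p' \<partial>lebesgue) \<le> 1"
  shows "(\<integral>\<^sup>+x. maximal_truncation K f x * (ennreal (u x powr (1 / p)) * g x) \<partial>lebesgue)
    \<le> ennreal bump_const * two_weight_bump X Y p u v"
proof -
  let ?L = "lebesgue :: 'a measure" and ?n = "DIM('a)"
  define \<kappa> where "\<kappa> = two_weight_bump X Y p u v"
  define U where "U x = ennreal (u x powr (1 / p))" for x
  define V where "V x = inverse (ennreal (v x powr (1 / p)))" for x
  define \<phi> where "\<phi> x = ennreal (cmod (f x)) * ennreal (v x powr (1 / p))" for x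
  have Um: "U \<in> borel_measurable ?L" unfolding U_def[abs_def] by (rule measurable_weight_powr[OF u])
  have Vm: "V \<in> borel_measurable ?L" unfolding V_def[abs_def]
    by (rule borel_measurable_inverse_ennreal[OF measurable_weight_powr[OF v]])
  have \<phi>m: "\<phi> \<in> borel_measurable ?L" unfolding \<phi>_def[abs_def]
    using f by (intro borel_measurable_times_ennreal measurable_weight_powr[OF v]) auto
  have \<phi>p: "(\<integral>\<^sup>+x. ennreal_powr (\<phi> x) p \<partial>?L) \<le> 1"
    using fv p weight_nonneg[OF v] by (simp add: \<phi>_def ennreal_powr_mult_root)
  \<comment> \<open>The factor \<open>V\<close> is the inverse of the root of the weight only where
    \<open>v\<close> is positive; where \<open>v\<close> vanishes, \<open>\<phi>\<close> is 0 and
    loses \<open>f\<close>.\<close>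
  have fV: "AE x in ?L. ennreal (cmod (f x)) = V x * \<phi> x"
    using vpos
  proof eventually_elim
    case (elim x)
    then have "0 < v x powr (1 / p)" by simp
    then have "V x * ennreal (v x powr (1 / p)) = 1"
      by (simp add: V_def inverse_ennreal ennreal_mult[symmetric])
    then show ?case by (simp add: \<phi>_def mult.left_commute[of "V x"])
  qed
  define m1 where "m1 = dyadic_maximal (associate_norm Y) \<phi>"
  define m2 where "m2 = dyadic_maximal (associate_norm X) g"
  have m12: "m1 \<in> borel_measurable ?L" "m2 \<in> borel_measurable ?L"
    unfolding m1_def m2_def by (rule measurable_dyadic_maximal)+
  \<comment> \<open>Averages over a triple are at most the dyadic maximal functions at every point
    of the cube, so \<open>G\<close> satisfies the pointwise hypothesis of
    \<open>global_bound\<close>.\<close>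
  define G where "G y = ennreal (9 ^ ?n) * \<kappa> * (m1 y * m2 y)" for y
  have Gm: "G \<in> borel_measurable ?L" unfolding G_def[abs_def]
    by (intro borel_measurable_times_ennreal borel_measurable_const m12)
  have "(\<integral>\<^sup>+x. maximal_truncation K f x * (U x * g x) \<partial>?L) \<le> ennreal (2
      * stop_const) * (\<integral>\<^sup>+y. G y \<partial>?L)"
  proof (rule global_bound[OF fl borel_measurable_times_ennreal[OF Um g] Gm])
    fix j :: int and x y :: 'a assume y: "y \<in> dyadic j x"
    define a where "a = dyadic_corner j x - 2 powi j *\<^sub>R One"
    define l :: real where "l = 3 * 2 powi j"
    have l: "0 < l" by (simp add: l_def)
    have tri: "dyadic_triple j x = cube a l" by (simp add: dyadic_triple_def a_def l_def)
    let ?A1 = "cube_average (associate_norm Y) a l \<phi>" and ?A2 = "cube_average (associate_norm X) a l g"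
    have A: "?A1 \<le> m1 y" "?A2 \<le> m2 y"
      using dyadic_average_le_maximal[OF y] unfolding m1_def m2_def dyadic_average_def a_def l_def by blast+
    have 1: "(\<integral>\<^sup>+z\<in>dyadic_triple j x. ennreal (cmod (f z)) \<partial>?L)
        \<le> ennreal (l ^ ?n) * (cube_average Y a l V * ?A1)"
    proof -
      have "(\<integral>\<^sup>+z\<in>dyadic_triple j x. ennreal (cmod (f z)) \<partial>?L)
          = (\<integral>\<^sup>+z\<in>cube a l. V z * \<phi> z \<partial>?L)"
        unfolding tri by (intro nn_integral_cong_AE eventually_mono[OF fV]) simp
      also have "\<dots> \<le> ennreal (l ^ ?n) * (cube_average Y a l V * ?A1)"
        by (rule Y.cube_average_holder[OF Vm \<phi>m l])
      finally show ?thesis .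
    qed
    have 2: "(\<integral>\<^sup>+z\<in>dyadic j x. U z * g z \<partial>?L) \<le> ennreal (l ^ ?n)
        * (cube_average X a l U * ?A2)"
    proof -
      \<comment> \<open>Enlarged to the triple, since both factors of the bump condition must refer
        to the same cube.\<close>
      have "(\<integral>\<^sup>+z\<in>dyadic j x. U z * g z \<partial>?L)
          \<le> (\<integral>\<^sup>+z\<in>cube a l. U z * g z \<partial>?L)"
        unfolding tri[symmetric] by (rule nn_set_integral_mono_set[OF dyadic_subset_triple])
      also have "\<dots> \<le> ennreal (l ^ ?n) * (cube_average X a l U * ?A2)"
        by (rule X.cube_average_holder[OF Um g l])
      finally show ?thesis .
    qed
    have "(\<integral>\<^sup>+z\<in>dyadic_triple j x. ennreal (cmod (f z)) \<partial>?L)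
        * (\<integral>\<^sup>+z\<in>dyadic j x. U z * g z \<partial>?L)
      \<le> ennreal (l ^ ?n) * (cube_average Y a l V * ?A1) * (ennreal (l ^ ?n) * (cube_average X a l U * ?A2))"
      by (intro mult_mono 1 2) auto
    also have "\<dots> = (ennreal (l ^ ?n) * ennreal (l ^ ?n)) * ((cube_average X a l U * cube_average Y a l V)
        * (?A1 * ?A2))"
      by (simp only: mult_ac)
    also have "\<dots> \<le> (ennreal (l ^ ?n) * ennreal (l ^ ?n)) * (\<kappa> * (m1 y * m2 y))"
      unfolding \<kappa>_def U_def V_def using A two_weight_bump_upper[OF l, of X a u p Y v]
      by (intro mult_left_mono mult_mono) auto
    also have "ennreal (l ^ ?n) * ennreal (l ^ ?n) = (emeasure ?L (dyadic j x))\<^sup>2 * ennreal (9 ^ ?n)"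
    proof -
      define s :: real where "s = (2 powi j) ^ ?n"
      have s: "0 < s" by (simp add: s_def)
      have "l ^ ?n = 3 ^ ?n * s" by (simp add: l_def s_def power_mult_distrib)
      moreover have "(3::real) ^ ?n * 3 ^ ?n = 9 ^ ?n" by (simp only: power_mult_distrib[symmetric]) simp
      ultimately have "l ^ ?n * l ^ ?n = s * s * 9 ^ ?n" by (simp add: mult_ac)
      then have "ennreal (l ^ ?n * l ^ ?n) = ennreal (s * s * 9 ^ ?n)" by simp
      then show ?thesis
        using l s unfolding emeasure_dyadic s_def[symmetric] by (simp add: power2_eq_square ennreal_mult)
    qed
    finally show "(\<integral>\<^sup>+z\<in>dyadic_triple j x. ennreal (cmod (f z)) \<partial>?L)
        * (\<integral>\<^sup>+z\<in>dyadic j x. U z * g z \<partial>?L)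
        \<le> (emeasure ?L (dyadic j x))\<^sup>2 * G y"
      by (simp only: G_def mult.assoc)
  qed
  also have "(\<integral>\<^sup>+y. G y \<partial>?L) = ennreal (9 ^ ?n) * \<kappa>
      * (\<integral>\<^sup>+y. m1 y * m2 y \<partial>?L)"
    unfolding G_def by (intro nn_integral_cmult borel_measurable_times_ennreal m12)
  \<comment> \<open>Both \<open>\<phi>\<close> and \<open>g\<close> are normalised, so Young's
    inequality reduces the product to the two maximal bounds.\<close>
  also have "(\<integral>\<^sup>+y. m1 y * m2 y \<partial>?L)
      \<le> (\<integral>\<^sup>+y. ennreal_powr (m1 y) p + ennreal_powr (m2 y) p' \<partial>?L)"
    by (intro nn_integral_mono ennreal_Youngs_inequality[OF p p'])
  also have "\<dots> = (\<integral>\<^sup>+y. ennreal_powr (m1 y) p \<partial>?L)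
      + (\<integral>\<^sup>+y. ennreal_powr (m2 y) p' \<partial>?L)"
    by (intro nn_integral_add measurable_compose[OF m12(1) measurable_ennreal_powr] measurable_compose[OF m12(2) measurable_ennreal_powr])
  also have "\<dots> \<le> ennreal CY + ennreal CX"
  proof (rule add_mono)
    have "(\<integral>\<^sup>+y. ennreal_powr (m1 y) p \<partial>?L)
        \<le> (\<integral>\<^sup>+y. ennreal_powr (maximal_function (associate_norm Y) \<phi> y) p \<partial>?L)"
      using p unfolding m1_def by (intro nn_integral_mono ennreal_powr_mono dyadic_maximal_le) auto
    also have "\<dots> \<le> ennreal CY" by (rule MY[OF \<phi>m \<phi>p])
    finally show "(\<integral>\<^sup>+y. ennreal_powr (m1 y) p \<partial>?L) \<le> ennreal CY" .
    have "(\<integral>\<^sup>+y. ennreal_powr (m2 y) p' \<partial>?L)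
        \<le> (\<integral>\<^sup>+y. ennreal_powr (maximal_function (associate_norm X) g y) p' \<partial>?L)"
      using conjugate_exponent(1)[OF p p'] unfolding m2_def by (intro nn_integral_mono ennreal_powr_mono dyadic_maximal_le) auto
    also have "\<dots> \<le> ennreal CX" by (rule MX[OF g gp])
    finally show "(\<integral>\<^sup>+y. ennreal_powr (m2 y) p' \<partial>?L) \<le> ennreal CX" .
  qed
  also have "\<dots> \<le> ennreal (CX + CY + 1)" using CX CY by (simp add: ennreal_leI flip: ennreal_plus)
  finally have "(\<integral>\<^sup>+x. maximal_truncation K f x * (U x * g x) \<partial>?L) \<le> ennreal (2
      * stop_const) * (ennreal (9 ^ ?n) * \<kappa> * ennreal (CX + CY + 1))"
    by (simp add: mult_left_mono)
  also have "\<dots> = (ennreal (2 * stop_const) * ennreal (9 ^ ?n) * ennreal (CX + CY + 1)) * \<kappa>"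
      by (simp only: mult_ac)
  also have "ennreal (2 * stop_const) * ennreal (9 ^ ?n) * ennreal (CX + CY + 1) = ennreal bump_const"
  proof -
    have "0 \<le> 2 * stop_const" "0 \<le> CX + CY + 1" using stop_const_pos CX CY by auto
    then show ?thesis unfolding bump_const_def by (simp only: ennreal_mult mult_nonneg_nonneg zero_le_power zero_le_numeral)
  qed
  finally show ?thesis unfolding U_def \<kappa>_def .
qed

text \<open>A finite product bounds its second factor only if the first is nonzero. Since
  \<open>u\<close> is not null, its average is nonzero on all sufficiently large centred
  cubes.\<close>

lemma finite_bump_imp:
  assumes u: "weight u" and v: "weight v" and fin: "two_weight_bump X Y p u v < \<infinity>"
    and u0: "\<not> (AE x in lebesgue. u x = 0)"
  obtains m0 where "0 < m0"
    "\<And>m. m0 \<le> m \<Longrightarrow> cube_average Y (- real m *\<^sub>R One) (2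
        * real m) (\<lambda>x. inverse (ennreal (v x powr (1 / p)))) < \<infinity>"
proof -
  have "\<exists>m0. \<not> (AE x in lebesgue. x \<in> big_cube m0 \<longrightarrow> u x = 0)"
  proof (rule ccontr)
    assume "\<not> ?thesis"
    then have "AE x in lebesgue. \<forall>m::nat. x \<in> big_cube m \<longrightarrow> u x = 0"
        by (subst AE_all_countable) blast
    then have "AE x in lebesgue. u x = 0" by eventually_elim (use ex_big_cube in blast)
    then show False using u0 by simp
  qed
  then obtain m0 where m0: "\<not> (AE x in lebesgue. x \<in> big_cube m0 \<longrightarrow> u x = 0)" by blast
  show ?thesis
  proof (rule that[of "Suc m0"])
    fix m assume m: "Suc m0 \<le> m"
    let ?a = "- real m *\<^sub>R One :: 'a" and ?l = "2 * real m"
    have l: "0 < ?l" using m by simp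
    have "cube_average X ?a ?l (\<lambda>x. ennreal (u x powr (1 / p))) \<noteq> 0"
    proof
      assume "cube_average X ?a ?l (\<lambda>x. ennreal (u x powr (1 / p))) = 0"
      from X.cube_average_eq_0D[OF measurable_weight_powr[OF u] l this]
      have "AE x in lebesgue. x \<in> big_cube m0 \<longrightarrow> u x = 0"
      proof eventually_elim
        case (elim x)
        then show ?case using big_cube_mono[of m0 m] m weight_nonneg[OF u, of x] by (auto simp: big_cube_def)
      qed
      then show False using m0 by simp
    qed
    moreover have "cube_average X ?a ?l (\<lambda>x. ennreal (u x powr (1 / p)))
        * cube_average Y ?a ?l (\<lambda>x. inverse (ennreal (v x powr (1 / p)))) < \<infinity>"
      by (rule le_less_trans[OF two_weight_bump_upper[OF l] fin])
    ultimately show "cube_average Y ?a ?l (\<lambda>x. inverse (ennreal (v x powr (1 / p)))) < \<infinity>"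
      by (auto simp: ennreal_mult_less_top)
  qed simp
qed

text \<open>The inverse power is infinite where \<open>v\<close> vanishes, while a finite average
  forces finiteness almost everywhere on the cube.\<close>

lemma weight_pos_AE:
  assumes v: "weight v" and m0: "0 < m0"
    and fin: "\<And>m. m0 \<le> m \<Longrightarrow> cube_average Y (- real m *\<^sub>R One) (2
        * real m) (\<lambda>x. inverse (ennreal (v x powr (1 / p)))) < \<infinity>"
  shows "AE x in lebesgue. 0 < v x"
proof -
  have "AE x in lebesgue. x \<in> big_cube (m0 + m) \<longrightarrow> 0 < v x" for m
  proof -
    have l: "0 < 2 * real (m0 + m)" using m0 by simp
    have "AE x in lebesgue. x \<in> big_cube (m0 + m) \<longrightarrow> inverse (ennreal (v x powr (1 / p)))
        < \<infinity>"
      unfolding big_cube_def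
      by (rule Y.cube_average_finiteD[OF borel_measurable_inverse_ennreal[OF measurable_weight_powr[OF v]] l fin]) simp
    then show ?thesis
    proof eventually_elim
      case (elim x)
      then show ?case using weight_nonneg[OF v, of x] by (cases "v x = 0") auto
    qed
  qed
  then have "AE x in lebesgue. \<forall>m. x \<in> big_cube (m0 + m) \<longrightarrow> 0 < v x"
      by (subst AE_all_countable) blast
  then show ?thesis
  proof eventually_elim
    case (elim x)
    obtain m where "x \<in> big_cube m" using ex_big_cube by blast
    then have "x \<in> big_cube (m0 + m)" using big_cube_mono[of m "m0 + m"] by auto
    then show ?case using elim by blast
  qed
qed

text \<open>Hoelder's inequality for \<open>Y\<close> on a centred cube leaves the average of
  \<open>\<phi>\<close> in the associate norm, about which the bump condition is silent; it is
  finite by the bound on the maximal operator.\<close>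

lemma loc_integrable_of_finite_bump:
  assumes v: "weight v" and m0: "0 < m0"
    and fin: "\<And>m. m0 \<le> m \<Longrightarrow> cube_average Y (- real m *\<^sub>R One) (2
        * real m) (\<lambda>x. inverse (ennreal (v x powr (1 / p)))) < \<infinity>"
    and f: "f \<in> borel_measurable lebesgue"
    and fv: "(\<integral>\<^sup>+x. ennreal_powr (ennreal (cmod (f x))) p * ennreal (v x) \<partial>lebesgue) \<le> 1"
  shows "loc_integrable f"
proof (rule loc_integrableI[OF f])
  fix m assume m: "m0 \<le> m"
  let ?L = "lebesgue :: 'a measure"
  let ?a = "- real m *\<^sub>R One :: 'a" and ?l = "2 * real m"
  have l: "0 < ?l" using m m0 by simp
  define V where "V x = inverse (ennreal (v x powr (1 / p)))" for x
  define \<phi> where "\<phi> x = ennreal (cmod (f x)) * ennreal (v x powr (1 / p))" for x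
  have Vm: "V \<in> borel_measurable ?L" unfolding V_def[abs_def]
    by (rule borel_measurable_inverse_ennreal[OF measurable_weight_powr[OF v]])
  have \<phi>m: "\<phi> \<in> borel_measurable ?L" unfolding \<phi>_def[abs_def]
    using f by (intro borel_measurable_times_ennreal measurable_weight_powr[OF v]) auto
  have \<phi>p: "(\<integral>\<^sup>+x. ennreal_powr (\<phi> x) p \<partial>?L) \<le> 1"
    using fv p weight_nonneg[OF v] by (simp add: \<phi>_def ennreal_powr_mult_root)
  have avfin: "cube_average (associate_norm Y) ?a ?l \<phi> < \<infinity>"
  proof (rule ccontr)
    \<comment> \<open>An infinite average over one cube makes the maximal function infinite on that
      whole cube, which has positive measure.\<close>
    assume "\<not> ?thesis"
    then have top: "cube_average (associate_norm Y) ?a ?l \<phi> = \<infinity>" by (simp add: not_less top_unique)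
    have "maximal_function (associate_norm Y) \<phi> x = \<infinity>" if "x \<in> big_cube m" for x
    proof -
      have "cube_average (associate_norm Y) ?a ?l \<phi> \<le> maximal_function (associate_norm Y) \<phi> x"
        unfolding maximal_function_def using that l by (intro SUP_upper2[of "(?a, ?l)"]) (auto simp: big_cube_def)
      then show ?thesis using top by (simp add: top_unique)
    qed
    then have "(\<integral>\<^sup>+x. \<infinity> * indicator (big_cube m) x \<partial>?L)
        \<le> (\<integral>\<^sup>+x. ennreal_powr (maximal_function (associate_norm Y) \<phi> x) p \<partial>?L)"
      by (intro nn_integral_mono) (auto simp: indicator_def)
    also have "\<dots> \<le> ennreal CY" by (rule MY[OF \<phi>m \<phi>p])
    finally have "\<infinity> * emeasure ?L (big_cube m) \<le> ennreal CY"
      by (subst (asm) nn_integral_cmult_indicator[OF sets_big_cube])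
    moreover have "emeasure ?L (big_cube m :: 'a set) = ennreal (?l ^ DIM('a))"
      unfolding big_cube_def using l by (intro emeasure_cube) simp
    ultimately show False using l by (simp add: ennreal_top_mult top_unique)
  qed
  have vpos: "AE x in ?L. 0 < v x" by (rule weight_pos_AE[OF v m0 fin])
  have "(\<integral>\<^sup>+x\<in>big_cube m. ennreal (cmod (f x)) \<partial>?L)
      = (\<integral>\<^sup>+x\<in>cube ?a ?l. V x * \<phi> x \<partial>?L)"
    unfolding big_cube_def
  proof (rule nn_integral_cong_AE)
    show "AE x in ?L. ennreal (cmod (f x)) * indicator (cube ?a ?l) x = V x * \<phi> x * indicator (cube ?a ?l) x"
      using vpos
    proof eventually_elim
      case (elim x)
      then have "0 < v x powr (1 / p)" by simp
      then have "V x * ennreal (v x powr (1 / p)) = 1"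
        by (simp add: V_def inverse_ennreal ennreal_mult[symmetric])
      then show ?case by (simp add: \<phi>_def mult.left_commute[of "V x"])
    qed
  qed
  also have "\<dots> \<le> ennreal (?l ^ DIM('a)) * (cube_average Y ?a ?l V
      * cube_average (associate_norm Y) ?a ?l \<phi>)"
    by (rule Y.cube_average_holder[OF Vm \<phi>m l])
  also have "\<dots> < \<infinity>" using fin[OF m] avfin by (simp add: ennreal_mult_less_top V_def[abs_def])
  finally show "(\<integral>\<^sup>+x\<in>big_cube m. ennreal (cmod (f x)) \<partial>?L) < \<infinity>" .
qed

lemma weighted_opnorm_le:
  assumes u: "weight u" and v: "weight v"
  shows "weighted_opnorm p v u (maximal_truncation K) \<le> ennreal bump_const * two_weight_bump X Y p u v"
proof (cases "two_weight_bump X Y p u v = \<infinity>")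
  \<comment> \<open>The right-hand side is infinite because \<open>bump_const\<close> is
    positive.\<close>
  case True
  then show ?thesis using bump_const_pos by (simp add: ennreal_mult_top)
next
  case False
  then have bfin: "two_weight_bump X Y p u v < \<infinity>" by (simp add: less_top)
  have p0: "0 < p" using p by simp
  show ?thesis
    unfolding weighted_opnorm_def
  proof (rule SUP_least, clarify)
    fix f :: "'a \<Rightarrow> complex" assume f: "f \<in> borel_measurable lebesgue" and "Lp_norm p v (modulus f) \<le> 1"
    then have fv: "(\<integral>\<^sup>+x. ennreal_powr (ennreal (cmod (f x))) p
        * ennreal (v x) \<partial>lebesgue) \<le> 1"
      using ennreal_powr_ennreal[of 1 p] by (simp add: Lp_norm_le_iff[OF p0])
    show "Lp_norm p u (maximal_truncation K f) \<le> ennreal bump_const * two_weight_bump X Y p u v"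
      unfolding Lp_norm_le_iff[OF p0]
    proof (cases "AE x in lebesgue. u x = 0")
      \<comment> \<open>Here the bump constant can be finite without any information on
        \<open>v\<close>, so \<open>f\<close> need not be locally integrable; but the left-hand side
        vanishes.\<close>
      case True
      have "(\<integral>\<^sup>+x. ennreal_powr (maximal_truncation K f x) p
          * ennreal (u x) \<partial>lebesgue) = (\<integral>\<^sup>+x. 0 \<partial>(lebesgue :: 'a measure))"
        by (intro nn_integral_cong_AE eventually_mono[OF True]) simp
      then show "(\<integral>\<^sup>+x. ennreal_powr (maximal_truncation K f x) p * ennreal (u x) \<partial>lebesgue)
          \<le> ennreal_powr (ennreal bump_const * two_weight_bump X Y p u v) p" by simp
    next
      case False
      obtain m0 where m0: "0 < m0"
        "\<And>m. m0 \<le> m \<Longrightarrow> cube_average Y (- real m *\<^sub>R One) (2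
            * real m) (\<lambda>x. inverse (ennreal (v x powr (1 / p)))) < \<infinity>"
        by (rule finite_bump_imp[OF u v bfin False]) (rule that)
      have vpos: "AE x in lebesgue. 0 < v x" by (rule weight_pos_AE[OF v m0])
      have fl: "loc_integrable f" by (rule loc_integrable_of_finite_bump[OF v m0 f fv])
      have "(\<integral>\<^sup>+x. ennreal_powr (maximal_truncation K f x
          * ennreal (u x powr (1 / p))) p \<partial>lebesgue)
          \<le> ennreal_powr (ennreal bump_const * two_weight_bump X Y p u v) p"
      proof (rule nn_integral_powr_le_dual[OF p p'])
        show "(\<lambda>x. maximal_truncation K f x * ennreal (u x powr (1 / p))) \<in> borel_measurable lebesgue"
          by (intro borel_measurable_times_ennreal measurable_maximal_truncation fl measurable_weight_powr u)
        fix g :: "'a \<Rightarrow> ennreal"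
        assume "g \<in> borel_measurable lebesgue" "(\<integral>\<^sup>+x. ennreal_powr (g x) p' \<partial>lebesgue) \<le> 1"
        from bilinear_bound[OF u v vpos f fl fv this]
        show "(\<integral>\<^sup>+x. maximal_truncation K f x * ennreal (u x powr (1 / p)) * g x \<partial>lebesgue)
            \<le> ennreal bump_const * two_weight_bump X Y p u v"
          by (simp add: mult.assoc)
      qed
      then show "(\<integral>\<^sup>+x. ennreal_powr (maximal_truncation K f x) p * ennreal (u x) \<partial>lebesgue)
          \<le> ennreal_powr (ennreal bump_const * two_weight_bump X Y p u v) p"
        by (simp add: ennreal_powr_mult_root[OF p0 weight_nonneg[OF u]])
    qed
  qed
qed

end

section \<open>Passage from the given definitions to the locales\<close>

lemma L2_norm_eq: "Lp_norm 2 (\<lambda>_. 1) (modulus f)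
    = ennreal_powr (\<integral>\<^sup>+x. ennreal ((cmod (f x))\<^sup>2) \<partial>lebesgue) (1 / 2)"
  by (simp add: Lp_norm_def ennreal_powr_ennreal)

lemma L2_functions_iff: "f \<in> L2_functions \<longleftrightarrow> square_integrable f"
  by (auto simp: L2_functions_def square_integrable_def L2_norm_eq ennreal_powr_def less_top[symmetric])

lemma CZ_kernel_imp:
  fixes K :: "'a::euclidean_space \<Rightarrow> 'a \<Rightarrow> complex"
  assumes "CZ_kernel K"
  obtains c d where "cz_kernel K c d"
proof -
  obtain c d :: real where d: "0 < d" "d \<le> 1"
    and s: "\<And>x y. x \<noteq> y \<Longrightarrow> cmod (K x y) \<le> c / norm (x - y) ^ DIM('a)"
    and r: "\<And>x x' y. norm (x - x') < norm (x - y) / 2 \<Longrightarrow>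
           cmod (K x y - K x' y) + cmod (K y x - K y x')
             \<le> c * (norm (x - x') powr d / norm (x - y) powr (DIM('a) + d))"
    using assms unfolding CZ_kernel_def by blast
  \<comment> \<open>The given constant is of unspecified sign; enlarging it keeps all estimates and
    makes it positive.\<close>
  have "cz_kernel K (max c 1) d"
  proof
    show "0 < max c 1" "0 < d" "d \<le> 1" using d by auto
    show "cmod (K x y) \<le> max c 1 / norm (x - y) ^ DIM('a)" if "x \<noteq> y" for x y
      by (rule order_trans[OF s[OF that] divide_right_mono]) auto
    fix x x' y :: 'a assume xy: "norm (x - x') < norm (x - y) / 2"
    have "c * (norm (x - x') powr d / norm (x - y) powr (DIM('a) + d)) \<le> max c 1
        * (norm (x - x') powr d / norm (x - y) powr (DIM('a) + d))"
      by (rule mult_right_mono) auto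
    then show "cmod (K x y - K x' y) \<le> max c 1 * (norm (x - x') powr d / norm (x - y) powr (DIM('a) + d))"
      "cmod (K y x - K y x') \<le> max c 1 * (norm (x - x') powr d / norm (x - y) powr (DIM('a) + d))"
      using r[OF xy] norm_ge_zero[of "K x y - K x' y"] norm_ge_zero[of "K y x - K y x'"] by linarith+
  qed
  then show ?thesis by (rule that)
qed

lemma CZ_operator_imp:
  fixes T :: "('a::euclidean_space \<Rightarrow> complex) \<Rightarrow> 'a \<Rightarrow> complex"
  assumes "CZ_operator T K"
  obtains c d B where "cz_operator K c d T B"
proof -
  have K: "CZ_kernel K"
    and T: "\<And>f. square_integrable f \<Longrightarrow> square_integrable (T f)"
    and lin: "\<And>f g a b. square_integrable f \<Longrightarrow> square_integrable g \<Longrightarrow>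
        AE x in lebesgue. T (\<lambda>y. a * f y + b * g y) x = a * T f x + b * T g x"
    and bd: "\<exists>C::real. \<forall>f \<in> L2_functions.
        Lp_norm 2 (\<lambda>_. 1) (modulus (T f)) \<le> ennreal C * Lp_norm 2 (\<lambda>_. 1) (modulus f)"
    and ker: "\<And>f. square_integrable f \<Longrightarrow>
        AE x in lebesgue. x \<notin> closure {y. f y \<noteq> 0} \<longrightarrow> T f x
            = (LINT y|lebesgue. K x y * f y)"
    using assms unfolding CZ_operator_def L2_functions_iff[symmetric] by blast+
  obtain c d where cd: "cz_kernel K c d" by (rule CZ_kernel_imp[OF K])
  obtain C :: real where C0: "\<forall>f \<in> L2_functions.
      Lp_norm 2 (\<lambda>_. 1) (modulus (T f)) \<le> ennreal C * Lp_norm 2 (\<lambda>_. 1) (modulus f)"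
    using bd by (rule exE)
  have C: "ennreal_powr (\<integral>\<^sup>+x. ennreal ((cmod (T f x))\<^sup>2) \<partial>lebesgue) (1 / 2)
      \<le> ennreal C * ennreal_powr (\<integral>\<^sup>+x. ennreal ((cmod (f x))\<^sup>2) \<partial>lebesgue) (1 / 2)" if "square_integrable f" for f
    using bspec[OF C0, of f] that unfolding L2_functions_iff L2_norm_eq by simp
  \<comment> \<open>The square appears because \<open>B\<close> bounds integrals of squares;
    \<open>max C 0\<close> covers a negative \<open>C\<close>, and the summand 1 makes
    \<open>B\<close> positive.\<close>
  have "cz_operator K c d T ((max C 0)\<^sup>2 + 1)"
  proof (intro cz_operator.intro cd cz_operator_axioms.intro)
    show "0 < (max C 0)\<^sup>2 + 1" by (rule add_nonneg_pos) auto
    show "square_integrable (T f)" if "square_integrable f" for f by (rule T[OF that])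
    show "AE x in lebesgue. T (\<lambda>y. f y + g y) x = T f x
        + T g x" if "square_integrable f" "square_integrable g" for f g
      using lin[OF that, of 1 1] by simp
    show "AE x in lebesgue. x \<notin> closure {y. f y \<noteq> 0} \<longrightarrow> T f x
        = (LINT y|lebesgue. K x y * f y)" if "square_integrable f" for f
      by (rule ker[OF that])
    fix f :: "'a \<Rightarrow> complex" assume f: "square_integrable f"
    define I where "I = (\<integral>\<^sup>+x. ennreal ((cmod (f x))\<^sup>2) \<partial>lebesgue)"
    have "I < \<infinity>" using f by (simp add: I_def square_integrable_def)
    then obtain i where i: "0 \<le> i" "I = ennreal i" by (cases I rule: ennreal_cases) auto
    have Cm: "ennreal C = ennreal (max C 0)" by (simp add: max_def ennreal_neg)
    have "(\<integral>\<^sup>+x. ennreal ((cmod (T f x))\<^sup>2) \<partial>lebesgue)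
        \<le> ennreal_powr (ennreal C * ennreal_powr I (1 / 2)) 2"
      using C[OF f] unfolding I_def by (subst ennreal_powr_le_iff[symmetric]) auto
    also have "ennreal C * ennreal_powr I (1 / 2) = ennreal (max C 0 * sqrt i)"
      unfolding Cm using i by (simp add: ennreal_powr_ennreal powr_half_sqrt ennreal_mult)
    also have "ennreal_powr \<dots> 2 = ennreal ((max C 0)\<^sup>2 * i)"
      using i by (simp add: ennreal_powr_ennreal power_mult_distrib)
    also have "\<dots> \<le> ennreal (((max C 0)\<^sup>2 + 1) * i)" using i
        by (intro ennreal_leI mult_right_mono) auto
    also have "\<dots> = ennreal ((max C 0)\<^sup>2 + 1) * I" using i by (simp add: ennreal_mult)
    finally show "(\<integral>\<^sup>+x. ennreal ((cmod (T f x))\<^sup>2) \<partial>lebesgue)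
        \<le> ennreal ((max C 0)\<^sup>2 + 1)
            * (\<integral>\<^sup>+x. ennreal ((cmod (f x))\<^sup>2) \<partial>lebesgue)"
      unfolding I_def .
  qed
  then show ?thesis by (rule that)
qed

theorem theorem1p3:
  fixes T :: "(real ^ 'n \<Rightarrow> complex) \<Rightarrow> real ^ 'n \<Rightarrow> complex"
    and K :: "real ^ 'n \<Rightarrow> real ^ 'n \<Rightarrow> complex"
    and X Y :: "(real ^ 'n \<Rightarrow> ennreal) \<Rightarrow> ennreal"
    and p p' :: real
  assumes "CZ_operator T K"
    and "1 < p" and "p' = p / (p - 1)"
    and "banach_function_norm X" and "banach_function_norm Y"
    and "maximal_bounded_on_Lp (associate_norm X) p'"
    and "maximal_bounded_on_Lp (associate_norm Y) p"
  shows "\<exists>c::real. 0 < c \<and> (\<forall>u v. weight u \<longrightarrow> weight v \<longrightarrow>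
           weighted_opnorm p v u (maximal_truncation K) \<le> ennreal c * two_weight_bump X Y p u v)"
proof -
  obtain c d B where T: "cz_operator K c d T B" by (rule CZ_operator_imp[OF assms(1)])
  have p': "0 < p'" using conjugate_exponent(1)[OF assms(2,3)] by simp
  obtain CX where CX: "0 \<le> CX" "\<And>f. f \<in> borel_measurable lebesgue
      \<Longrightarrow> (\<integral>\<^sup>+x. ennreal_powr (f x) p' \<partial>lebesgue) \<le> 1 \<Longrightarrow>
      (\<integral>\<^sup>+x. ennreal_powr (maximal_function (associate_norm X) f x) p' \<partial>lebesgue)
          \<le> ennreal CX"
    by (rule maximal_bounded_on_LpD[OF assms(6) p']) (rule that)
  obtain CY where CY: "0 \<le> CY" "\<And>f. f \<in> borel_measurable lebesgue
      \<Longrightarrow> (\<integral>\<^sup>+x. ennreal_powr (f x) p \<partial>lebesgue) \<le> 1 \<Longrightarrow>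
      (\<integral>\<^sup>+x. ennreal_powr (maximal_function (associate_norm Y) f x) p \<partial>lebesgue)
          \<le> ennreal CY"
    by (rule maximal_bounded_on_LpD[OF assms(7)]) (use assms(2) in simp, rule that)
  interpret bump_operator K c d T B X Y p p' CX CY
    by (intro bump_operator.intro T assms(4,5) bump_operator_axioms.intro assms(2,3) CX CY)
  show ?thesis using bump_const_pos weighted_opnorm_le by blast
qed

end
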